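(* The following are equivalent over $\mathsf{RCA}_0$. (1) $\mathsf{ACA}_0$. (2) Every infinite partial order with no infinite antichain has a $(0,\infty)$-homogeneous chain. (3) Every infinite well-partial-order has a $(0,\infty)$-homogeneous chain.
   Context: We work in second-order arithmetic; all partial orders have domain a subset of $\mathbb{N}$. $\mathsf{RCA}_0$ is the usual base system (discretely ordered commutative semi-ring axioms for $\mathbb{N}$, $\Sigma^0_1$ induction, $\Delta^0_1$ comprehension), and $\mathsf{ACA}_0$ is $\mathsf{RCA}_0$ plus the scheme of universal closures of $\exists X\,\forall n\,(n\in X\leftrightarrow\varphi(n))$ for arithmetical formulas $\varphi$ in which $X$ is not free. In a partial order $(P,<_P)$, elements $p,q$ are comparable if $p\leq_P q$ or $q\leq_P p$; a chain is a set of pairwise comparable elements and an antichain is a set of pairwise incomparable elements. An infinite chain $C\subseteq P$ is $(0,\infty)$-homogeneous for $P$ if every $p\in P$ is comparable with either no element of $C$ or infinitely many elements of $C$. $(P,<_P)$ is a well-partial-order if for every function $h\colon\mathbb{N}\to P$ there are $m<n$ with $h(m)\leq_P h(n)$. *)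

theory Defs
  imports Main
begin

section \<open>The language of second-order arithmetic\<close>

text \<open>
  Number variables and set variables are two separate sorts, both named by natural numbers.
  Equality is primitive for numbers only.
\<close>

datatype tm =
    Var nat
  | Zero ("\<^bold>0")
  | One ("\<^bold>1")
  | Plus tm tm (infixl "\<^bold>+" 65)
  | Times tm tm (infixl "\<^bold>*" 70)

datatype fm =
    Eq tm tm (infix "\<^bold>=" 50)
  | Less tm tm (infix "\<^bold><" 50)
  | Mem tm nat (infix "\<^bold>\<in>" 50)
  | Neg fm ("\<^bold>\<not> _" [40] 40)
  | Conj fm fm (infixr "\<^bold>\<and>" 35)
  | Disj fm fm (infixr "\<^bold>\<or>" 30)
  | Imp fm fm (infixr "\<^bold>\<longrightarrow>" 25)
  | Iff fm fm (infixr "\<^bold>\<longleftrightarrow>" 25)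
  | All nat fm ("(3\<^bold>\<forall>_./ _)" [0, 10] 10)
  | Ex nat fm ("(3\<^bold>\<exists>_./ _)" [0, 10] 10)
  | AllS nat fm ("(3\<^bold>\<forall>\<^sub>s_./ _)" [0, 10] 10)
  | ExS nat fm ("(3\<^bold>\<exists>\<^sub>s_./ _)" [0, 10] 10)

primrec vars_tm :: "tm \<Rightarrow> nat set" where
  "vars_tm (Var x) = {x}"
| "vars_tm \<^bold>0 = {}"
| "vars_tm \<^bold>1 = {}"
| "vars_tm (s \<^bold>+ t) = vars_tm s \<union> vars_tm t"
| "vars_tm (s \<^bold>* t) = vars_tm s \<union> vars_tm t"

primrec free_set_vars :: "fm \<Rightarrow> nat set" where
  "free_set_vars (s \<^bold>= t) = {}"
| "free_set_vars (s \<^bold>< t) = {}"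
| "free_set_vars (t \<^bold>\<in> X) = {X}"
| "free_set_vars (\<^bold>\<not> \<phi>) = free_set_vars \<phi>"
| "free_set_vars (\<phi> \<^bold>\<and> \<psi>) = free_set_vars \<phi> \<union> free_set_vars \<psi>"
| "free_set_vars (\<phi> \<^bold>\<or> \<psi>) = free_set_vars \<phi> \<union> free_set_vars \<psi>"
| "free_set_vars (\<phi> \<^bold>\<longrightarrow> \<psi>) = free_set_vars \<phi> \<union> free_set_vars \<psi>"
| "free_set_vars (\<phi> \<^bold>\<longleftrightarrow> \<psi>) = free_set_vars \<phi> \<union> free_set_vars \<psi>"
| "free_set_vars (\<^bold>\<forall>x. \<phi>) = free_set_vars \<phi>"
| "free_set_vars (\<^bold>\<exists>x. \<phi>) = free_set_vars \<phi>"
| "free_set_vars (\<^bold>\<forall>\<^sub>sX. \<phi>) = free_set_vars \<phi> - {X}"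
| "free_set_vars (\<^bold>\<exists>\<^sub>sX. \<phi>) = free_set_vars \<phi> - {X}"

primrec subst_tm :: "nat \<Rightarrow> tm \<Rightarrow> tm \<Rightarrow> tm" where
  "subst_tm x u (Var y) = (if y = x then u else Var y)"
| "subst_tm x u \<^bold>0 = \<^bold>0"
| "subst_tm x u \<^bold>1 = \<^bold>1"
| "subst_tm x u (s \<^bold>+ t) = subst_tm x u s \<^bold>+ subst_tm x u t"
| "subst_tm x u (s \<^bold>* t) = subst_tm x u s \<^bold>* subst_tm x u t"

text \<open>
  Substitution of \<open>u\<close> for the free occurrences of the number variable \<open>x\<close>.  Bound variables are
  not renamed; it is only used for terms \<open>u\<close> containing no variable other than \<open>x\<close> itself, so
  that capture cannot occur (see \<open>sat_subst\<close> below).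
\<close>

primrec subst :: "nat \<Rightarrow> tm \<Rightarrow> fm \<Rightarrow> fm" where
  "subst x u (s \<^bold>= t) = (subst_tm x u s \<^bold>= subst_tm x u t)"
| "subst x u (s \<^bold>< t) = (subst_tm x u s \<^bold>< subst_tm x u t)"
| "subst x u (t \<^bold>\<in> X) = (subst_tm x u t \<^bold>\<in> X)"
| "subst x u (\<^bold>\<not> \<phi>) = (\<^bold>\<not> subst x u \<phi>)"
| "subst x u (\<phi> \<^bold>\<and> \<psi>) = (subst x u \<phi> \<^bold>\<and> subst x u \<psi>)"
| "subst x u (\<phi> \<^bold>\<or> \<psi>) = (subst x u \<phi> \<^bold>\<or> subst x u \<psi>)"
| "subst x u (\<phi> \<^bold>\<longrightarrow> \<psi>) = (subst x u \<phi> \<^bold>\<longrightarrow> subst x u \<psi>)"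
| "subst x u (\<phi> \<^bold>\<longleftrightarrow> \<psi>) = (subst x u \<phi> \<^bold>\<longleftrightarrow> subst x u \<psi>)"
| "subst x u (\<^bold>\<forall>y. \<phi>) = (\<^bold>\<forall>y. if y = x then \<phi> else subst x u \<phi>)"
| "subst x u (\<^bold>\<exists>y. \<phi>) = (\<^bold>\<exists>y. if y = x then \<phi> else subst x u \<phi>)"
| "subst x u (\<^bold>\<forall>\<^sub>sX. \<phi>) = (\<^bold>\<forall>\<^sub>sX. subst x u \<phi>)"
| "subst x u (\<^bold>\<exists>\<^sub>sX. \<phi>) = (\<^bold>\<exists>\<^sub>sX. subst x u \<phi>)"

inductive bounded_fm :: "fm \<Rightarrow> bool" where
  "bounded_fm (s \<^bold>= t)"
| "bounded_fm (s \<^bold>< t)"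
| "bounded_fm (t \<^bold>\<in> X)"
| "bounded_fm \<phi> \<Longrightarrow> bounded_fm (\<^bold>\<not> \<phi>)"
| "bounded_fm \<phi> \<Longrightarrow> bounded_fm \<psi> \<Longrightarrow> bounded_fm (\<phi> \<^bold>\<and> \<psi>)"
| "bounded_fm \<phi> \<Longrightarrow> bounded_fm \<psi> \<Longrightarrow> bounded_fm (\<phi> \<^bold>\<or> \<psi>)"
| "bounded_fm \<phi> \<Longrightarrow> bounded_fm \<psi> \<Longrightarrow> bounded_fm (\<phi> \<^bold>\<longrightarrow> \<psi>)"
| "bounded_fm \<phi> \<Longrightarrow> bounded_fm \<psi> \<Longrightarrow> bounded_fm (\<phi> \<^bold>\<longleftrightarrow> \<psi>)"
| "bounded_fm \<phi> \<Longrightarrow> x \<notin> vars_tm t \<Longrightarrow> bounded_fm (\<^bold>\<forall>x. Var x \<^bold>< t \<^bold>\<longrightarrow> \<phi>)"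
| "bounded_fm \<phi> \<Longrightarrow> x \<notin> vars_tm t \<Longrightarrow> bounded_fm (\<^bold>\<exists>x. Var x \<^bold>< t \<^bold>\<and> \<phi>)"

definition Sigma01 :: "fm set" where
  "Sigma01 = {\<^bold>\<exists>x. \<theta> | x \<theta>. bounded_fm \<theta>}"

definition Pi01 :: "fm set" where
  "Pi01 = {\<^bold>\<forall>x. \<theta> | x \<theta>. bounded_fm \<theta>}"

text \<open>Arithmetical formulas may contain free set variables, but no set quantifiers.\<close>

primrec arithmetical :: "fm \<Rightarrow> bool" where
  "arithmetical (s \<^bold>= t) = True"
| "arithmetical (s \<^bold>< t) = True"
| "arithmetical (t \<^bold>\<in> X) = True"
| "arithmetical (\<^bold>\<not> \<phi>) = arithmetical \<phi>"
| "arithmetical (\<phi> \<^bold>\<and> \<psi>) = (arithmetical \<phi> \<and> arithmetical \<psi>)"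
| "arithmetical (\<phi> \<^bold>\<or> \<psi>) = (arithmetical \<phi> \<and> arithmetical \<psi>)"
| "arithmetical (\<phi> \<^bold>\<longrightarrow> \<psi>) = (arithmetical \<phi> \<and> arithmetical \<psi>)"
| "arithmetical (\<phi> \<^bold>\<longleftrightarrow> \<psi>) = (arithmetical \<phi> \<and> arithmetical \<psi>)"
| "arithmetical (\<^bold>\<forall>x. \<phi>) = arithmetical \<phi>"
| "arithmetical (\<^bold>\<exists>x. \<phi>) = arithmetical \<phi>"
| "arithmetical (\<^bold>\<forall>\<^sub>sX. \<phi>) = False"
| "arithmetical (\<^bold>\<exists>\<^sub>sX. \<phi>) = False"


section \<open>Structures and satisfaction\<close>

text \<open>
  The first-order part is the type \<open>'a\<close>; set quantifiers range over the collection
  \<open>Sets M\<close> of subsets of the first-order part, which need not contain all subsets.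
\<close>

record 'a L2_structure =
  zero_of :: 'a
  one_of :: 'a
  plus_of :: "'a \<Rightarrow> 'a \<Rightarrow> 'a"
  times_of :: "'a \<Rightarrow> 'a \<Rightarrow> 'a"
  less_of :: "'a \<Rightarrow> 'a \<Rightarrow> bool"
  Sets :: "'a set set"

primrec eval :: "'a L2_structure \<Rightarrow> (nat \<Rightarrow> 'a) \<Rightarrow> tm \<Rightarrow> 'a" where
  "eval M e (Var x) = e x"
| "eval M e \<^bold>0 = zero_of M"
| "eval M e \<^bold>1 = one_of M"
| "eval M e (s \<^bold>+ t) = plus_of M (eval M e s) (eval M e t)"
| "eval M e (s \<^bold>* t) = times_of M (eval M e s) (eval M e t)"

primrec sat :: "'a L2_structure \<Rightarrow> (nat \<Rightarrow> 'a) \<Rightarrow> (nat \<Rightarrow> 'a set) \<Rightarrow> fm \<Rightarrow> bool" where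
  "sat M e E (s \<^bold>= t) \<longleftrightarrow> eval M e s = eval M e t"
| "sat M e E (s \<^bold>< t) \<longleftrightarrow> less_of M (eval M e s) (eval M e t)"
| "sat M e E (t \<^bold>\<in> X) \<longleftrightarrow> eval M e t \<in> E X"
| "sat M e E (\<^bold>\<not> \<phi>) \<longleftrightarrow> \<not> sat M e E \<phi>"
| "sat M e E (\<phi> \<^bold>\<and> \<psi>) \<longleftrightarrow> sat M e E \<phi> \<and> sat M e E \<psi>"
| "sat M e E (\<phi> \<^bold>\<or> \<psi>) \<longleftrightarrow> sat M e E \<phi> \<or> sat M e E \<psi>"
| "sat M e E (\<phi> \<^bold>\<longrightarrow> \<psi>) \<longleftrightarrow> (sat M e E \<phi> \<longrightarrow> sat M e E \<psi>)"
| "sat M e E (\<phi> \<^bold>\<longleftrightarrow> \<psi>) \<longleftrightarrow> (sat M e E \<phi> \<longleftrightarrow> sat M e E \<psi>)"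
| "sat M e E (\<^bold>\<forall>x. \<phi>) \<longleftrightarrow> (\<forall>a. sat M (e(x := a)) E \<phi>)"
| "sat M e E (\<^bold>\<exists>x. \<phi>) \<longleftrightarrow> (\<exists>a. sat M (e(x := a)) E \<phi>)"
| "sat M e E (\<^bold>\<forall>\<^sub>sX. \<phi>) \<longleftrightarrow> (\<forall>A\<in>Sets M. sat M e (E(X := A)) \<phi>)"
| "sat M e E (\<^bold>\<exists>\<^sub>sX. \<phi>) \<longleftrightarrow> (\<exists>A\<in>Sets M. sat M e (E(X := A)) \<phi>)"

text \<open>
  Quantifying over all assignments amounts to taking universal closures.  It is used for
  structures with \<open>Sets M \<noteq> {}\<close>; otherwise there are no assignments.
\<close>

definition models :: "'a L2_structure \<Rightarrow> fm set \<Rightarrow> bool" (infix "\<Turnstile>" 50) where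
  "M \<Turnstile> T \<longleftrightarrow> (\<forall>\<phi>\<in>T. \<forall>e E. range E \<subseteq> Sets M \<longrightarrow> sat M e E \<phi>)"

lemma eval_subst_tm: "eval M e (subst_tm x u t) = eval M (e(x := eval M e u)) t"
  by (induction t) auto

lemma eval_cong: "(\<And>x. x \<in> vars_tm t \<Longrightarrow> e x = e' x) \<Longrightarrow> eval M e t = eval M e' t"
  by (induction t) auto

lemma sat_subst:
  assumes "vars_tm u \<subseteq> {x}"
  shows "sat M e E (subst x u \<phi>) \<longleftrightarrow> sat M (e(x := eval M e u)) E \<phi>"
proof (induction \<phi> arbitrary: e E)
  case (All y \<phi>)
  show ?case
  proof (cases "y = x")
    case False
    then have "eval M (e(y := a)) u = eval M e u" for a
      using assms by (intro eval_cong) auto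
    with False All show ?thesis by (simp add: fun_upd_twist del: fun_upd_apply)
  qed (simp del: fun_upd_apply)
next
  case (Ex y \<phi>)
  show ?case
  proof (cases "y = x")
    case False
    then have "eval M (e(y := a)) u = eval M e u" for a
      using assms by (intro eval_cong) auto
    with False Ex show ?thesis by (simp add: fun_upd_twist del: fun_upd_apply)
  qed (simp del: fun_upd_apply)
qed (auto simp: eval_subst_tm)


section \<open>The theories RCA0 and ACA0\<close>

abbreviation le_tm :: "tm \<Rightarrow> tm \<Rightarrow> fm" (infix "\<^bold>\<le>" 50) where
  "s \<^bold>\<le> t \<equiv> (s \<^bold>< t \<^bold>\<or> s \<^bold>= t)"

text \<open>
  Discretely ordered commutative semirings, as non-negative parts of discretely ordered
  commutative rings (the theory \<open>PA\<^sup>-\<close>).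
\<close>

definition semiring_axioms :: "fm set" where
  "semiring_axioms = (let x = Var 0; y = Var 1; z = Var 2 in
    {(x \<^bold>+ y) \<^bold>+ z \<^bold>= x \<^bold>+ (y \<^bold>+ z),
     x \<^bold>+ y \<^bold>= y \<^bold>+ x,
     (x \<^bold>* y) \<^bold>* z \<^bold>= x \<^bold>* (y \<^bold>* z),
     x \<^bold>* y \<^bold>= y \<^bold>* x,
     x \<^bold>* (y \<^bold>+ z) \<^bold>= x \<^bold>* y \<^bold>+ x \<^bold>* z,
     x \<^bold>+ \<^bold>0 \<^bold>= x,
     x \<^bold>* \<^bold>0 \<^bold>= \<^bold>0,
     x \<^bold>* \<^bold>1 \<^bold>= x,
     \<^bold>\<not> x \<^bold>< x,
     x \<^bold>< y \<^bold>\<and> y \<^bold>< z \<^bold>\<longrightarrow> x \<^bold>< z,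
     x \<^bold>< y \<^bold>\<or> x \<^bold>= y \<^bold>\<or> y \<^bold>< x,
     x \<^bold>< y \<^bold>\<longrightarrow> x \<^bold>+ z \<^bold>< y \<^bold>+ z,
     \<^bold>0 \<^bold>< z \<^bold>\<and> x \<^bold>< y \<^bold>\<longrightarrow> x \<^bold>* z \<^bold>< y \<^bold>* z,
     x \<^bold>< y \<^bold>\<longrightarrow> (\<^bold>\<exists>2. x \<^bold>+ z \<^bold>= y),
     \<^bold>0 \<^bold>< \<^bold>1,
     \<^bold>0 \<^bold>< x \<^bold>\<longrightarrow> \<^bold>1 \<^bold>\<le> x,
     \<^bold>0 \<^bold>\<le> x})"

definition Sigma01_induction :: "fm set" where
  "Sigma01_induction =
    {subst n \<^bold>0 \<phi> \<^bold>\<and> (\<^bold>\<forall>n. \<phi> \<^bold>\<longrightarrow> subst n (Var n \<^bold>+ \<^bold>1) \<phi>) \<^bold>\<longrightarrow> (\<^bold>\<forall>n. \<phi>) | n \<phi>. \<phi> \<in> Sigma01}"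

definition Delta01_comprehension :: "fm set" where
  "Delta01_comprehension =
    {(\<^bold>\<forall>n. \<phi> \<^bold>\<longleftrightarrow> \<psi>) \<^bold>\<longrightarrow> (\<^bold>\<exists>\<^sub>sX. \<^bold>\<forall>n. Var n \<^bold>\<in> X \<^bold>\<longleftrightarrow> \<phi>) | n X \<phi> \<psi>.
      \<phi> \<in> Sigma01 \<and> \<psi> \<in> Pi01 \<and> X \<notin> free_set_vars \<phi>}"

definition arithmetical_comprehension :: "fm set" where
  "arithmetical_comprehension =
    {\<^bold>\<exists>\<^sub>sX. \<^bold>\<forall>n. Var n \<^bold>\<in> X \<^bold>\<longleftrightarrow> \<phi> | n X \<phi>. arithmetical \<phi> \<and> X \<notin> free_set_vars \<phi>}"

definition RCA0 :: "fm set" where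
  "RCA0 = semiring_axioms \<union> Sigma01_induction \<union> Delta01_comprehension"

definition ACA0 :: "fm set" where
  "ACA0 = RCA0 \<union> arithmetical_comprehension"


section \<open>Partial orders in second-order arithmetic\<close>

text \<open>
  In what follows \<open>P\<close>, \<open>L\<close>, \<open>C\<close>, \<open>A\<close>, \<open>h\<close>, \<open>X\<close> name set variables.  A partial order is a pair of a
  set \<open>P\<close> and a set \<open>L\<close> of (codes of) pairs \<open>(p, q)\<close> with \<open>p <\<^sub>P q\<close>.
\<close>

definition pair_tm :: "tm \<Rightarrow> tm \<Rightarrow> tm" where
  "pair_tm s t = (s \<^bold>+ t) \<^bold>* (s \<^bold>+ t) \<^bold>+ s"

definition infinite_fm :: "nat \<Rightarrow> fm" where
  "infinite_fm X = (\<^bold>\<forall>0. \<^bold>\<exists>1. Var 0 \<^bold>< Var 1 \<^bold>\<and> Var 1 \<^bold>\<in> X)"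

definition subset_fm :: "nat \<Rightarrow> nat \<Rightarrow> fm" where
  "subset_fm X Y = (\<^bold>\<forall>0. Var 0 \<^bold>\<in> X \<^bold>\<longrightarrow> Var 0 \<^bold>\<in> Y)"

definition partial_order_fm :: "nat \<Rightarrow> nat \<Rightarrow> fm" where
  "partial_order_fm P L =
    ((\<^bold>\<forall>0. Var 0 \<^bold>\<in> L \<^bold>\<longrightarrow>
        (\<^bold>\<exists>1. \<^bold>\<exists>2. Var 1 \<^bold>\<in> P \<^bold>\<and> Var 2 \<^bold>\<in> P \<^bold>\<and> Var 0 \<^bold>= pair_tm (Var 1) (Var 2))) \<^bold>\<and>
     (\<^bold>\<forall>0. Var 0 \<^bold>\<in> P \<^bold>\<longrightarrow> \<^bold>\<not> pair_tm (Var 0) (Var 0) \<^bold>\<in> L) \<^bold>\<and>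
     (\<^bold>\<forall>0. \<^bold>\<forall>1. \<^bold>\<forall>2. Var 0 \<^bold>\<in> P \<^bold>\<and> Var 1 \<^bold>\<in> P \<^bold>\<and> Var 2 \<^bold>\<in> P \<^bold>\<and>
        pair_tm (Var 0) (Var 1) \<^bold>\<in> L \<^bold>\<and> pair_tm (Var 1) (Var 2) \<^bold>\<in> L \<^bold>\<longrightarrow>
        pair_tm (Var 0) (Var 2) \<^bold>\<in> L))"

definition leq_fm :: "nat \<Rightarrow> tm \<Rightarrow> tm \<Rightarrow> fm" where
  "leq_fm L s t = (pair_tm s t \<^bold>\<in> L \<^bold>\<or> s \<^bold>= t)"

definition comparable_fm :: "nat \<Rightarrow> tm \<Rightarrow> tm \<Rightarrow> fm" where
  "comparable_fm L s t = (leq_fm L s t \<^bold>\<or> leq_fm L t s)"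

definition chain_fm :: "nat \<Rightarrow> nat \<Rightarrow> nat \<Rightarrow> fm" where
  "chain_fm P L C =
    (subset_fm C P \<^bold>\<and>
     (\<^bold>\<forall>0. \<^bold>\<forall>1. Var 0 \<^bold>\<in> C \<^bold>\<and> Var 1 \<^bold>\<in> C \<^bold>\<longrightarrow> comparable_fm L (Var 0) (Var 1)))"

definition antichain_fm :: "nat \<Rightarrow> nat \<Rightarrow> nat \<Rightarrow> fm" where
  "antichain_fm P L A =
    (subset_fm A P \<^bold>\<and>
     (\<^bold>\<forall>0. \<^bold>\<forall>1. Var 0 \<^bold>\<in> A \<^bold>\<and> Var 1 \<^bold>\<in> A \<^bold>\<and> \<^bold>\<not> Var 0 \<^bold>= Var 1 \<^bold>\<longrightarrow>
        \<^bold>\<not> comparable_fm L (Var 0) (Var 1)))"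

text \<open>A \<open>(0, \<infinity>)\<close>-homogeneous chain; infinitely many means unboundedly many.\<close>

definition homogeneous_chain_fm :: "nat \<Rightarrow> nat \<Rightarrow> nat \<Rightarrow> fm" where
  "homogeneous_chain_fm P L C =
    (chain_fm P L C \<^bold>\<and> infinite_fm C \<^bold>\<and>
     (\<^bold>\<forall>0. Var 0 \<^bold>\<in> P \<^bold>\<longrightarrow>
        (\<^bold>\<forall>1. Var 1 \<^bold>\<in> C \<^bold>\<longrightarrow> \<^bold>\<not> comparable_fm L (Var 0) (Var 1)) \<^bold>\<or>
        (\<^bold>\<forall>1. \<^bold>\<exists>2. Var 1 \<^bold>< Var 2 \<^bold>\<and> Var 2 \<^bold>\<in> C \<^bold>\<and> comparable_fm L (Var 0) (Var 2))))"

text \<open>\<open>h\<close> is (the graph of) a function from the numbers to \<open>P\<close>.\<close>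

definition function_to_fm :: "nat \<Rightarrow> nat \<Rightarrow> fm" where
  "function_to_fm h P =
    ((\<^bold>\<forall>0. Var 0 \<^bold>\<in> h \<^bold>\<longrightarrow> (\<^bold>\<exists>1. \<^bold>\<exists>2. Var 2 \<^bold>\<in> P \<^bold>\<and> Var 0 \<^bold>= pair_tm (Var 1) (Var 2))) \<^bold>\<and>
     (\<^bold>\<forall>0. \<^bold>\<exists>1. pair_tm (Var 0) (Var 1) \<^bold>\<in> h) \<^bold>\<and>
     (\<^bold>\<forall>0. \<^bold>\<forall>1. \<^bold>\<forall>2. pair_tm (Var 0) (Var 1) \<^bold>\<in> h \<^bold>\<and> pair_tm (Var 0) (Var 2) \<^bold>\<in> h \<^bold>\<longrightarrow>
        Var 1 \<^bold>= Var 2))"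

text \<open>The bound set variable \<open>4\<close> must differ from \<open>P\<close> and \<open>L\<close>.\<close>

definition wpo_fm :: "nat \<Rightarrow> nat \<Rightarrow> fm" where
  "wpo_fm P L =
    (partial_order_fm P L \<^bold>\<and>
     (\<^bold>\<forall>\<^sub>s4. function_to_fm 4 P \<^bold>\<longrightarrow>
        (\<^bold>\<exists>0. \<^bold>\<exists>1. \<^bold>\<exists>2. \<^bold>\<exists>3. Var 0 \<^bold>< Var 1 \<^bold>\<and>
           pair_tm (Var 0) (Var 2) \<^bold>\<in> 4 \<^bold>\<and> pair_tm (Var 1) (Var 3) \<^bold>\<in> 4 \<^bold>\<and>
           leq_fm L (Var 2) (Var 3))))"

definition no_antichain_principle :: fm where
  "no_antichain_principle =
    (\<^bold>\<forall>\<^sub>s0. \<^bold>\<forall>\<^sub>s1. partial_order_fm 0 1 \<^bold>\<and> infinite_fm 0 \<^bold>\<and>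
        \<^bold>\<not> (\<^bold>\<exists>\<^sub>s2. antichain_fm 0 1 2 \<^bold>\<and> infinite_fm 2) \<^bold>\<longrightarrow>
        (\<^bold>\<exists>\<^sub>s3. homogeneous_chain_fm 0 1 3))"

definition wpo_principle :: fm where
  "wpo_principle =
    (\<^bold>\<forall>\<^sub>s0. \<^bold>\<forall>\<^sub>s1. wpo_fm 0 1 \<^bold>\<and> infinite_fm 0 \<^bold>\<longrightarrow> (\<^bold>\<exists>\<^sub>s3. homogeneous_chain_fm 0 1 3))"


section \<open>Reading the formulas inside a structure\<close>

definition pr :: "'a L2_structure \<Rightarrow> 'a \<Rightarrow> 'a \<Rightarrow> 'a" where
  "pr M a b = plus_of M (times_of M (plus_of M a b) (plus_of M a b)) a"

definition cmp :: "'a L2_structure \<Rightarrow> 'a set \<Rightarrow> 'a \<Rightarrow> 'a \<Rightarrow> bool" where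
  "cmp M L a b \<longleftrightarrow> (pr M a b \<in> L \<or> a = b) \<or> (pr M b a \<in> L \<or> b = a)"

lemma eval_pair_tm [simp]: "eval M e (pair_tm s t) = pr M (eval M e s) (eval M e t)"
  by (simp add: pair_tm_def pr_def)

lemma sat_infinite_fm [simp]:
  "sat M e E (infinite_fm X) \<longleftrightarrow> (\<forall>k. \<exists>i\<in>E X. less_of M k i)"
  by (auto simp: infinite_fm_def)

lemma sat_subset_fm [simp]: "sat M e E (subset_fm X Y) \<longleftrightarrow> E X \<subseteq> E Y"
  by (auto simp: subset_fm_def)

lemma sat_partial_order_fm [simp]:
  "sat M e E (partial_order_fm P L) \<longleftrightarrow>
    E L \<subseteq> {pr M p q | p q. p \<in> E P \<and> q \<in> E P} \<and>
    (\<forall>p\<in>E P. pr M p p \<notin> E L) \<and>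
    (\<forall>p\<in>E P. \<forall>q\<in>E P. \<forall>r\<in>E P. pr M p q \<in> E L \<and> pr M q r \<in> E L \<longrightarrow> pr M p r \<in> E L)"
  by (simp add: partial_order_fm_def) blast

lemma sat_leq_fm [simp]:
  "sat M e E (leq_fm L s t) \<longleftrightarrow>
    pr M (eval M e s) (eval M e t) \<in> E L \<or> eval M e s = eval M e t"
  by (simp add: leq_fm_def)

lemma sat_comparable_fm [simp]:
  "sat M e E (comparable_fm L s t) \<longleftrightarrow> cmp M (E L) (eval M e s) (eval M e t)"
  by (simp add: comparable_fm_def cmp_def)

lemma sat_chain_fm [simp]:
  "sat M e E (chain_fm P L C) \<longleftrightarrow> E C \<subseteq> E P \<and> (\<forall>p\<in>E C. \<forall>q\<in>E C. cmp M (E L) p q)"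
  by (auto simp: chain_fm_def)

lemma sat_antichain_fm [simp]:
  "sat M e E (antichain_fm P L A) \<longleftrightarrow>
    E A \<subseteq> E P \<and> (\<forall>p\<in>E A. \<forall>q\<in>E A. p \<noteq> q \<longrightarrow> \<not> cmp M (E L) p q)"
  by (auto simp: antichain_fm_def)

lemma sat_homogeneous_chain_fm [simp]:
  "sat M e E (homogeneous_chain_fm P L C) \<longleftrightarrow>
    E C \<subseteq> E P \<and> (\<forall>p\<in>E C. \<forall>q\<in>E C. cmp M (E L) p q) \<and> (\<forall>k. \<exists>i\<in>E C. less_of M k i) \<and>
    (\<forall>p\<in>E P. (\<forall>c\<in>E C. \<not> cmp M (E L) p c) \<or> (\<forall>k. \<exists>c\<in>E C. less_of M k c \<and> cmp M (E L) p c))"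
  by (simp add: homogeneous_chain_fm_def) blast

lemma sat_function_to_fm [simp]:
  "sat M e E (function_to_fm h P) \<longleftrightarrow>
    E h \<subseteq> {pr M m p | m p. p \<in> E P} \<and> (\<forall>m. \<exists>!p. pr M m p \<in> E h)"
  by (simp add: function_to_fm_def) blast

lemma sat_wpo_fm [simp]:
  assumes "P \<noteq> 4" "L \<noteq> 4"
  shows "sat M e E (wpo_fm P L) \<longleftrightarrow>
    sat M e E (partial_order_fm P L) \<and>
    (\<forall>h\<in>Sets M. h \<subseteq> {pr M m p | m p. p \<in> E P} \<and> (\<forall>m. \<exists>!p. pr M m p \<in> h) \<longrightarrow>
      (\<exists>m n p q. less_of M m n \<and> pr M m p \<in> h \<and> pr M n q \<in> h \<and> (pr M p q \<in> E L \<or> p = q)))"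
  using assms by (simp add: wpo_fm_def)

end

theory Submission
  imports Defs
begin

text \<open>
  Fix a model \<open>M\<close> of RCA0.  Its numbers may be nonstandard, so finiteness of a set always means
  boundedness in \<open>M\<close>, and arguments about finite sets are inductions inside \<open>M\<close>.

  From the chain principles to ACA0.  It is enough that the sets of \<open>M\<close> are closed under
  projection: then every arithmetical formula can be replaced by a bounded one with more set
  parameters (\<open>arithmetical_bounded_replacement\<close>).  Let an infinite set \<open>S\<close> of stages \<open>(n, s)\<close> be
  given, where \<open>(n, s)\<close> enumerates \<open>n\<close> and no number is enumerated twice.  A stage is injured by a
  later stage that enumerates a smaller number; put \<open>x\<close> below \<open>y\<close> if \<open>x\<close> has been injured by the
  time \<open>y\<close>.  Uninjured stages, the true ones, are maximal in this partial order, and they occur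
  arbitrarily late.  This rules out a \<open>(0, \<infinity>)\<close>-homogeneous chain (\<open>no_homogeneous_chain\<close>): if
  \<open>c\<close> and \<open>c'\<close> are in the chain and \<open>c\<close> comes first, then \<open>c\<close> is injured by the time \<open>c'\<close>, so every
  true stage \<open>y\<close> after \<open>c'\<close> lies above \<open>c\<close>; by homogeneity \<open>y\<close> is comparable with some later
  element of the chain, hence below it, although \<open>y\<close> is maximal.  So the order of stages does not
  satisfy the hypothesis of the principle.  The infinite antichain or the bad sequence that
  witnesses this consists of true stages, and a true stage that enumerates a number larger than
  \<open>n\<close> bounds the stage at which \<open>n\<close> can be enumerated.  This makes the set of enumerated numbers
  \<open>\<Delta>\<^sup>0\<^sub>1\<close> (\<open>projection_from_true_stages\<close>).

  From ACA0 to the chain principles.  Let \<open>P\<close> be infinite without infinite antichains.  There are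
  three sources of homogeneous chains.  If an ascending sequence lies above a point and a
  descending one below it, their union is homogeneous, because each element of it has infinitely
  many elements of it on both sides (\<open>homogeneous_zeta\<close>).  If \<open>V\<close> is nonempty without maximal
  elements and whatever lies above an element of \<open>V\<close> is in \<open>V\<close> or in a set that contains no
  ascending sequence, then a cofinal sequence in a suitable directed piece of \<open>V\<close> is homogeneous
  (\<open>homogeneous_ideal\<close>).  The third is the dual of the second.

  One would like to take for \<open>V\<close> the elements that have an ascending sequence above them, but this
  condition quantifies over sets.  Instead, arithmetical sets \<open>W\<close> and, dually, \<open>Z\<close> are used whose
  elements provably have ascending sequences above them and descending sequences below them,
  respectively, and which are large enough for the following: if an interval \<open>[l, m]\<close> is
  infinite, then \<open>l \<in> W\<close> or \<open>m \<in> Z\<close>, or there is a point with an ascending sequence above and a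
  descending one below it.  Suppose that there is no homogeneous chain.  Then \<open>Z\<close> contains no
  ascending sequence, so by the second source every element outside \<open>Z\<close> lies below one of the
  maximal elements outside \<open>Z\<close>, and these form a finite antichain; dually, every element outside
  \<open>W\<close> lies above one of finitely many minimal ones.  The elements outside \<open>W \<union> Z\<close> are therefore
  covered by finitely many intervals, and these intervals are finite.  So \<open>W \<union> Z\<close> is cofinite in \<open>P\<close>, one of
  \<open>W\<close> and \<open>Z\<close> is nonempty, and the second or the third source applies to it
  (\<open>homogeneous_chain_exists\<close>).
\<close>

section \<open>Dependence of satisfaction on the free variables\<close>

primrec num_vars :: "fm \<Rightarrow> nat set" where
  "num_vars (s \<^bold>= t) = vars_tm s \<union> vars_tm t"
| "num_vars (s \<^bold>< t) = vars_tm s \<union> vars_tm t"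
| "num_vars (t \<^bold>\<in> X) = vars_tm t"
| "num_vars (\<^bold>\<not> \<phi>) = num_vars \<phi>"
| "num_vars (\<phi> \<^bold>\<and> \<psi>) = num_vars \<phi> \<union> num_vars \<psi>"
| "num_vars (\<phi> \<^bold>\<or> \<psi>) = num_vars \<phi> \<union> num_vars \<psi>"
| "num_vars (\<phi> \<^bold>\<longrightarrow> \<psi>) = num_vars \<phi> \<union> num_vars \<psi>"
| "num_vars (\<phi> \<^bold>\<longleftrightarrow> \<psi>) = num_vars \<phi> \<union> num_vars \<psi>"
| "num_vars (\<^bold>\<forall>x. \<phi>) = insert x (num_vars \<phi>)"
| "num_vars (\<^bold>\<exists>x. \<phi>) = insert x (num_vars \<phi>)"
| "num_vars (\<^bold>\<forall>\<^sub>sX. \<phi>) = num_vars \<phi>"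
| "num_vars (\<^bold>\<exists>\<^sub>sX. \<phi>) = num_vars \<phi>"

lemma finite_vars_tm: "finite (vars_tm t)"
  by (induction t) auto

lemma finite_num_vars: "finite (num_vars \<phi>)"
  by (induction \<phi>) (auto simp: finite_vars_tm)

lemma finite_free_set_vars: "finite (free_set_vars \<phi>)"
  by (induction \<phi>) auto

lemma sat_num_cong:
  "(\<And>x. x \<in> num_vars \<phi> \<Longrightarrow> e x = e' x) \<Longrightarrow> sat M e E \<phi> \<longleftrightarrow> sat M e' E \<phi>"
proof (induction \<phi> arbitrary: e e' E)
  case (Eq s t)
  then have "eval M e s = eval M e' s" "eval M e t = eval M e' t"
    by (auto intro!: eval_cong)
  then show ?case by simp
next
  case (Less s t)
  then have "eval M e s = eval M e' s" "eval M e t = eval M e' t"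
    by (auto intro!: eval_cong)
  then show ?case by simp
next
  case (Mem t X)
  then have "eval M e t = eval M e' t"
    by (auto intro!: eval_cong)
  then show ?case by simp
next
  case (Neg \<phi>)
  then show ?case by (metis num_vars.simps(4) sat.simps(4))
next
  case (Conj \<phi> \<psi>)
  have "sat M e E \<phi> = sat M e' E \<phi>" "sat M e E \<psi> = sat M e' E \<psi>"
    using Conj.prems by (auto intro!: Conj.IH)
  then show ?case by simp
next
  case (Disj \<phi> \<psi>)
  have "sat M e E \<phi> = sat M e' E \<phi>" "sat M e E \<psi> = sat M e' E \<psi>"
    using Disj.prems by (auto intro!: Disj.IH)
  then show ?case by simp
next
  case (Imp \<phi> \<psi>)
  have "sat M e E \<phi> = sat M e' E \<phi>" "sat M e E \<psi> = sat M e' E \<psi>"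
    using Imp.prems by (auto intro!: Imp.IH)
  then show ?case by simp
next
  case (Iff \<phi> \<psi>)
  have "sat M e E \<phi> = sat M e' E \<phi>" "sat M e E \<psi> = sat M e' E \<psi>"
    using Iff.prems by (auto intro!: Iff.IH)
  then show ?case by simp
next
  case (All x \<phi>)
  have "sat M (e(x := a)) E \<phi> = sat M (e'(x := a)) E \<phi>" for a
    using All.prems by (intro All.IH) auto
  then show ?case by simp
next
  case (Ex x \<phi>)
  have "sat M (e(x := a)) E \<phi> = sat M (e'(x := a)) E \<phi>" for a
    using Ex.prems by (intro Ex.IH) auto
  then show ?case by simp
next
  case (AllS X \<phi>)
  have "sat M e (E(X := A)) \<phi> = sat M e' (E(X := A)) \<phi>" for A
    using AllS.prems by (intro AllS.IH) auto
  then show ?case by simp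
next
  case (ExS X \<phi>)
  have "sat M e (E(X := A)) \<phi> = sat M e' (E(X := A)) \<phi>" for A
    using ExS.prems by (intro ExS.IH) auto
  then show ?case by simp
qed

lemma sat_set_cong:
  "(\<And>X. X \<in> free_set_vars \<phi> \<Longrightarrow> E X = E' X) \<Longrightarrow> sat M e E \<phi> \<longleftrightarrow> sat M e E' \<phi>"
proof (induction \<phi> arbitrary: e E E')
  case (Neg \<phi>)
  then show ?case by (metis free_set_vars.simps(4) sat.simps(4))
next
  case (Conj \<phi> \<psi>)
  have "sat M e E \<phi> = sat M e E' \<phi>" "sat M e E \<psi> = sat M e E' \<psi>"
    using Conj.prems by (auto intro!: Conj.IH)
  then show ?case by simp
next
  case (Disj \<phi> \<psi>)
  have "sat M e E \<phi> = sat M e E' \<phi>" "sat M e E \<psi> = sat M e E' \<psi>"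
    using Disj.prems by (auto intro!: Disj.IH)
  then show ?case by simp
next
  case (Imp \<phi> \<psi>)
  have "sat M e E \<phi> = sat M e E' \<phi>" "sat M e E \<psi> = sat M e E' \<psi>"
    using Imp.prems by (auto intro!: Imp.IH)
  then show ?case by simp
next
  case (Iff \<phi> \<psi>)
  have "sat M e E \<phi> = sat M e E' \<phi>" "sat M e E \<psi> = sat M e E' \<psi>"
    using Iff.prems by (auto intro!: Iff.IH)
  then show ?case by simp
next
  case (All x \<phi>)
  have "sat M (e(x := a)) E \<phi> = sat M (e(x := a)) E' \<phi>" for a
    using All.prems by (intro All.IH) auto
  then show ?case by simp
next
  case (Ex x \<phi>)
  have "sat M (e(x := a)) E \<phi> = sat M (e(x := a)) E' \<phi>" for a
    using Ex.prems by (intro Ex.IH) auto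
  then show ?case by simp
next
  case (AllS X \<phi>)
  have "sat M e (E(X := A)) \<phi> = sat M e (E'(X := A)) \<phi>" for A
    using AllS.prems by (intro AllS.IH) auto
  then show ?case by simp
next
  case (ExS X \<phi>)
  have "sat M e (E(X := A)) \<phi> = sat M e (E'(X := A)) \<phi>" for A
    using ExS.prems by (intro ExS.IH) auto
  then show ?case by simp
qed auto

lemma fresh_var: "finite S \<Longrightarrow> \<exists>x::nat. x \<notin> S"
  by (rule ex_new_if_finite) auto

section \<open>Arithmetic in a model of RCA0\<close>

locale rca0_model =
  fixes M :: "'a L2_structure"
  assumes sets_nonempty: "Sets M \<noteq> {}"
    and rca0: "M \<Turnstile> RCA0"
begin

abbreviation num_less :: "'a \<Rightarrow> 'a \<Rightarrow> bool" (infix "\<prec>" 50) where "a \<prec> b \<equiv> less_of M a b"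
definition lte :: "'a \<Rightarrow> 'a \<Rightarrow> bool" (infix "\<preceq>" 50) where "a \<preceq> b \<longleftrightarrow> a \<prec> b \<or> a = b"
abbreviation num_add :: "'a \<Rightarrow> 'a \<Rightarrow> 'a" (infixl "\<oplus>" 65) where "a \<oplus> b \<equiv> plus_of M a b"
abbreviation num_mult :: "'a \<Rightarrow> 'a \<Rightarrow> 'a" (infixl "\<otimes>" 70) where "a \<otimes> b \<equiv> times_of M a b"
abbreviation num_zero ("\<zero>") where "\<zero> \<equiv> zero_of M"
abbreviation num_one ("\<one>") where "\<one> \<equiv> one_of M"
text \<open>
  A total subtraction is needed for the locale instance that provides the arithmetic of the model;
  below the diagonal it is cut off at zero.
\<close>

definition sub :: "'a \<Rightarrow> 'a \<Rightarrow> 'a" (infixl "\<ominus>" 65) where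
  "a \<ominus> b = (if b \<preceq> a then SOME c. c \<oplus> b = a else \<zero>)"

lemma semiring:
  "(x \<oplus> y) \<oplus> z = x \<oplus> (y \<oplus> z)"
  "x \<oplus> y = y \<oplus> x"
  "(x \<otimes> y) \<otimes> z = x \<otimes> (y \<otimes> z)"
  "x \<otimes> y = y \<otimes> x"
  "x \<otimes> (y \<oplus> z) = x \<otimes> y \<oplus> x \<otimes> z"
  "x \<oplus> \<zero> = x"
  "x \<otimes> \<zero> = \<zero>"
  "x \<otimes> \<one> = x"
  "\<not> x \<prec> x"
  "x \<prec> y \<Longrightarrow> y \<prec> z \<Longrightarrow> x \<prec> z"
  "x \<prec> y \<or> x = y \<or> y \<prec> x"
  "x \<prec> y \<Longrightarrow> x \<oplus> z \<prec> y \<oplus> z"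
  "\<zero> \<prec> z \<Longrightarrow> x \<prec> y \<Longrightarrow> x \<otimes> z \<prec> y \<otimes> z"
  "x \<prec> y \<Longrightarrow> \<exists>z. x \<oplus> z = y"
  "\<zero> \<prec> \<one>"
  "\<zero> \<prec> x \<Longrightarrow> \<one> \<preceq> x"
  "\<zero> \<preceq> x"
proof -
  obtain S where S: "S \<in> Sets M" using sets_nonempty by blast
  define e where "e = (\<lambda>n::nat. if n = 0 then x else if n = 1 then y else z)"
  have "range (\<lambda>_::nat. S) \<subseteq> Sets M" using S by auto
  then have *: "\<forall>\<phi>\<in>semiring_axioms. sat M e (\<lambda>_. S) \<phi>"
    using rca0 by (simp add: models_def RCA0_def ball_Un)
  show
  "(x \<oplus> y) \<oplus> z = x \<oplus> (y \<oplus> z)"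
  "x \<oplus> y = y \<oplus> x"
  "(x \<otimes> y) \<otimes> z = x \<otimes> (y \<otimes> z)"
  "x \<otimes> y = y \<otimes> x"
  "x \<otimes> (y \<oplus> z) = x \<otimes> y \<oplus> x \<otimes> z"
  "x \<oplus> \<zero> = x"
  "x \<otimes> \<zero> = \<zero>"
  "x \<otimes> \<one> = x"
  "\<not> x \<prec> x"
  "x \<prec> y \<Longrightarrow> y \<prec> z \<Longrightarrow> x \<prec> z"
  "x \<prec> y \<or> x = y \<or> y \<prec> x"
  "x \<prec> y \<Longrightarrow> x \<oplus> z \<prec> y \<oplus> z"
  "\<zero> \<prec> z \<Longrightarrow> x \<prec> y \<Longrightarrow> x \<otimes> z \<prec> y \<otimes> z"
  "x \<prec> y \<Longrightarrow> \<exists>z. x \<oplus> z = y"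
  "\<zero> \<prec> \<one>"
  "\<zero> \<prec> x \<Longrightarrow> \<one> \<preceq> x"
  "\<zero> \<preceq> x"
    using *[unfolded semiring_axioms_def Let_def e_def, simplified]
    unfolding lte_def by (elim conjE; blast)+
qed

lemma lt_not_lt: "a \<prec> b \<Longrightarrow> \<not> b \<prec> a"
  using semiring(9,10) by blast

lemma add_cancel: "a \<oplus> c = b \<oplus> c \<Longrightarrow> a = b"
  by (metis semiring(9,11,12))

lemma sub_add: assumes "b \<preceq> a" shows "a \<ominus> b \<oplus> b = a"
proof -
  have "\<exists>c. c \<oplus> b = a" using assms by (metis lte_def semiring(2,6,14))
  then have "(SOME c. c \<oplus> b = a) \<oplus> b = a" by (rule someI_ex)
  then show ?thesis using assms by (simp add: sub_def)
qed

lemma sub_unique: "c \<oplus> b = a \<Longrightarrow> a \<ominus> b = c"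
  by (metis add_cancel lte_def semiring(2,6,12,17) sub_add)

lemma one_add_lte: "a \<prec> b \<longleftrightarrow> a \<oplus> \<one> \<preceq> b"
proof
  assume "a \<prec> b"
  then obtain c where c: "a \<oplus> c = b" using semiring(14) by blast
  then have "c \<noteq> \<zero>" using \<open>a \<prec> b\<close> semiring(6,9) by metis
  then have "\<one> \<preceq> c" by (metis lte_def semiring(16,17))
  then show "a \<oplus> \<one> \<preceq> b" using c by (metis lte_def semiring(2,12))
next
  assume "a \<oplus> \<one> \<preceq> b"
  then show "a \<prec> b" by (metis lte_def semiring(2,6,10,12,15))
qed

sublocale N: discrete_linordered_semidom "plus_of M" sub lte "less_of M" "zero_of M" "times_of M" "one_of M"
proof unfold_locales
  fix a b c :: 'a
  show "a \<oplus> b \<oplus> c = a \<oplus> (b \<oplus> c)" by (rule semiring)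
  show "a \<oplus> b = b \<oplus> a" by (rule semiring)
  show "\<zero> \<oplus> a = a" using semiring(2,6) by metis
  show "a \<otimes> b \<otimes> c = a \<otimes> (b \<otimes> c)" by (rule semiring)
  show "a \<otimes> b = b \<otimes> a" by (rule semiring)
  show "(a \<oplus> b) \<otimes> c = a \<otimes> c \<oplus> b \<otimes> c" using semiring(4,5) by metis
  show "a \<otimes> (b \<oplus> c) = a \<otimes> b \<oplus> a \<otimes> c" by (rule semiring)
  show "\<one> \<otimes> a = a" using semiring(4,8) by metis
  show "\<zero> \<otimes> a = \<zero>" using semiring(4,7) by metis
  show "a \<otimes> \<zero> = \<zero>" by (rule semiring)
  show "a \<oplus> b \<ominus> a = b" using sub_unique semiring(2) by metis
  show "a \<ominus> b \<ominus> c = a \<ominus> (b \<oplus> c)"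
  proof (cases "b \<oplus> c \<preceq> a")
    case True
    define d where "d = a \<ominus> (b \<oplus> c)"
    have "d \<oplus> (b \<oplus> c) = a" unfolding d_def by (rule sub_add[OF True])
    then have "(d \<oplus> c) \<oplus> b = a" using semiring(1)[of d c b] semiring(2)[of b c] by simp
    then have "a \<ominus> b = d \<oplus> c" by (rule sub_unique)
    then show ?thesis using sub_unique[of d c] d_def by simp
  next
    case False
    then have F: "a \<ominus> (b \<oplus> c) = \<zero>" by (simp add: sub_def)
    show ?thesis
    proof (cases "b \<preceq> a")
      case True
      have "\<not> c \<preceq> a \<ominus> b"
      proof
        assume "c \<preceq> a \<ominus> b"
        then have "c \<oplus> b \<preceq> (a \<ominus> b) \<oplus> b" using semiring(12) unfolding lte_def by blast
        then show False using False sub_add[OF True] semiring(2)[of c b] by simp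
      qed
      then show ?thesis using F sub_def by metis
    next
      case False
      then have "a \<ominus> b = \<zero>" by (simp add: sub_def)
      moreover have "\<zero> \<ominus> c = \<zero>"
      proof (cases "c \<preceq> \<zero>")
        case True
        then have "c = \<zero>" by (metis lte_def lt_not_lt semiring(17))
        then show ?thesis using sub_unique semiring(6) by metis
      qed (simp add: sub_def)
      ultimately show ?thesis using F by simp
    qed
  qed
  show "a \<otimes> (b \<ominus> c) = a \<otimes> b \<ominus> a \<otimes> c"
  proof (cases "c \<preceq> b")
    case True
    have "a \<otimes> (b \<ominus> c) \<oplus> a \<otimes> c = a \<otimes> b"
      using semiring(5)[of a "b \<ominus> c" c] sub_add[OF True] by simp
    then show ?thesis by (rule sub_unique[symmetric])
  next
    case False
    then have "b \<prec> c" by (metis lte_def semiring(11))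
    then have "a = \<zero> \<or> a \<otimes> b \<prec> a \<otimes> c" by (metis lte_def semiring(4,13,17))
    then have "a = \<zero> \<or> \<not> a \<otimes> c \<preceq> a \<otimes> b" using lt_not_lt semiring(9) lte_def by metis
    moreover have "\<zero> \<ominus> \<zero> = \<zero>" using sub_unique semiring(6) by blast
    moreover have "b \<ominus> c = \<zero>" using False by (simp add: sub_def)
    moreover have "\<zero> \<otimes> x = \<zero>" for x using semiring(4)[of "\<zero>" x] semiring(7) by simp
    ultimately show ?thesis using semiring(7) by (auto simp: sub_def)
  qed
  show "\<zero> \<noteq> \<one>" using semiring(9,15) by metis
  show "a \<noteq> \<zero> \<Longrightarrow> b \<noteq> \<zero> \<Longrightarrow> a \<otimes> b \<noteq> \<zero>"
    by (metis lte_def semiring(4,7,9,13,17))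
  show "(a \<prec> b) = (a \<preceq> b \<and> \<not> b \<preceq> a)" by (metis lte_def lt_not_lt)
  show "a \<preceq> a" by (simp add: lte_def)
  show "a \<preceq> b \<Longrightarrow> b \<preceq> c \<Longrightarrow> a \<preceq> c" using semiring(10) by (auto simp: lte_def)
  show "a \<preceq> b \<Longrightarrow> b \<preceq> a \<Longrightarrow> a = b" using lt_not_lt by (auto simp: lte_def)
  show "a \<preceq> b \<or> b \<preceq> a" using semiring(11) by (auto simp: lte_def)
  show "a \<preceq> b \<Longrightarrow> c \<oplus> a \<preceq> c \<oplus> b" by (metis lte_def semiring(2,12))
  show "a \<prec> b \<Longrightarrow> \<zero> \<prec> c \<Longrightarrow> c \<otimes> a \<prec> c \<otimes> b" by (metis semiring(4,13))
  show "\<zero> \<prec> \<one>" by (rule semiring)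
  show "b \<preceq> a \<Longrightarrow> a \<ominus> b \<oplus> b = a" by (rule sub_add)
  show "(a \<prec> b) = (a \<oplus> \<one> \<preceq> b)" by (rule one_add_lte)
qed

lemma zero_le [simp]: "\<zero> \<preceq> x"
  by (rule semiring)

lemma not_lt_zero [simp]: "\<not> x \<prec> \<zero>"
  using zero_le N.not_less by blast

lemma lt_succ [simp]: "a \<prec> b \<oplus> \<one> \<longleftrightarrow> a \<preceq> b"
  using N.less_eq_iff_succ_less by blast

lemma lt_succ_self [simp]: "a \<prec> a \<oplus> \<one>"
  by simp

lemma zero_or_succ: "a = \<zero> \<or> (\<exists>b. a = b \<oplus> \<one>)"
proof (cases "a = \<zero>")
  case False
  then have "\<one> \<preceq> a" using semiring(16,17) lte_def by metis
  then show ?thesis using sub_add by metis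
qed simp

lemma le_add1 [simp]: "a \<preceq> a \<oplus> b"
  by (rule N.add_increasing2) auto

lemma le_add2 [simp]: "b \<preceq> a \<oplus> b"
  by (rule N.add_increasing) auto

lemma le_mult: "\<zero> \<prec> b \<Longrightarrow> a \<preceq> a \<otimes> b"
  using N.mult_left_mono[of \<one> b a] semiring(16) by simp

lemma le_square: "a \<preceq> a \<otimes> a"
  using le_mult[of a a] zero_le[of a] unfolding lte_def by auto

lemma le_pr_sum: "a \<oplus> b \<preceq> pr M a b"
  unfolding pr_def using le_square[of "a \<oplus> b"] by (intro N.add_increasing2) auto

lemma le_pr1 [simp]: "a \<preceq> pr M a b"
  using le_pr_sum le_add1 N.order_trans by blast

lemma le_pr2 [simp]: "b \<preceq> pr M a b"
  using le_pr_sum le_add2 N.order_trans by blast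

end

context rca0_model
begin

lemmas ring_norm = N.distrib_left N.distrib_right N.add.assoc N.add.commute N.add.left_commute
  N.mult.assoc N.mult.commute N.mult.left_commute

lemma lt_add_succ: "x \<prec> x \<oplus> (y \<oplus> \<one>)"
  using lt_succ[of x "x \<oplus> y"] by (simp only: N.add.assoc le_add1)

text \<open>
  With \<open>s = a + b\<close>, the code \<open>s\<^sup>2 + a\<close> lies between \<open>s\<^sup>2\<close> and \<open>s\<^sup>2 + s\<close>, which is less than
  \<open>(s + 1)\<^sup>2\<close>.  Hence the sum can be read off from the code.
\<close>

lemma pr_less:
  assumes "a \<oplus> b \<prec> c \<oplus> d"
  shows "pr M a b \<prec> pr M c d"
proof -
  let ?s = "a \<oplus> b" and ?t = "c \<oplus> d"
  have "?s \<otimes> ?s \<oplus> a \<preceq> ?s \<otimes> ?s \<oplus> ?s" by (rule N.add_left_mono) simp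
  also have "\<dots> \<prec> ?s \<otimes> ?s \<oplus> ?s \<oplus> (?s \<oplus> \<one>)"
    by (rule lt_add_succ)
  also have "\<dots> = (?s \<oplus> \<one>) \<otimes> (?s \<oplus> \<one>)"
    by (simp add: N.distrib_left N.distrib_right N.add.assoc N.add.commute N.add.left_commute)
  also have "\<dots> \<preceq> ?t \<otimes> ?t"
    using assms one_add_lte by (intro N.mult_mono) auto
  also have "\<dots> \<preceq> ?t \<otimes> ?t \<oplus> c" by simp
  finally show ?thesis unfolding pr_def .
qed

lemma pr_inj [simp]: "pr M a b = pr M c d \<longleftrightarrow> a = c \<and> b = d"
proof
  assume eq: "pr M a b = pr M c d"
  then have s: "a \<oplus> b = c \<oplus> d"
    using pr_less[of a b c d] pr_less[of c d a b] N.less_linear[of "a \<oplus> b" "c \<oplus> d"] by auto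
  with eq have "a = c" unfolding pr_def by simp
  with s show "a = c \<and> b = d" by simp
qed simp

lemma pr_mono_strict: "a \<prec> c \<Longrightarrow> b \<preceq> d \<Longrightarrow> pr M a b \<prec> pr M c d"
  by (intro pr_less N.add_less_le_mono)

definition dv :: "'a \<Rightarrow> 'a \<Rightarrow> bool" where "dv a b \<longleftrightarrow> (\<exists>c. a \<otimes> c = b)"

lemma dv_bounded: "\<zero> \<prec> a \<Longrightarrow> dv a b \<longleftrightarrow> (\<exists>c. c \<prec> b \<oplus> \<one> \<and> a \<otimes> c = b)"
  unfolding dv_def using le_mult N.mult.commute lt_succ by metis

lemma dv_diff:
  assumes "dv d (x \<oplus> a)" "dv d x"
  shows "dv d a"
proof -
  obtain u v where u: "d \<otimes> u = x \<oplus> a" and v: "d \<otimes> v = x" using assms dv_def by auto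
  show ?thesis
  proof (cases "v \<preceq> u")
    case True
    have "d \<otimes> (u \<ominus> v) \<oplus> d \<otimes> v = d \<otimes> u"
      using sub_add[OF True] N.distrib_left[of d "u \<ominus> v" v] by simp
    then have "d \<otimes> (u \<ominus> v) \<oplus> x = a \<oplus> x" using u v N.add.commute by simp
    then show ?thesis using dv_def by auto
  next
    case False
    then have "d \<otimes> u \<preceq> d \<otimes> v" by (intro N.mult_left_mono) auto
    then have "x \<oplus> a \<preceq> x \<oplus> \<zero>" using u v by simp
    then have "a = \<zero>" using N.add_le_cancel_left N.order_antisym zero_le by blast
    then show ?thesis unfolding dv_def by (intro exI[of _ \<zero>]) simp
  qed
qed

lemma dv_mult: "dv d x \<Longrightarrow> dv d (x \<otimes> y)"
  unfolding dv_def using N.mult.assoc by metis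

lemma dv_add: "dv d x \<Longrightarrow> dv d y \<Longrightarrow> dv d (x \<oplus> y)"
  unfolding dv_def using N.distrib_left by metis

lemma dv_refl [simp]: "dv d d"
  unfolding dv_def by (metis N.mult_1_right)

text \<open>
  The moduli of Goedel's beta function.  They are pairwise coprime when \<open>B\<close> is divisible by all
  small numbers, and then sets of small numbers are coded by divisibility.
\<close>

definition modulus :: "'a \<Rightarrow> 'a \<Rightarrow> 'a" where "modulus B i = \<one> \<oplus> (i \<oplus> \<one>) \<otimes> B"

lemma modulus_pos [simp]: "\<zero> \<prec> modulus B i"
  unfolding modulus_def by (metis N.add.commute lt_succ zero_le)

lemma modulus_gt_one:
  assumes "\<zero> \<prec> B" shows "\<one> \<prec> modulus B i"
proof -
  have "\<zero> \<prec> (i \<oplus> \<one>) \<otimes> B" using assms by (intro N.mult_pos_pos) simp_all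
  then show ?thesis unfolding modulus_def by simp
qed

text \<open>
  The modulus \<open>d\<close> of \<open>i\<close> is coprime to that of \<open>k\<close>, called \<open>e\<close>, because \<open>e\<close> is invertible modulo
  \<open>d\<close>: with \<open>d = 1 + t\<close> one has \<open>t\<^sup>2 \<equiv> 1\<close>, and \<open>e \<equiv> g B\<close> or \<open>e \<equiv> - g B\<close>, where \<open>g B\<close> times \<open>w\<close>
  is \<open>t\<^sup>2\<close>.  So if \<open>d\<close> divides \<open>a e\<close>, it divides \<open>a e w\<close>, hence \<open>a\<close>.
\<close>

lemma modulus_coprime_aux:
  assumes "dv g B" and ik: "k = i \<oplus> g \<or> i = k \<oplus> g"
    and d: "dv (modulus B i) (a \<otimes> modulus B k)"
  shows "dv (modulus B i) a"
proof -
  obtain c where c: "g \<otimes> c = B" using assms(1) dv_def by auto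
  define t where "t = (i \<oplus> \<one>) \<otimes> B"
  define w where "w = c \<otimes> ((i \<oplus> \<one>) \<otimes> (i \<oplus> \<one>))"
  let ?d = "modulus B i" and ?e = "modulus B k"
  have dt: "?d = \<one> \<oplus> t" by (simp add: modulus_def t_def)
  have t2: "t \<otimes> t \<oplus> ?d = ?d \<otimes> t \<oplus> \<one>"
    unfolding dt by (simp add: ring_norm)
  have gw: "(g \<otimes> B) \<otimes> w = t \<otimes> t"
  proof -
    have "(g \<otimes> B) \<otimes> w = (g \<otimes> c) \<otimes> B \<otimes> ((i \<oplus> \<one>) \<otimes> (i \<oplus> \<one>))"
      unfolding w_def by (simp only: N.mult.assoc N.mult.commute N.mult.left_commute)
    also have "\<dots> = t \<otimes> t"
      unfolding c t_def by (simp only: N.mult.assoc N.mult.commute N.mult.left_commute)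
    finally show ?thesis .
  qed
  have ew: "dv ?d (a \<otimes> ?e \<otimes> w)" using d dv_mult by blast
  from ik show ?thesis
  proof
    assume k: "k = i \<oplus> g"
    have "?e = ?d \<oplus> g \<otimes> B"
      unfolding modulus_def k by (simp add: ring_norm)
    then have "?e \<otimes> w \<oplus> ?d = ?d \<otimes> w \<oplus> (t \<otimes> t \<oplus> ?d)"
      using gw by (simp add: N.distrib_right N.add.assoc)
    also have "\<dots> = ?d \<otimes> (w \<oplus> t) \<oplus> \<one>"
      unfolding t2 by (simp add: N.distrib_left N.add.assoc)
    finally have "a \<otimes> (?e \<otimes> w \<oplus> ?d) = a \<otimes> (?d \<otimes> (w \<oplus> t) \<oplus> \<one>)" by simp
    then have "a \<otimes> ?e \<otimes> w \<oplus> ?d \<otimes> a = ?d \<otimes> ((w \<oplus> t) \<otimes> a) \<oplus> a"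
      by (simp only: ring_norm N.mult_1_right)
    moreover have "dv ?d (a \<otimes> ?e \<otimes> w \<oplus> ?d \<otimes> a)" using ew dv_mult dv_add dv_refl by blast
    ultimately show ?thesis using dv_diff dv_mult dv_refl by metis
  next
    assume i: "i = k \<oplus> g"
    have "?d = ?e \<oplus> g \<otimes> B"
      unfolding modulus_def i by (simp add: ring_norm)
    then have "?d \<otimes> w \<oplus> ?d = ?e \<otimes> w \<oplus> (t \<otimes> t \<oplus> ?d)"
      using gw by (metis N.distrib_right N.add.assoc)
    also have "\<dots> = ?e \<otimes> w \<oplus> ?d \<otimes> t \<oplus> \<one>"
      unfolding t2 by (simp add: N.add.assoc)
    finally have "a \<otimes> (?d \<otimes> w \<oplus> ?d) = a \<otimes> (?e \<otimes> w \<oplus> ?d \<otimes> t \<oplus> \<one>)" by simp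
    then have "?d \<otimes> (a \<otimes> w \<oplus> a) = (a \<otimes> ?e \<otimes> w \<oplus> ?d \<otimes> (t \<otimes> a)) \<oplus> a"
      by (simp only: ring_norm N.mult_1_right)
    moreover have "dv ?d (a \<otimes> ?e \<otimes> w \<oplus> ?d \<otimes> (t \<otimes> a))" using ew dv_mult dv_add dv_refl by blast
    ultimately show ?thesis using dv_diff dv_mult dv_refl by metis
  qed
qed

lemma modulus_coprime:
  assumes B: "\<And>i. i \<prec> b \<Longrightarrow> dv (i \<oplus> \<one>) B"
    and ik: "i \<prec> b" "k \<prec> b" "i \<noteq> k"
    and d: "dv (modulus B i) (a \<otimes> modulus B k)"
  shows "dv (modulus B i) a"
proof -
  have "\<exists>g. (k = i \<oplus> g \<or> i = k \<oplus> g) \<and> (g \<preceq> i \<or> g \<preceq> k)"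
  proof (cases "i \<preceq> k")
    case True
    then have k: "k = i \<oplus> (k \<ominus> i)" using sub_add N.add.commute by metis
    then have "k \<ominus> i \<preceq> k" using le_add2 by metis
    then show ?thesis using k by blast
  next
    case False
    then have i: "i = k \<oplus> (i \<ominus> k)" using sub_add N.add.commute N.linear by metis
    then have "i \<ominus> k \<preceq> i" using le_add2 by metis
    then show ?thesis using i by blast
  qed
  then obtain g where g: "k = i \<oplus> g \<or> i = k \<oplus> g" "g \<preceq> i \<or> g \<preceq> k" by blast
  have "g \<noteq> \<zero>" using g(1) ik(3) by auto
  then obtain g' where g': "g = g' \<oplus> \<one>" using zero_or_succ by blast
  have "g' \<prec> b" using g(2) g' ik(1,2) one_add_lte N.less_trans N.less_le_trans N.le_less_trans by metis
  then have "dv g B" using B g' by blast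
  then show ?thesis using modulus_coprime_aux g(1) d by blast
qed

end

section \<open>Comprehension, induction and bounded sets in a model of RCA0\<close>

context rca0_model
begin

text \<open>
  From here on, formulas only serve to show that a set belongs to the model or that an induction is
  allowed; \<open>E\<close> and \<open>e\<close> supply the set and number parameters of the formula.
\<close>

lemma sat_rca0: "\<phi> \<in> RCA0 \<Longrightarrow> range E \<subseteq> Sets M \<Longrightarrow> sat M e E \<phi>"
  using rca0 unfolding models_def by blast

lemma delta_setI:
  assumes "bounded_fm \<theta>" "bounded_fm \<chi>" and E: "range E \<subseteq> Sets M"
    and A: "\<And>a. a \<in> A \<longleftrightarrow> (\<exists>b. sat M (e(n := a, x := b)) E \<theta>)"
    and A': "\<And>a. a \<in> A \<longleftrightarrow> (\<forall>b. sat M (e(n := a, y := b)) E \<chi>)"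
  shows "A \<in> Sets M"
proof -
  obtain X where X: "X \<notin> free_set_vars \<theta>" using fresh_var finite_free_set_vars by blast
  have "((\<^bold>\<forall>n. (\<^bold>\<exists>x. \<theta>) \<^bold>\<longleftrightarrow> (\<^bold>\<forall>y. \<chi>)) \<^bold>\<longrightarrow>
      (\<^bold>\<exists>\<^sub>sX. \<^bold>\<forall>n. Var n \<^bold>\<in> X \<^bold>\<longleftrightarrow> (\<^bold>\<exists>x. \<theta>))) \<in> RCA0"
    unfolding RCA0_def Delta01_comprehension_def Sigma01_def Pi01_def
    using assms(1,2) X by fastforce
  then have "sat M e E ((\<^bold>\<forall>n. (\<^bold>\<exists>x. \<theta>) \<^bold>\<longleftrightarrow> (\<^bold>\<forall>y. \<chi>)) \<^bold>\<longrightarrow>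
      (\<^bold>\<exists>\<^sub>sX. \<^bold>\<forall>n. Var n \<^bold>\<in> X \<^bold>\<longleftrightarrow> (\<^bold>\<exists>x. \<theta>)))"
    using E by (rule sat_rca0)
  moreover have "sat M e E (\<^bold>\<forall>n. (\<^bold>\<exists>x. \<theta>) \<^bold>\<longleftrightarrow> (\<^bold>\<forall>y. \<chi>))"
    using A A' by (simp only: sat.simps) blast
  ultimately obtain B where B: "B \<in> Sets M"
    "\<And>a. a \<in> B \<longleftrightarrow> (\<exists>b. sat M (e(n := a, x := b)) (E(X := B)) \<theta>)"
    by (simp del: fun_upd_apply add: fun_upd_same) blast
  have "sat M f (E(X := B)) \<theta> = sat M f E \<theta>" for f
    using X by (intro sat_set_cong) auto
  then have "A = B" using A B(2) by auto
  then show ?thesis using B(1) by simp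
qed

lemma bounded_setI_var:
  assumes \<theta>: "bounded_fm \<theta>" and E: "range E \<subseteq> Sets M"
    and A: "\<And>a. a \<in> A \<longleftrightarrow> sat M (e(n := a)) E \<theta>"
  shows "A \<in> Sets M"
proof -
  obtain x where x: "x \<notin> num_vars \<theta>" using fresh_var finite_num_vars by blast
  have "sat M (e(n := a, x := b)) E \<theta> = sat M (e(n := a)) E \<theta>" for a b
    using x by (intro sat_num_cong) auto
  then show ?thesis using \<theta> E A by (intro delta_setI[of \<theta> \<theta> E A e n x x]) auto
qed

lemmas bounded_setI = bounded_setI_var[where n = 0]

lemma sigma_induct:
  assumes \<theta>: "bounded_fm \<theta>" and E: "range E \<subseteq> Sets M"
    and Q: "\<And>a. Q a \<longleftrightarrow> (\<exists>b. sat M (e(0 := a, x := b)) E \<theta>)"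
    and "Q \<zero>" and "\<And>a. Q a \<Longrightarrow> Q (a \<oplus> \<one>)"
  shows "Q a"
proof -
  let ?\<phi> = "\<^bold>\<exists>x. \<theta>"
  have "(subst 0 \<^bold>0 ?\<phi> \<^bold>\<and> (\<^bold>\<forall>0. ?\<phi> \<^bold>\<longrightarrow> subst 0 (Var 0 \<^bold>+ \<^bold>1) ?\<phi>) \<^bold>\<longrightarrow> (\<^bold>\<forall>0. ?\<phi>)) \<in> RCA0"
    unfolding RCA0_def Sigma01_induction_def Sigma01_def using \<theta> by blast
  then have "sat M e E (subst 0 \<^bold>0 ?\<phi> \<^bold>\<and> (\<^bold>\<forall>0. ?\<phi> \<^bold>\<longrightarrow> subst 0 (Var 0 \<^bold>+ \<^bold>1) ?\<phi>) \<^bold>\<longrightarrow> (\<^bold>\<forall>0. ?\<phi>))"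
    using E by (rule sat_rca0)
  moreover have "sat M f E (subst 0 \<^bold>0 ?\<phi>) = sat M (f(0 := \<zero>)) E ?\<phi>" for f
    by (subst sat_subst) auto
  moreover have "sat M f E (subst 0 (Var 0 \<^bold>+ \<^bold>1) ?\<phi>) = sat M (f(0 := f 0 \<oplus> \<one>)) E ?\<phi>" for f
    by (subst sat_subst) auto
  moreover have "sat M (e(0 := a)) E ?\<phi> = Q a" for a using Q by simp
  ultimately show ?thesis using assms(4,5)
    by (simp del: subst.simps sat.simps(10) add: sat.simps(5,7,9))
qed

lemma set_induct:
  assumes "A \<in> Sets M" "\<zero> \<in> A" "\<And>a. a \<in> A \<Longrightarrow> a \<oplus> \<one> \<in> A"
  shows "a \<in> A"
  by (rule sigma_induct[where \<theta> = "Var 0 \<^bold>\<in> 0" and E = "\<lambda>_. A" and e = "\<lambda>_. \<zero>" and x = 1])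
    (use assms in \<open>auto intro: bounded_fm.intros\<close>)

text \<open>
  If \<open>A\<close> has no least element, then induction shows that no number below \<open>n\<close> is in \<open>A\<close>.  The
  induction is over a bounded condition, so that it is available in RCA0.
\<close>

lemma least_element:
  assumes A: "A \<in> Sets M" "A \<noteq> {}"
  obtains m where "m \<in> A" "\<And>x. x \<in> A \<Longrightarrow> m \<preceq> x"
proof -
  have "\<exists>m\<in>A. \<forall>x\<in>A. m \<preceq> x"
  proof (rule ccontr)
    assume no: "\<not> ?thesis"
    define B where "B = {n. \<forall>i. i \<prec> n \<longrightarrow> i \<notin> A}"
    have "B \<in> Sets M"
      by (rule bounded_setI[where \<theta> = "\<^bold>\<forall>1. Var 1 \<^bold>< Var 0 \<^bold>\<longrightarrow> \<^bold>\<not> Var 1 \<^bold>\<in> 0"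
            and E = "\<lambda>_. A" and e = "\<lambda>_. \<zero>"])
        (use A in \<open>auto intro!: bounded_fm.intros simp: B_def\<close>)
    moreover have "\<zero> \<in> B" by (simp add: B_def)
    moreover have "n \<oplus> \<one> \<in> B" if "n \<in> B" for n
    proof -
      have "n \<notin> A" using no that unfolding B_def using N.not_less by blast
      then show ?thesis using that unfolding B_def by (auto simp: lte_def)
    qed
    ultimately have "n \<in> B" for n using set_induct by blast
    then show False using A(2) unfolding B_def using lt_succ_self by blast
  qed
  then show ?thesis using that by blast
qed

definition bdd :: "'a set \<Rightarrow> bool" where "bdd A \<longleftrightarrow> (\<exists>k. \<forall>i\<in>A. i \<prec> k)"

lemma not_bdd: "\<not> bdd A \<longleftrightarrow> (\<forall>k. \<exists>i\<in>A. k \<prec> i)"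
proof
  assume "\<not> bdd A"
  then have "\<exists>i\<in>A. \<not> i \<prec> k \<oplus> \<one>" for k unfolding bdd_def by blast
  then show "\<forall>k. \<exists>i\<in>A. k \<prec> i" unfolding lt_succ N.not_le by blast
next
  show "\<forall>k. \<exists>i\<in>A. k \<prec> i \<Longrightarrow> \<not> bdd A"
    unfolding bdd_def using N.less_asym by blast
qed

lemma bdd_subset: "bdd B \<Longrightarrow> A \<subseteq> B \<Longrightarrow> bdd A"
  unfolding bdd_def by (meson subsetD)

lemma bdd_Un: assumes "bdd A" "bdd B" shows "bdd (A \<union> B)"
proof -
  obtain k l where "\<forall>i\<in>A. i \<prec> k" "\<forall>i\<in>B. i \<prec> l"
    using assms unfolding bdd_def by metis
  then have "\<forall>i\<in>A \<union> B. i \<prec> k \<oplus> l" using le_add1 le_add2 N.less_le_trans by blast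
  then show ?thesis unfolding bdd_def by blast
qed

text \<open>
  The greatest element is the least upper bound; being an upper bound is a bounded condition because
  \<open>A\<close> has the bound \<open>k\<close>.
\<close>

lemma greatest_element:
  assumes A: "A \<in> Sets M" "A \<noteq> {}" "bdd A"
  obtains m where "m \<in> A" "\<And>x. x \<in> A \<Longrightarrow> x \<preceq> m"
proof -
  obtain k where k: "\<forall>i\<in>A. i \<prec> k" using A(3) bdd_def by blast
  define U where "U = {u. \<forall>i. i \<prec> k \<longrightarrow> i \<in> A \<longrightarrow> i \<preceq> u}"
  have "U \<in> Sets M"
    by (rule bounded_setI[where \<theta> = "\<^bold>\<forall>1. Var 1 \<^bold>< Var 2 \<^bold>\<longrightarrow> (Var 1 \<^bold>\<in> 0 \<^bold>\<longrightarrow> Var 1 \<^bold>\<le> Var 0)"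
          and E = "\<lambda>_. A" and e = "\<lambda>_. k"])
      (use A in \<open>auto intro!: bounded_fm.intros simp: U_def lte_def\<close>)
  moreover have "k \<in> U" unfolding U_def using lte_def by simp
  ultimately obtain u where u: "u \<in> U" "\<And>x. x \<in> U \<Longrightarrow> u \<preceq> x" using least_element by (metis empty_iff)
  have le: "x \<preceq> u" if "x \<in> A" for x using that u(1) k unfolding U_def by blast
  have "u \<in> A"
  proof (rule ccontr)
    assume "u \<notin> A"
    then have lt: "x \<prec> u" if "x \<in> A" for x using le[OF that] that lte_def by metis
    obtain w where "u = w \<oplus> \<one>" using zero_or_succ lt A(2) by (metis all_not_in_conv not_lt_zero)
    then have "w \<in> U" "w \<prec> u" unfolding U_def using lt by simp_all
    then show False using u(2) N.not_less by blast
  qed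
  then show ?thesis using that le by blast
qed

lemma common_multiple: "\<exists>B. \<zero> \<prec> B \<and> (\<forall>i. i \<prec> b \<longrightarrow> dv (i \<oplus> \<one>) B)"
proof -
  obtain S where S: "S \<in> Sets M" using sets_nonempty by blast
  define Q where "Q b \<longleftrightarrow> (\<exists>B. \<zero> \<prec> B \<and> (\<forall>i. i \<prec> b \<longrightarrow> dv (i \<oplus> \<one>) B))" for b
  have pos: "\<zero> \<prec> i \<oplus> \<one>" for i by simp
  have Q': "Q b \<longleftrightarrow> (\<exists>B. \<zero> \<prec> B \<and> (\<forall>i. i \<prec> b \<longrightarrow> (\<exists>c. c \<prec> B \<oplus> \<one> \<and> (i \<oplus> \<one>) \<otimes> c = B)))" for b
    unfolding Q_def using dv_bounded[OF pos] by simp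
  have "Q b"
  proof (rule sigma_induct[where x = 1 and E = "\<lambda>_. S" and e = "\<lambda>_. \<zero>" and
        \<theta> = "\<^bold>0 \<^bold>< Var 1 \<^bold>\<and> (\<^bold>\<forall>2. Var 2 \<^bold>< Var 0 \<^bold>\<longrightarrow>
          (\<^bold>\<exists>3. Var 3 \<^bold>< Var 1 \<^bold>+ \<^bold>1 \<^bold>\<and> (Var 2 \<^bold>+ \<^bold>1) \<^bold>* Var 3 \<^bold>= Var 1))"])
    show "Q \<zero>" unfolding Q_def by (auto intro: exI[of _ \<one>])
    show "Q (a \<oplus> \<one>)" if "Q a" for a
    proof -
      obtain B where B: "\<zero> \<prec> B" "\<forall>i. i \<prec> a \<longrightarrow> dv (i \<oplus> \<one>) B" using \<open>Q a\<close> Q_def by blast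
      have "\<zero> \<prec> B \<otimes> (a \<oplus> \<one>)" using B(1) pos by (intro N.mult_pos_pos)
      moreover have "dv (i \<oplus> \<one>) (B \<otimes> (a \<oplus> \<one>))" if "i \<preceq> a" for i
      proof (cases "i = a")
        case True
        then show ?thesis using N.mult.commute dv_mult dv_refl by metis
      next
        case False
        then show ?thesis using that B(2) dv_mult lte_def by metis
      qed
      ultimately show ?thesis unfolding Q_def by auto
    qed
  qed (use S in \<open>auto intro!: bounded_fm.intros simp: Q' N.add_pos_nonneg\<close>)
  then show ?thesis unfolding Q_def .
qed

lemma common_multiple_moduli: "\<exists>N. \<zero> \<prec> N \<and> (\<forall>i. i \<prec> b \<longrightarrow> dv (modulus B i) N)"
proof -
  obtain S where S: "S \<in> Sets M" using sets_nonempty by blast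
  define Q where "Q b \<longleftrightarrow> (\<exists>N. \<zero> \<prec> N \<and> (\<forall>i. i \<prec> b \<longrightarrow> dv (modulus B i) N))" for b
  have Q': "Q b \<longleftrightarrow> (\<exists>N. \<zero> \<prec> N \<and> (\<forall>i. i \<prec> b \<longrightarrow> (\<exists>c. c \<prec> N \<oplus> \<one> \<and> modulus B i \<otimes> c = N)))" for b
    unfolding Q_def using dv_bounded[OF modulus_pos] by simp
  have "Q b"
  proof (rule sigma_induct[where x = 1 and E = "\<lambda>_. S" and e = "\<lambda>_. B" and
        \<theta> = "\<^bold>0 \<^bold>< Var 1 \<^bold>\<and> (\<^bold>\<forall>2. Var 2 \<^bold>< Var 0 \<^bold>\<longrightarrow>
          (\<^bold>\<exists>3. Var 3 \<^bold>< Var 1 \<^bold>+ \<^bold>1 \<^bold>\<and> (\<^bold>1 \<^bold>+ (Var 2 \<^bold>+ \<^bold>1) \<^bold>* Var 4) \<^bold>* Var 3 \<^bold>= Var 1))"])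
    show "Q \<zero>" unfolding Q_def by (auto intro: exI[of _ \<one>])
    show "Q (a \<oplus> \<one>)" if "Q a" for a
    proof -
      obtain N where N: "\<zero> \<prec> N" "\<forall>i. i \<prec> a \<longrightarrow> dv (modulus B i) N" using \<open>Q a\<close> Q_def by blast
      have "\<zero> \<prec> N \<otimes> modulus B a" using N(1) modulus_pos by (intro N.mult_pos_pos)
      moreover have "dv (modulus B i) (N \<otimes> modulus B a)" if "i \<preceq> a" for i
      proof (cases "i = a")
        case True
        then show ?thesis using N.mult.commute dv_mult dv_refl by metis
      next
        case False
        then show ?thesis using that N(2) dv_mult lte_def by metis
      qed
      ultimately show ?thesis unfolding Q_def by auto
    qed
  qed (use S in \<open>auto intro!: bounded_fm.intros simp: Q' modulus_def\<close>)
  then show ?thesis unfolding Q_def .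
qed

text \<open>
  An injection of the model into itself takes large values arbitrarily late.  Without cardinalities
  of finite sets, the pigeons are counted by divisors: if all values from \<open>i0\<close> on were below \<open>b\<close>,
  let \<open>N\<close> be a common multiple of the coprime moduli of the numbers below \<open>b\<close>.  Each new value
  \<open>v\<close> moves the modulus of \<open>v\<close> from the cofactor \<open>q\<close> to the divisor \<open>a\<close> of \<open>N\<close>, and so \<open>a\<close> grows
  beyond \<open>N\<close>.
\<close>

lemma pigeonhole:
  assumes h: "h \<in> Sets M"
    and inj: "\<And>i j v. pr M i v \<in> h \<Longrightarrow> pr M j v \<in> h \<Longrightarrow> i = j"
    and fn: "\<And>i v w. pr M i v \<in> h \<Longrightarrow> pr M i w \<in> h \<Longrightarrow> v = w"
    and total: "\<And>i. \<exists>v. pr M i v \<in> h"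
  shows "\<exists>i v. i0 \<preceq> i \<and> pr M i v \<in> h \<and> b \<preceq> v"
proof (rule ccontr)
  assume "\<not> ?thesis"
  then have val: "\<exists>v. v \<prec> b \<and> pr M (i0 \<oplus> i) v \<in> h" for i
    using total le_add1 N.not_le by metis
  obtain B where B0: "\<zero> \<prec> B" and B: "\<forall>i. i \<prec> b \<longrightarrow> dv (i \<oplus> \<one>) B" using common_multiple by blast
  obtain N where N: "\<zero> \<prec> N" "\<forall>i. i \<prec> b \<longrightarrow> dv (modulus B i) N" using common_multiple_moduli by blast
  \<comment> \<open>After n values: a q = N, a exceeds n, and q is still divisible by the modulus of each unused v.\<close>
  define D where "D = {n. \<exists>a. a \<prec> N \<oplus> \<one> \<and> (\<exists>q. q \<prec> N \<oplus> \<one> \<and> a \<otimes> q = N \<and> n \<prec> a \<and>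
    (\<forall>v. v \<prec> b \<longrightarrow> (\<exists>i. i \<prec> n \<and> pr M (i0 \<oplus> i) v \<in> h) \<or> (\<exists>c. c \<prec> q \<oplus> \<one> \<and> modulus B v \<otimes> c = q)))}"
  define e where "e = (\<lambda>_::nat. \<zero>)(10 := N, 11 := b, 12 := B, 13 := i0)"
  have "D \<in> Sets M"
    by (rule bounded_setI[where E = "\<lambda>_. h" and e = e and \<theta> =
      "\<^bold>\<exists>1. Var 1 \<^bold>< Var 10 \<^bold>+ \<^bold>1 \<^bold>\<and> (\<^bold>\<exists>2. Var 2 \<^bold>< Var 10 \<^bold>+ \<^bold>1 \<^bold>\<and> Var 1 \<^bold>* Var 2 \<^bold>= Var 10 \<^bold>\<and>
        Var 0 \<^bold>< Var 1 \<^bold>\<and> (\<^bold>\<forall>3. Var 3 \<^bold>< Var 11 \<^bold>\<longrightarrow>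
          (\<^bold>\<exists>4. Var 4 \<^bold>< Var 0 \<^bold>\<and> pair_tm (Var 13 \<^bold>+ Var 4) (Var 3) \<^bold>\<in> 0) \<^bold>\<or>
          (\<^bold>\<exists>5. Var 5 \<^bold>< Var 2 \<^bold>+ \<^bold>1 \<^bold>\<and> (\<^bold>1 \<^bold>+ (Var 3 \<^bold>+ \<^bold>1) \<^bold>* Var 12) \<^bold>* Var 5 \<^bold>= Var 2)))"])
      (use h in \<open>auto intro!: bounded_fm.intros simp: D_def e_def modulus_def\<close>)
  moreover have D': "n \<in> D \<longleftrightarrow> (\<exists>a q. a \<otimes> q = N \<and> n \<prec> a \<and>
    (\<forall>v. v \<prec> b \<longrightarrow> (\<exists>i. i \<prec> n \<and> pr M (i0 \<oplus> i) v \<in> h) \<or> dv (modulus B v) q))" for n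
  proof -
    have "a \<prec> N \<oplus> \<one> \<and> q \<prec> N \<oplus> \<one>" if "a \<otimes> q = N" for a q
    proof -
      have "a \<noteq> \<zero>" "q \<noteq> \<zero>" using that N(1) by auto
      then have "\<zero> \<prec> a" "\<zero> \<prec> q" using zero_le lte_def by metis+
      then show ?thesis using that le_mult N.mult.commute lt_succ by metis
    qed
    then show ?thesis unfolding D_def dv_bounded[OF modulus_pos] by blast
  qed
  moreover have "\<zero> \<in> D" unfolding D' using N by - (rule exI[of _ \<one>], rule exI[of _ N], simp)
  moreover have "n \<oplus> \<one> \<in> D" if "n \<in> D" for n
  proof -
    obtain a q where aq: "a \<otimes> q = N" "n \<prec> a"
      "\<And>v. v \<prec> b \<Longrightarrow> (\<exists>i. i \<prec> n \<and> pr M (i0 \<oplus> i) v \<in> h) \<or> dv (modulus B v) q"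
      using \<open>n \<in> D\<close> D' by blast
    obtain v where v: "v \<prec> b" "pr M (i0 \<oplus> n) v \<in> h" using val by blast
    have "\<not> (\<exists>i. i \<prec> n \<and> pr M (i0 \<oplus> i) v \<in> h)"
      using inj v(2) N.add_left_imp_eq N.less_irrefl by metis
    then obtain q' where q': "modulus B v \<otimes> q' = q" using aq(3)[OF v(1)] dv_def by blast
    have "dv (modulus B w) q'" if w: "w \<prec> b" "\<not> (\<exists>i. i \<prec> n \<oplus> \<one> \<and> pr M (i0 \<oplus> i) w \<in> h)" for w
    proof -
      have "w \<noteq> v" using w(2) v(2) lt_succ_self by blast
      moreover have "dv (modulus B w) q" using aq(3)[OF w(1)] w(2) N.less_imp_le lt_succ by blast
      ultimately show ?thesis
        using modulus_coprime[of b B w v q'] B w(1) v(1) q' N.mult.commute by metis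
    qed
    moreover have "n \<oplus> \<one> \<prec> a \<otimes> modulus B v"
    proof -
      have "\<one> \<prec> modulus B v" using B0 by (rule modulus_gt_one)
      moreover have "\<zero> \<prec> a" using aq(2) zero_le N.le_less_trans by blast
      ultimately have "a \<prec> a \<otimes> modulus B v" using N.mult_strict_left_mono[of \<one> _ a] by simp
      then show ?thesis using aq(2) one_add_lte N.le_less_trans by blast
    qed
    moreover have "(a \<otimes> modulus B v) \<otimes> q' = N" using aq(1) q' N.mult.assoc by simp
    ultimately show ?thesis unfolding D' by blast
  qed
  ultimately have "N \<in> D" using set_induct by blast
  then obtain a q where "a \<otimes> q = N" "N \<prec> a" using D' by blast
  moreover from this N(1) have "\<zero> \<prec> q" using zero_le[of q] unfolding lte_def by auto
  ultimately show False using le_mult N.not_le by metis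
qed

end

section \<open>Closure under projection gives arithmetical comprehension\<close>

text \<open>
  Tuples are nested pairs, so that a formula with several free variables can be turned into a
  statement about membership of one term in a set.
\<close>

primrec tuple_tm :: "nat list \<Rightarrow> tm" where
  "tuple_tm [] = \<^bold>0"
| "tuple_tm (y # ys) = pair_tm (Var y) (tuple_tm ys)"

primrec bounded_exs :: "nat list \<Rightarrow> tm \<Rightarrow> fm \<Rightarrow> fm" where
  "bounded_exs [] t \<phi> = \<phi>"
| "bounded_exs (y # ys) t \<phi> = (\<^bold>\<exists>y. Var y \<^bold>< t \<^bold>\<and> bounded_exs ys t \<phi>)"

lemma bounded_fm_bounded_exs:
  "bounded_fm \<phi> \<Longrightarrow> set ys \<inter> vars_tm t = {} \<Longrightarrow> bounded_fm (bounded_exs ys t \<phi>)"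
  by (induction ys) (auto intro: bounded_fm.intros)

context rca0_model
begin

lemma eval_tuple_tm_eq_iff:
  "eval M e (tuple_tm ys) = eval M e' (tuple_tm ys) \<longleftrightarrow> (\<forall>y\<in>set ys. e y = e' y)"
  by (induction ys) auto

lemma le_eval_tuple_tm: "y \<in> set ys \<Longrightarrow> e y \<preceq> eval M e (tuple_tm ys)"
  by (induction ys) (auto intro: N.order_trans[OF _ le_pr2])

lemma sat_bounded_exs:
  "set ys \<inter> vars_tm t = {} \<Longrightarrow> sat M e E (bounded_exs ys t \<phi>) \<longleftrightarrow>
    (\<exists>f. (\<forall>y\<in>set ys. f y \<prec> eval M e t) \<and> sat M (\<lambda>v. if v \<in> set ys then f v else e v) E \<phi>)"
proof (induction ys arbitrary: e)
  case (Cons y ys)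
  have ev: "eval M (e(y := a)) t = eval M e t" for a
    using Cons.prems by (intro eval_cong) auto
  have IH: "sat M (e(y := a)) E (bounded_exs ys t \<phi>) \<longleftrightarrow>
    (\<exists>f. (\<forall>z\<in>set ys. f z \<prec> eval M e t) \<and>
      sat M (\<lambda>v. if v \<in> set ys then f v else (e(y := a)) v) E \<phi>)" for a
  proof -
    have "set ys \<inter> vars_tm t = {}" using Cons.prems by simp
    from Cons.IH[OF this, of "e(y := a)"] show ?thesis unfolding ev .
  qed
  show ?case
  proof
    assume "sat M e E (bounded_exs (y # ys) t \<phi>)"
    then obtain a f where a: "a \<prec> eval M e t" "\<forall>z\<in>set ys. f z \<prec> eval M e t"
        "sat M (\<lambda>v. if v \<in> set ys then f v else (e(y := a)) v) E \<phi>"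
      using IH ev by auto
    define g where "g = (\<lambda>v. if v \<in> set ys then f v else a)"
    have "(\<lambda>v. if v \<in> set ys then f v else (e(y := a)) v) =
        (\<lambda>v. if v \<in> set (y # ys) then g v else e v)"
      by (auto simp: g_def)
    moreover have "\<forall>z\<in>set (y # ys). g z \<prec> eval M e t" using a by (auto simp: g_def)
    ultimately show "\<exists>f. (\<forall>z\<in>set (y # ys). f z \<prec> eval M e t) \<and>
        sat M (\<lambda>v. if v \<in> set (y # ys) then f v else e v) E \<phi>"
      using a(3) by (intro exI[of _ g]) simp
  next
    assume "\<exists>f. (\<forall>z\<in>set (y # ys). f z \<prec> eval M e t) \<and>
        sat M (\<lambda>v. if v \<in> set (y # ys) then f v else e v) E \<phi>"
    then obtain f where f: "\<forall>z\<in>set (y # ys). f z \<prec> eval M e t"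
        "sat M (\<lambda>v. if v \<in> set (y # ys) then f v else e v) E \<phi>" by blast
    have "(\<lambda>v. if v \<in> set ys then f v else (e(y := f y)) v) =
        (\<lambda>v. if v \<in> set (y # ys) then f v else e v)" by auto
    then have "sat M (e(y := f y)) E (bounded_exs ys t \<phi>)" using IH f by auto
    then show "sat M e E (bounded_exs (y # ys) t \<phi>)" using f(1) ev by auto
  qed
qed simp

definition projection_closed :: bool where
  "projection_closed \<longleftrightarrow> (\<forall>A\<in>Sets M. {n. \<exists>s. pr M n s \<in> A} \<in> Sets M)"

text \<open>
  The quantifier is absorbed into a new set parameter: \<open>K\<close> is the set of codes of those values of
  the free variables \<open>ys\<close> for which some \<open>x\<close> satisfies \<open>\<theta>\<close>.  It is the projection of a set defined by
  a bounded formula, since every component of a tuple is at most its code.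
\<close>

lemma replace_Ex:
  assumes J: projection_closed and \<theta>: "bounded_fm \<theta>" and E: "range E \<subseteq> Sets M" and F: "finite F"
  shows "\<exists>\<phi>' E'. bounded_fm \<phi>' \<and> range E' \<subseteq> Sets M \<and> (\<forall>X\<in>F. E' X = E X) \<and>
    (\<forall>e. sat M e E' \<phi>' \<longleftrightarrow> sat M e E (\<^bold>\<exists>x. \<theta>))"
proof -
  obtain ys where ys: "set ys = num_vars \<theta> - {x}"
    using finite_num_vars finite_list finite_Diff by metis
  have "finite (insert x (num_vars \<theta>))" using finite_num_vars by blast
  then obtain z where z: "z \<noteq> x" "z \<notin> num_vars \<theta>" using fresh_var by blast
  have "finite (insert z (insert x (num_vars \<theta>)))" using finite_num_vars by blast
  then obtain w where w: "w \<noteq> z" "w \<noteq> x" "w \<notin> num_vars \<theta>" using fresh_var by blast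
  obtain X where X: "X \<notin> F" using fresh_var F by blast
  let ?t = "Var z \<^bold>+ \<^bold>1"
  \<comment> \<open>beta says that the tuple coded by z satisfies theta, for the current value of x.\<close>
  define \<beta> where "\<beta> = bounded_exs ys ?t (Var z \<^bold>= tuple_tm ys \<^bold>\<and> \<theta>)"
  have \<beta>: "bounded_fm \<beta>"
    unfolding \<beta>_def using \<theta> z ys by (intro bounded_fm_bounded_exs) (auto intro: bounded_fm.intros)
  have tup: "eval M (\<lambda>v. if v \<in> set ys then f v else g v) (tuple_tm ys) = eval M f (tuple_tm ys)" for f g
    by (subst eval_tuple_tm_eq_iff) simp
  have zys: "z \<notin> set ys" and disj: "set ys \<inter> vars_tm ?t = {}" using z ys by auto
  have sat_\<beta>: "sat M e E \<beta> \<longleftrightarrow> (\<exists>f. e z = eval M f (tuple_tm ys) \<and>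
      sat M (\<lambda>v. if v \<in> set ys then f v else e v) E \<theta>)" for e
  proof -
    have "sat M e E \<beta> \<longleftrightarrow> (\<exists>f. (\<forall>y\<in>set ys. f y \<prec> e z \<oplus> \<one>) \<and> e z = eval M f (tuple_tm ys) \<and>
      sat M (\<lambda>v. if v \<in> set ys then f v else e v) E \<theta>)"
      unfolding \<beta>_def sat_bounded_exs[OF disj] using zys by (simp add: tup)
    moreover have "\<forall>y\<in>set ys. f y \<prec> e z \<oplus> \<one>" if "e z = eval M f (tuple_tm ys)" for f
      using that le_eval_tuple_tm by simp
    ultimately show ?thesis by blast
  qed
  have cong: "sat M e E \<theta> = sat M e' E \<theta>" if "\<And>v. v \<in> insert x (set ys) \<Longrightarrow> e v = e' v" for e e'
    using that ys by (intro sat_num_cong) blast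
  define A where "A = {p. \<exists>c. c \<prec> p \<oplus> \<one> \<and> (\<exists>a. a \<prec> p \<oplus> \<one> \<and> p = pr M c a \<and>
    (\<exists>f. c = eval M f (tuple_tm ys) \<and> sat M (f(x := a)) E \<theta>))}"
  have "A \<in> Sets M"
  proof (rule bounded_setI_var[where E = E and e = "\<lambda>_. \<zero>" and n = w and
        \<theta> = "\<^bold>\<exists>z. Var z \<^bold>< Var w \<^bold>+ \<^bold>1 \<^bold>\<and> (\<^bold>\<exists>x. Var x \<^bold>< Var w \<^bold>+ \<^bold>1 \<^bold>\<and>
          (Var w \<^bold>= pair_tm (Var z) (Var x) \<^bold>\<and> \<beta>))"])
    have "sat M (\<lambda>v. if v \<in> set ys then f v else (e(x := a)) v) E \<theta> = sat M (f(x := a)) E \<theta>" for f e a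
      using ys by (intro cong) auto
    then show "p \<in> A \<longleftrightarrow> sat M ((\<lambda>_. \<zero>)(w := p)) E (\<^bold>\<exists>z. Var z \<^bold>< Var w \<^bold>+ \<^bold>1 \<^bold>\<and>
        (\<^bold>\<exists>x. Var x \<^bold>< Var w \<^bold>+ \<^bold>1 \<^bold>\<and> (Var w \<^bold>= pair_tm (Var z) (Var x) \<^bold>\<and> \<beta>)))" for p
      unfolding A_def using z w by (simp add: sat_\<beta> del: fun_upd_apply) (simp add: fun_upd_apply)
  qed (use E \<beta> z w in \<open>auto intro!: bounded_fm.intros\<close>)
  then have K: "{c. \<exists>a. pr M c a \<in> A} \<in> Sets M" (is "?K \<in> _") using J projection_closed_def by blast
  have "eval M e (tuple_tm ys) \<in> ?K \<longleftrightarrow> (\<exists>a. sat M (e(x := a)) E \<theta>)" for e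
  proof -
    have "eval M e (tuple_tm ys) \<in> ?K \<longleftrightarrow>
        (\<exists>a f. eval M e (tuple_tm ys) = eval M f (tuple_tm ys) \<and> sat M (f(x := a)) E \<theta>)"
      by (auto simp: A_def)
    also have "\<dots> \<longleftrightarrow> (\<exists>a. sat M (e(x := a)) E \<theta>)"
    proof -
      have "sat M (f(x := a)) E \<theta> = sat M (e(x := a)) E \<theta>"
        if "eval M e (tuple_tm ys) = eval M f (tuple_tm ys)" for a f
        using that unfolding eval_tuple_tm_eq_iff by (intro cong) auto
      then show ?thesis by blast
    qed
    finally show ?thesis .
  qed
  then show ?thesis using K E X
    by (intro exI[of _ "tuple_tm ys \<^bold>\<in> X"] exI[of _ "E(X := ?K)"]) (auto intro: bounded_fm.intros)
qed

text \<open>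
  The two subformulas are treated one after the other.  The replacement of the second must not
  change the set parameters of the first, and conversely; this is why the values of finitely many
  set variables, collected in \<open>F\<close>, are kept fixed.
\<close>

lemma connective_replacement:
  assumes \<phi>\<psi>: "arithmetical (op \<phi> \<psi>)" and E: "range E \<subseteq> Sets M" and F: "finite F"
    and IH1: "\<And>E F. arithmetical \<phi> \<Longrightarrow> range E \<subseteq> Sets M \<Longrightarrow> finite F \<Longrightarrow>
      \<exists>\<phi>' E'. bounded_fm \<phi>' \<and> range E' \<subseteq> Sets M \<and> (\<forall>X\<in>F. E' X = E X) \<and>
        (\<forall>e. sat M e E' \<phi>' \<longleftrightarrow> sat M e E \<phi>)"
    and IH2: "\<And>E F. arithmetical \<psi> \<Longrightarrow> range E \<subseteq> Sets M \<Longrightarrow> finite F \<Longrightarrow>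
      \<exists>\<psi>' E'. bounded_fm \<psi>' \<and> range E' \<subseteq> Sets M \<and> (\<forall>X\<in>F. E' X = E X) \<and>
        (\<forall>e. sat M e E' \<psi>' \<longleftrightarrow> sat M e E \<psi>)"
    and arith: "arithmetical (op \<phi> \<psi>) \<Longrightarrow> arithmetical \<phi> \<and> arithmetical \<psi>"
    and bounded: "\<And>\<phi> \<psi>. bounded_fm \<phi> \<Longrightarrow> bounded_fm \<psi> \<Longrightarrow> bounded_fm (op \<phi> \<psi>)"
    and sem: "\<And>e E E' \<phi> \<phi>' \<psi> \<psi>'. sat M e E \<phi> = sat M e E' \<phi>' \<Longrightarrow> sat M e E \<psi> = sat M e E' \<psi>' \<Longrightarrow>
      sat M e E (op \<phi> \<psi>) = sat M e E' (op \<phi>' \<psi>')"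
  shows "\<exists>\<phi>' E'. bounded_fm \<phi>' \<and> range E' \<subseteq> Sets M \<and> (\<forall>X\<in>F. E' X = E X) \<and>
    (\<forall>e. sat M e E' \<phi>' \<longleftrightarrow> sat M e E (op \<phi> \<psi>))"
proof -
  have a: "arithmetical \<phi>" "arithmetical \<psi>" using arith \<phi>\<psi> by auto
  have "finite (F \<union> free_set_vars \<psi>)" using F finite_free_set_vars by blast
  from IH1[OF a(1) E this] obtain \<phi>' E1 where 1: "bounded_fm \<phi>'" "range E1 \<subseteq> Sets M"
      "\<forall>X\<in>F \<union> free_set_vars \<psi>. E1 X = E X" "\<forall>e. sat M e E1 \<phi>' \<longleftrightarrow> sat M e E \<phi>" by blast
  have "finite (F \<union> free_set_vars \<phi>')" using F finite_free_set_vars by blast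
  from IH2[OF a(2) 1(2) this] obtain \<psi>' E2 where 2: "bounded_fm \<psi>'" "range E2 \<subseteq> Sets M"
      "\<forall>X\<in>F \<union> free_set_vars \<phi>'. E2 X = E1 X" "\<forall>e. sat M e E2 \<psi>' \<longleftrightarrow> sat M e E1 \<psi>" by blast
  have "sat M e E2 \<phi>' = sat M e E \<phi>" for e
    using 1(4) 2(3) sat_set_cong[of \<phi>' E2 E1 M e] by simp
  moreover have "sat M e E2 \<psi>' = sat M e E \<psi>" for e
    using 2(4) 1(3) sat_set_cong[of \<psi> E1 E M e] by simp
  ultimately have "sat M e E2 (op \<phi>' \<psi>') = sat M e E (op \<phi> \<psi>)" for e using sem by blast
  then show ?thesis using 1 2 bounded by (intro exI[of _ "op \<phi>' \<psi>'"] exI[of _ E2]) auto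
qed

text \<open>
  Closure under projection removes one number quantifier at a time, from the inside out, at the
  price of new set parameters.
\<close>

lemma arithmetical_bounded_replacement:
  assumes J: projection_closed
  shows "arithmetical \<phi> \<Longrightarrow> range E \<subseteq> Sets M \<Longrightarrow> finite F \<Longrightarrow>
    \<exists>\<phi>' E'. bounded_fm \<phi>' \<and> range E' \<subseteq> Sets M \<and> (\<forall>X\<in>F. E' X = E X) \<and>
      (\<forall>e. sat M e E' \<phi>' \<longleftrightarrow> sat M e E \<phi>)"
proof (induction \<phi> arbitrary: E F)
  case (Eq s t)
  then show ?case by (blast intro: bounded_fm.intros)
next
  case (Less s t)
  then show ?case by (blast intro: bounded_fm.intros)
next
  case (Mem t X)
  then show ?case by (blast intro: bounded_fm.intros)
next
  case (Neg \<phi>)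
  then obtain \<phi>' E' where "bounded_fm \<phi>'" "range E' \<subseteq> Sets M" "\<forall>X\<in>F. E' X = E X"
      "\<forall>e. sat M e E' \<phi>' \<longleftrightarrow> sat M e E \<phi>" by (metis arithmetical.simps(4))
  then show ?case by (intro exI[of _ "\<^bold>\<not> \<phi>'"] exI[of _ E']) (auto intro: bounded_fm.intros)
next
  case (Ex x \<phi>)
  then obtain \<phi>' E' where 1: "bounded_fm \<phi>'" "range E' \<subseteq> Sets M" "\<forall>X\<in>F. E' X = E X"
      "\<forall>e. sat M e E' \<phi>' \<longleftrightarrow> sat M e E \<phi>" by (metis arithmetical.simps(10))
  then show ?case using replace_Ex[OF J 1(1,2) Ex.prems(3), of x] by simp
next
  case (All x \<phi>)
  then obtain \<phi>' E' where 1: "bounded_fm \<phi>'" "range E' \<subseteq> Sets M" "\<forall>X\<in>F. E' X = E X"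
      "\<forall>e. sat M e E' \<phi>' \<longleftrightarrow> sat M e E \<phi>" by (metis arithmetical.simps(9))
  have "bounded_fm (\<^bold>\<not> \<phi>')" using 1(1) by (rule bounded_fm.intros)
  from replace_Ex[OF J this 1(2) All.prems(3), of x]
  obtain \<psi> E'' where "bounded_fm \<psi>" "range E'' \<subseteq> Sets M" "\<forall>X\<in>F. E'' X = E X"
      "\<forall>e. sat M e E'' \<psi> \<longleftrightarrow> \<not> sat M e E (\<^bold>\<forall>x. \<phi>)" using 1(3,4) by auto
  then show ?case by (intro exI[of _ "\<^bold>\<not> \<psi>"] exI[of _ E'']) (auto intro: bounded_fm.intros)
next
  case (Conj \<phi> \<psi>)
  from Conj.prems Conj.IH show ?case by (rule connective_replacement) (auto intro: bounded_fm.intros)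
next
  case (Disj \<phi> \<psi>)
  from Disj.prems Disj.IH show ?case by (rule connective_replacement) (auto intro: bounded_fm.intros)
next
  case (Imp \<phi> \<psi>)
  from Imp.prems Imp.IH show ?case by (rule connective_replacement) (auto intro: bounded_fm.intros)
next
  case (Iff \<phi> \<psi>)
  from Iff.prems Iff.IH show ?case by (rule connective_replacement) (auto intro: bounded_fm.intros)
qed simp_all

theorem projection_closed_imp_ACA0:
  assumes J: projection_closed
  shows "M \<Turnstile> ACA0"
  unfolding models_def
proof (intro ballI allI impI)
  fix \<chi> e and E :: "nat \<Rightarrow> 'a set"
  assume \<chi>: "\<chi> \<in> ACA0" and E: "range E \<subseteq> Sets M"
  show "sat M e E \<chi>"
  proof (cases "\<chi> \<in> RCA0")
    case False
    then obtain n X \<phi> where \<phi>: "\<chi> = (\<^bold>\<exists>\<^sub>sX. \<^bold>\<forall>n. Var n \<^bold>\<in> X \<^bold>\<longleftrightarrow> \<phi>)" "arithmetical \<phi>"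
        "X \<notin> free_set_vars \<phi>"
      using \<chi> unfolding ACA0_def arithmetical_comprehension_def by blast
    obtain \<phi>' E' where 1: "bounded_fm \<phi>'" "range E' \<subseteq> Sets M"
        "\<forall>e. sat M e E' \<phi>' \<longleftrightarrow> sat M e E \<phi>"
      using arithmetical_bounded_replacement[OF J \<phi>(2) E finite.emptyI] by blast
    have A: "{a. sat M (e(n := a)) E \<phi>} \<in> Sets M" (is "?A \<in> _")
      by (rule bounded_setI_var[OF 1(1,2)]) (use 1(3) in simp)
    have "sat M f (E(X := ?A)) \<phi> = sat M f E \<phi>" for f
      using \<phi>(3) by (intro sat_set_cong) auto
    then show ?thesis unfolding \<phi>(1) using A by (auto intro!: bexI[of _ ?A])
  qed (use E sat_rca0 in blast)
qed

end

section \<open>The two principles inside a model\<close>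

context rca0_model
begin

definition partial_order :: "'a set \<Rightarrow> 'a set \<Rightarrow> bool" where
  "partial_order P L \<longleftrightarrow>
    L \<subseteq> {pr M p q | p q. p \<in> P \<and> q \<in> P} \<and>
    (\<forall>p\<in>P. pr M p p \<notin> L) \<and>
    (\<forall>p\<in>P. \<forall>q\<in>P. \<forall>r\<in>P. pr M p q \<in> L \<and> pr M q r \<in> L \<longrightarrow> pr M p r \<in> L)"

definition homogeneous :: "'a set \<Rightarrow> 'a set \<Rightarrow> 'a set \<Rightarrow> bool" where
  "homogeneous P L C \<longleftrightarrow>
    C \<subseteq> P \<and> (\<forall>p\<in>C. \<forall>q\<in>C. cmp M L p q) \<and> \<not> bdd C \<and>
    (\<forall>p\<in>P. (\<forall>c\<in>C. \<not> cmp M L p c) \<or> (\<forall>k. \<exists>c\<in>C. k \<prec> c \<and> cmp M L p c))"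

definition antichain :: "'a set \<Rightarrow> 'a set \<Rightarrow> 'a set \<Rightarrow> bool" where
  "antichain P L A \<longleftrightarrow> A \<subseteq> P \<and> (\<forall>p\<in>A. \<forall>q\<in>A. p \<noteq> q \<longrightarrow> \<not> cmp M L p q)"

definition well_partial_order :: "'a set \<Rightarrow> 'a set \<Rightarrow> bool" where
  "well_partial_order P L \<longleftrightarrow> partial_order P L \<and>
    (\<forall>h\<in>Sets M. h \<subseteq> {pr M m p | m p. p \<in> P} \<and> (\<forall>m. \<exists>!p. pr M m p \<in> h) \<longrightarrow>
      (\<exists>m n p q. m \<prec> n \<and> pr M m p \<in> h \<and> pr M n q \<in> h \<and> (pr M p q \<in> L \<or> p = q)))"

lemma models_no_antichain_principle:
  "M \<Turnstile> {no_antichain_principle} \<longleftrightarrow>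
    (\<forall>P\<in>Sets M. \<forall>L\<in>Sets M. partial_order P L \<and> \<not> bdd P \<and>
      \<not> (\<exists>A\<in>Sets M. antichain P L A \<and> \<not> bdd A) \<longrightarrow> (\<exists>C\<in>Sets M. homogeneous P L C))"
proof -
  obtain S where "S \<in> Sets M" using sets_nonempty by blast
  then have "\<exists>E. range (E :: nat \<Rightarrow> 'a set) \<subseteq> Sets M" by (intro exI[of _ "\<lambda>_. S"]) auto
  then show ?thesis
    unfolding models_def no_antichain_principle_def partial_order_def homogeneous_def antichain_def not_bdd
    by simp
qed

lemma models_wpo_principle:
  "M \<Turnstile> {wpo_principle} \<longleftrightarrow>
    (\<forall>P\<in>Sets M. \<forall>L\<in>Sets M. well_partial_order P L \<and> \<not> bdd P \<longrightarrow>
      (\<exists>C\<in>Sets M. homogeneous P L C))"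
proof -
  obtain S where "S \<in> Sets M" using sets_nonempty by blast
  then have "\<exists>E. range (E :: nat \<Rightarrow> 'a set) \<subseteq> Sets M" by (intro exI[of _ "\<lambda>_. S"]) auto
  then show ?thesis
    unfolding models_def wpo_principle_def partial_order_def homogeneous_def well_partial_order_def not_bdd
    by simp
qed

end

section \<open>The order of stages of an enumeration\<close>

context rca0_model
begin

text \<open>
  Stages are pairs \<open>(f, s)\<close>, read as: the number \<open>f\<close> is enumerated.
\<close>

definition injures :: "'a \<Rightarrow> 'a \<Rightarrow> bool" where
  "injures k x \<longleftrightarrow> (\<exists>f s g t. k = pr M f s \<and> x = pr M g t \<and> x \<prec> k \<and> f \<prec> g)"

definition true_stage :: "'a set \<Rightarrow> 'a \<Rightarrow> bool" where
  "true_stage S x \<longleftrightarrow> x \<in> S \<and> (\<forall>k\<in>S. \<not> injures k x)"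

definition stage_order :: "'a set \<Rightarrow> 'a set" where
  "stage_order S = {pr M x y | x y. x \<in> S \<and> y \<in> S \<and> (\<exists>k\<in>S. k \<preceq> y \<and> injures k x)}"

lemma injures_pr [simp]: "injures (pr M f s) (pr M g t) \<longleftrightarrow> pr M g t \<prec> pr M f s \<and> f \<prec> g"
  unfolding injures_def by auto

lemma injures_less: "injures k x \<Longrightarrow> x \<prec> k"
  unfolding injures_def by auto

lemma stage_order_iff:
  "pr M x y \<in> stage_order S \<longleftrightarrow> x \<in> S \<and> y \<in> S \<and> (\<exists>k\<in>S. k \<preceq> y \<and> injures k x)"
  unfolding stage_order_def by auto

lemma stage_order_less: "pr M x y \<in> stage_order S \<Longrightarrow> x \<prec> y"
  unfolding stage_order_iff using injures_less N.less_le_trans by blast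

lemma stage_order_in_Sets: assumes S: "S \<in> Sets M" shows "stage_order S \<in> Sets M"
proof -
  have inj: "injures k x \<longleftrightarrow> (\<exists>f. f \<prec> k \<oplus> \<one> \<and> (\<exists>s. s \<prec> k \<oplus> \<one> \<and>
      (\<exists>g. g \<prec> x \<oplus> \<one> \<and> (\<exists>t. t \<prec> x \<oplus> \<one> \<and> k = pr M f s \<and> x = pr M g t \<and> x \<prec> k \<and> f \<prec> g))))" for k x
  proof -
    have "f \<prec> z \<oplus> \<one> \<and> s \<prec> z \<oplus> \<one>" if "z = pr M f s" for f s z using that by simp
    then show ?thesis unfolding injures_def by blast
  qed
  have *: "w \<in> stage_order S \<longleftrightarrow> (\<exists>x. x \<prec> w \<oplus> \<one> \<and> (\<exists>y. y \<prec> w \<oplus> \<one> \<and>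
      w = pr M x y \<and> x \<in> S \<and> y \<in> S \<and> (\<exists>k. k \<prec> y \<oplus> \<one> \<and> k \<in> S \<and> injures k x)))" for w
  proof -
    have "x \<prec> w \<oplus> \<one> \<and> y \<prec> w \<oplus> \<one>" if "w = pr M x y" for x y using that by simp
    then show ?thesis unfolding stage_order_def lt_succ by blast
  qed
  show ?thesis
    by (rule bounded_setI[where E = "\<lambda>_. S" and e = "\<lambda>_. \<zero>" and \<theta> =
      "\<^bold>\<exists>1. Var 1 \<^bold>< Var 0 \<^bold>+ \<^bold>1 \<^bold>\<and> (\<^bold>\<exists>2. Var 2 \<^bold>< Var 0 \<^bold>+ \<^bold>1 \<^bold>\<and>
        Var 0 \<^bold>= pair_tm (Var 1) (Var 2) \<^bold>\<and> Var 1 \<^bold>\<in> 0 \<^bold>\<and> Var 2 \<^bold>\<in> 0 \<^bold>\<and>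
        (\<^bold>\<exists>3. Var 3 \<^bold>< Var 2 \<^bold>+ \<^bold>1 \<^bold>\<and> Var 3 \<^bold>\<in> 0 \<^bold>\<and>
          (\<^bold>\<exists>4. Var 4 \<^bold>< Var 3 \<^bold>+ \<^bold>1 \<^bold>\<and> (\<^bold>\<exists>5. Var 5 \<^bold>< Var 3 \<^bold>+ \<^bold>1 \<^bold>\<and>
          (\<^bold>\<exists>6. Var 6 \<^bold>< Var 1 \<^bold>+ \<^bold>1 \<^bold>\<and> (\<^bold>\<exists>7. Var 7 \<^bold>< Var 1 \<^bold>+ \<^bold>1 \<^bold>\<and>
            Var 3 \<^bold>= pair_tm (Var 4) (Var 5) \<^bold>\<and> Var 1 \<^bold>= pair_tm (Var 6) (Var 7) \<^bold>\<and>
            Var 1 \<^bold>< Var 3 \<^bold>\<and> Var 4 \<^bold>< Var 6))))))"])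
      (use S in \<open>auto intro!: bounded_fm.intros simp: * inj simp del: lt_succ\<close>)
qed

lemma partial_order_stage_order: "partial_order S (stage_order S)"
  unfolding partial_order_def
proof (intro conjI ballI impI)
  show "stage_order S \<subseteq> {pr M p q |p q. p \<in> S \<and> q \<in> S}" unfolding stage_order_def by blast
  show "pr M p p \<notin> stage_order S" for p using stage_order_less N.less_irrefl by blast
  show "pr M p r \<in> stage_order S" if "pr M p q \<in> stage_order S \<and> pr M q r \<in> stage_order S" for p q r
    using that stage_order_less[of q r S] unfolding stage_order_iff
    using N.less_imp_le N.order_trans by blast
qed

text \<open>
  If all stages after \<open>n\<close> were injured, passing from a stage to one that injures it would give a
  descending sequence of numbers.  This is phrased as a \<open>\<Sigma>\<^sup>0\<^sub>1\<close> induction: some stage after \<open>n\<close>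
  enumerates a number that is at least \<open>m\<close> smaller than the first one.
\<close>

lemma true_stages_unbounded:
  assumes S: "S \<in> Sets M" "\<not> bdd S" "\<And>x. x \<in> S \<Longrightarrow> \<exists>f s. x = pr M f s"
  shows "\<exists>x. n \<prec> x \<and> true_stage S x"
proof (rule ccontr)
  assume no: "\<not> ?thesis"
  obtain x where x: "x \<in> S" "n \<prec> x" using S(2) not_bdd by blast
  obtain f0 s0 where x0: "x = pr M f0 s0" using S(3) x(1) by blast
  define Q where "Q m \<longleftrightarrow> (\<exists>w. w \<in> S \<and> n \<prec> w \<and> (\<exists>f. f \<prec> w \<oplus> \<one> \<and> (\<exists>s. s \<prec> w \<oplus> \<one> \<and> w = pr M f s \<and> f \<oplus> m \<prec> f0 \<oplus> \<one>)))" for m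
  have "Q m" for m
  proof (rule sigma_induct[where x = 1 and E = "\<lambda>_. S" and e = "(\<lambda>_. \<zero>)(10 := n, 11 := f0)" and \<theta> =
        "Var 1 \<^bold>\<in> 0 \<^bold>\<and> Var 10 \<^bold>< Var 1 \<^bold>\<and> (\<^bold>\<exists>2. Var 2 \<^bold>< Var 1 \<^bold>+ \<^bold>1 \<^bold>\<and> (\<^bold>\<exists>3. Var 3 \<^bold>< Var 1 \<^bold>+ \<^bold>1 \<^bold>\<and>
          Var 1 \<^bold>= pair_tm (Var 2) (Var 3) \<^bold>\<and> Var 2 \<^bold>+ Var 0 \<^bold>< Var 11 \<^bold>+ \<^bold>1))"])
    show "Q \<zero>" unfolding Q_def using x x0 by (intro exI[of _ x]) auto
    show "Q (m \<oplus> \<one>)" if Qm: "Q m" for m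
    proof -
      obtain f s where w: "pr M f s \<in> S" "n \<prec> pr M f s" "f \<oplus> m \<preceq> f0"
        using Qm unfolding Q_def by auto
      then obtain k where k: "k \<in> S" "injures k (pr M f s)"
        using no unfolding true_stage_def by blast
      obtain f' s' where k': "k = pr M f' s'" using S(3) k(1) by blast
      have "f' \<oplus> \<one> \<preceq> f" using k(2) k' one_add_lte by auto
      then have "f' \<oplus> \<one> \<oplus> m \<preceq> f0" using N.add_right_mono w(3) N.order_trans by blast
      then have "f' \<oplus> (m \<oplus> \<one>) \<preceq> f0" by (simp add: N.add.assoc N.add.commute N.add.left_commute)
      moreover have "n \<prec> k" using w(2) injures_less[OF k(2)] N.less_trans by blast
      ultimately show ?thesis unfolding Q_def using k(1) k' by (intro exI[of _ k]) auto
    qed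
  qed (use S in \<open>auto intro!: bounded_fm.intros simp: Q_def\<close>)
  from this[of "f0 \<oplus> \<one>"] obtain f where "f \<oplus> (f0 \<oplus> \<one>) \<preceq> f0" unfolding Q_def by auto
  then have "f0 \<oplus> \<one> \<preceq> f0" using le_add2 N.order_trans by blast
  then show False using N.not_le lt_succ_self by blast
qed

text \<open>
  A true stage \<open>y\<close> that is late enough lies above an element of the chain.  As it is maximal, it is
  not comparable with any later element of the chain.
\<close>

lemma no_homogeneous_chain:
  assumes S: "S \<in> Sets M" "\<not> bdd S" "\<And>x. x \<in> S \<Longrightarrow> \<exists>f s. x = pr M f s"
  shows "\<not> homogeneous S (stage_order S) C"
proof
  assume C: "homogeneous S (stage_order S) C"
  then have unb: "\<not> bdd C" and sub: "C \<subseteq> S" unfolding homogeneous_def by auto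
  have ord: "pr M p q \<in> stage_order S" if "cmp M (stage_order S) p q" "p \<prec> q" for p q
    using that stage_order_less N.less_asym N.less_irrefl unfolding cmp_def by blast
  obtain c where c: "c \<in> C" using unb not_bdd by blast
  obtain c' where c': "c' \<in> C" "c \<prec> c'" using unb not_bdd by blast
  have "pr M c c' \<in> stage_order S" using C c c' ord unfolding homogeneous_def by blast
  then obtain k where k: "k \<in> S" "k \<preceq> c'" "injures k c" unfolding stage_order_iff by blast
  obtain y where y: "c' \<prec> y" "true_stage S y" using true_stages_unbounded[OF S] by blast
  have "k \<preceq> y" using k(2) y(1) N.le_less_trans N.less_imp_le by blast
  then have "pr M c y \<in> stage_order S" using k y(2) c sub unfolding stage_order_iff true_stage_def by blast
  then have "cmp M (stage_order S) y c" unfolding cmp_def by blast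
  moreover have "y \<in> S" using y(2) true_stage_def by blast
  ultimately obtain d where d: "d \<in> C" "y \<prec> d" "cmp M (stage_order S) y d"
    using C c unfolding homogeneous_def by meson
  then have "pr M y d \<in> stage_order S" using ord by blast
  then show False using y(2) unfolding stage_order_iff true_stage_def by blast
qed

text \<open>
  \<open>T\<close> is a set of pairs \<open>(i, x)\<close> in order to cover sequences as well as sets of true stages, since the
  range of a sequence need not be a set of the model.  A number \<open>n\<close> is enumerated if and only if it is
  enumerated before any given true stage from \<open>T\<close> that enumerates a number larger than \<open>n\<close>; there
  is always such a true stage, so both a \<open>\<Sigma>\<^sup>0\<^sub>1\<close> and a \<open>\<Pi>\<^sup>0\<^sub>1\<close> definition are available.
\<close>

lemma projection_from_true_stages:
  assumes S: "S \<in> Sets M" "\<And>n s t. pr M n s \<in> S \<Longrightarrow> pr M n t \<in> S \<Longrightarrow> s = t"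
      "\<And>x. x \<in> S \<Longrightarrow> \<exists>f s. x = pr M f s"
    and T: "T \<in> Sets M" "\<And>i x. pr M i x \<in> T \<Longrightarrow> true_stage S x"
      "\<And>k. \<exists>i x. pr M i x \<in> T \<and> k \<prec> x"
  shows "{n. \<exists>s. pr M n s \<in> S} \<in> Sets M"
proof -
  have above: "g \<prec> f" if "pr M i (pr M g t) \<in> T" "pr M f s \<in> S" "pr M g t \<prec> pr M f s" for i f s g t
  proof -
    have "true_stage S (pr M g t)" using T(2) that(1) by blast
    then have "\<not> f \<prec> g" "pr M g t \<in> S" using that unfolding true_stage_def by auto
    moreover have "f \<noteq> g" using S(2) that(2,3) \<open>pr M g t \<in> S\<close> N.less_irrefl by blast
    ultimately show ?thesis using N.less_linear by blast
  qed
  define Q where "Q n \<longleftrightarrow> (\<exists>w. w \<in> T \<and> (\<exists>i. i \<prec> w \<oplus> \<one> \<and> (\<exists>f. f \<prec> w \<oplus> \<one> \<and> (\<exists>s. s \<prec> w \<oplus> \<one> \<and>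
    w = pr M i (pr M f s) \<and> n \<prec> f))))" for n
  have Q': "Q n \<longleftrightarrow> (\<exists>i f s. pr M i (pr M f s) \<in> T \<and> n \<prec> f)" for n
    unfolding Q_def using N.order_trans[OF le_pr1 le_pr2] N.order_trans[OF le_pr2 le_pr2]
    by (auto simp: lt_succ)
  have Q: "Q n" for n
  proof (rule sigma_induct[where x = 1 and E = "\<lambda>_. T" and e = "\<lambda>_. \<zero>" and \<theta> =
        "Var 1 \<^bold>\<in> 0 \<^bold>\<and> (\<^bold>\<exists>2. Var 2 \<^bold>< Var 1 \<^bold>+ \<^bold>1 \<^bold>\<and> (\<^bold>\<exists>3. Var 3 \<^bold>< Var 1 \<^bold>+ \<^bold>1 \<^bold>\<and> (\<^bold>\<exists>4. Var 4 \<^bold>< Var 1 \<^bold>+ \<^bold>1 \<^bold>\<and>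
          Var 1 \<^bold>= pair_tm (Var 2) (pair_tm (Var 3) (Var 4)) \<^bold>\<and> Var 0 \<^bold>< Var 3)))"])
    have beyond: "\<exists>j f' s'. pr M j (pr M f' s') \<in> T \<and> f \<prec> f'" if fs: "pr M i (pr M f s) \<in> T" for i f s
    proof -
      obtain j y where y: "pr M j y \<in> T" "pr M f s \<prec> y" using T(3) by blast
      then have yS: "y \<in> S" using T(2) true_stage_def by blast
      then obtain f' s' where "y = pr M f' s'" using S(3) by blast
      then show ?thesis using above[OF fs] y yS by blast
    qed
    show "Q \<zero>"
    proof -
      obtain i x where "pr M i x \<in> T" using T(3) by blast
      moreover from this obtain f s where "x = pr M f s" using S(3) T(2) true_stage_def by blast
      ultimately obtain j f' s' where "pr M j (pr M f' s') \<in> T" "f \<prec> f'" using beyond by blast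
      then show ?thesis unfolding Q' using zero_le N.le_less_trans by blast
    qed
    show "Q (n \<oplus> \<one>)" if "Q n" for n
    proof -
      obtain i f s where "pr M i (pr M f s) \<in> T" "n \<prec> f" using \<open>Q n\<close> Q' by blast
      moreover from this obtain j f' s' where "pr M j (pr M f' s') \<in> T" "f \<prec> f'" using beyond by blast
      ultimately show ?thesis unfolding Q' using one_add_lte N.le_less_trans by blast
    qed
  qed (use T in \<open>auto intro!: bounded_fm.intros simp: Q_def\<close>)
  show ?thesis
  proof (rule delta_setI[where n = 0 and x = 1 and y = 1 and E = "(\<lambda>_. S)(1 := T)" and e = "\<lambda>_. \<zero>" and
        \<theta> = "pair_tm (Var 0) (Var 1) \<^bold>\<in> 0" and
        \<chi> = "\<^bold>\<forall>2. Var 2 \<^bold>< Var 1 \<^bold>+ \<^bold>1 \<^bold>\<longrightarrow> (\<^bold>\<forall>3. Var 3 \<^bold>< Var 1 \<^bold>+ \<^bold>1 \<^bold>\<longrightarrow> (\<^bold>\<forall>4. Var 4 \<^bold>< Var 1 \<^bold>+ \<^bold>1 \<^bold>\<longrightarrow>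
          (Var 1 \<^bold>= pair_tm (Var 2) (pair_tm (Var 3) (Var 4)) \<^bold>\<and> Var 1 \<^bold>\<in> 1 \<^bold>\<and> Var 0 \<^bold>< Var 3 \<^bold>\<longrightarrow>
            (\<^bold>\<exists>5. Var 5 \<^bold>< Var 1 \<^bold>+ \<^bold>1 \<^bold>\<and> pair_tm (Var 0) (Var 5) \<^bold>\<in> 0))))"])
    fix n
    have "(\<exists>s. pr M n s \<in> S) \<longleftrightarrow> (\<forall>w i f s. w = pr M i (pr M f s) \<and> w \<in> T \<and> n \<prec> f \<longrightarrow>
        (\<exists>t. t \<prec> w \<oplus> \<one> \<and> pr M n t \<in> S))" (is "?l \<longleftrightarrow> ?r")
    proof
      assume ?l
      then obtain t where t: "pr M n t \<in> S" by blast
      show ?r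
      proof (intro allI impI, elim conjE)
        fix w i f s
        assume w: "w = pr M i (pr M f s)" "w \<in> T" "n \<prec> f"
        then have "\<not> pr M f s \<prec> pr M n t" using above t N.less_asym by blast
        then have "pr M n t \<preceq> pr M f s" using N.not_less by blast
        then have "t \<preceq> w" using w(1) le_pr2 N.order_trans by metis
        then show "\<exists>t. t \<prec> w \<oplus> \<one> \<and> pr M n t \<in> S" using t by auto
      qed
    next
      assume r: ?r
      obtain i f s where "pr M i (pr M f s) \<in> T" "n \<prec> f" using Q Q' by blast
      then show ?l using r by blast
    qed
    also have "?r \<longleftrightarrow> (\<forall>w. \<forall>i. i \<prec> w \<oplus> \<one> \<longrightarrow> (\<forall>f. f \<prec> w \<oplus> \<one> \<longrightarrow> (\<forall>s. s \<prec> w \<oplus> \<one> \<longrightarrow>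
        (w = pr M i (pr M f s) \<and> w \<in> T \<and> n \<prec> f \<longrightarrow> (\<exists>t. t \<prec> w \<oplus> \<one> \<and> pr M n t \<in> S)))))"
      (is "_ \<longleftrightarrow> ?r'")
    proof
      assume r': ?r'
      show ?r
      proof (intro allI impI)
        fix w i f s
        assume w: "w = pr M i (pr M f s) \<and> w \<in> T \<and> n \<prec> f"
        then have "i \<prec> w \<oplus> \<one>" "f \<prec> w \<oplus> \<one>" "s \<prec> w \<oplus> \<one>"
          using N.order_trans[OF le_pr1 le_pr2] N.order_trans[OF le_pr2 le_pr2] by simp_all
        then show "\<exists>t. t \<prec> w \<oplus> \<one> \<and> pr M n t \<in> S" using r' w by blast
      qed
    qed blast
    finally show "n \<in> {n. \<exists>s. pr M n s \<in> S} \<longleftrightarrow>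
        (\<forall>b. sat M ((\<lambda>_. \<zero>)(0 := n, 1 := b)) ((\<lambda>_. S)(1 := T))
        (\<^bold>\<forall>2. Var 2 \<^bold>< Var 1 \<^bold>+ \<^bold>1 \<^bold>\<longrightarrow> (\<^bold>\<forall>3. Var 3 \<^bold>< Var 1 \<^bold>+ \<^bold>1 \<^bold>\<longrightarrow> (\<^bold>\<forall>4. Var 4 \<^bold>< Var 1 \<^bold>+ \<^bold>1 \<^bold>\<longrightarrow>
          (Var 1 \<^bold>= pair_tm (Var 2) (pair_tm (Var 3) (Var 4)) \<^bold>\<and> Var 1 \<^bold>\<in> 1 \<^bold>\<and> Var 0 \<^bold>< Var 3 \<^bold>\<longrightarrow>
            (\<^bold>\<exists>5. Var 5 \<^bold>< Var 1 \<^bold>+ \<^bold>1 \<^bold>\<and> pair_tm (Var 0) (Var 5) \<^bold>\<in> 0))))))"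
      by (simp del: lt_succ)
  qed (use S T in \<open>auto intro!: bounded_fm.intros\<close>)
qed

text \<open>
  The hypothesis is the common part of the two principles: a partial order without homogeneous
  chains yields arbitrarily large elements \<open>y\<close> that are not above a given \<open>x\<close>, for \<open>x\<close> in the same
  antichain or bad sequence.  In the order of stages, such an \<open>x\<close> is true.
\<close>

lemma projection_closedI:
  assumes H: "\<And>S L. S \<in> Sets M \<Longrightarrow> L \<in> Sets M \<Longrightarrow> partial_order S L \<Longrightarrow> \<not> bdd S \<Longrightarrow>
    (\<And>C. \<not> homogeneous S L C) \<Longrightarrow>
    \<exists>T\<in>Sets M. (\<exists>i x. pr M i x \<in> T) \<and> (\<forall>i x. pr M i x \<in> T \<longrightarrow> x \<in> S \<and>
      (\<forall>k. \<exists>j y. pr M j y \<in> T \<and> k \<prec> y \<and> pr M x y \<notin> L))"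
  shows projection_closed
  unfolding projection_closed_def
proof
  fix A assume A: "A \<in> Sets M"
  \<comment> \<open>Only the least witness of each number counts as a stage, so that no number is enumerated twice.\<close>
  define S where "S = {w. \<exists>n. n \<prec> w \<oplus> \<one> \<and> (\<exists>s. s \<prec> w \<oplus> \<one> \<and> w = pr M n s \<and> w \<in> A \<and>
    (\<forall>t. t \<prec> s \<longrightarrow> pr M n t \<notin> A))}"
  have S: "S \<in> Sets M"
    by (rule bounded_setI[where E = "\<lambda>_. A" and e = "\<lambda>_. \<zero>" and \<theta> =
      "\<^bold>\<exists>1. Var 1 \<^bold>< Var 0 \<^bold>+ \<^bold>1 \<^bold>\<and> (\<^bold>\<exists>2. Var 2 \<^bold>< Var 0 \<^bold>+ \<^bold>1 \<^bold>\<and> Var 0 \<^bold>= pair_tm (Var 1) (Var 2) \<^bold>\<and>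
        Var 0 \<^bold>\<in> 0 \<^bold>\<and> (\<^bold>\<forall>3. Var 3 \<^bold>< Var 2 \<^bold>\<longrightarrow> \<^bold>\<not> pair_tm (Var 1) (Var 3) \<^bold>\<in> 0))"])
      (use A in \<open>auto intro!: bounded_fm.intros simp: S_def\<close>)
  have S': "pr M n s \<in> S \<longleftrightarrow> pr M n s \<in> A \<and> (\<forall>t. t \<prec> s \<longrightarrow> pr M n t \<notin> A)" for n s
    unfolding S_def by auto
  have pairs: "\<exists>f s. x = pr M f s" if "x \<in> S" for x using that unfolding S_def by blast
  have unique: "s = t" if "pr M n s \<in> S" "pr M n t \<in> S" for n s t
    using that unfolding S' using N.less_linear by blast
  have "(\<exists>s. pr M n s \<in> A) \<longleftrightarrow> (\<exists>s. pr M n s \<in> S)" for n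
  proof
    assume "\<exists>s. pr M n s \<in> A"
    then have "{s. pr M n s \<in> A} \<noteq> {}" by blast
    moreover have "{s. pr M n s \<in> A} \<in> Sets M"
      by (rule bounded_setI[where E = "\<lambda>_. A" and e = "\<lambda>_. n" and \<theta> = "pair_tm (Var 1) (Var 0) \<^bold>\<in> 0"])
        (use A in \<open>auto intro!: bounded_fm.intros\<close>)
    ultimately obtain s where "s \<in> {s. pr M n s \<in> A}" "\<And>t. t \<in> {s. pr M n s \<in> A} \<Longrightarrow> s \<preceq> t"
      using least_element by blast
    then show "\<exists>s. pr M n s \<in> S" unfolding S' using N.not_le by blast
  qed (auto simp: S')
  then have eq: "{n. \<exists>s. pr M n s \<in> A} = {n. \<exists>s. pr M n s \<in> S}" by blast
  have "{n. \<exists>s. pr M n s \<in> S} \<in> Sets M"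
  proof (cases "bdd S")
    case True
    then obtain b where "\<forall>i\<in>S. i \<prec> b" using bdd_def by blast
    then have "s \<prec> b" if "pr M n s \<in> S" for n s using that le_pr2 N.le_less_trans by blast
    then have "(\<exists>s. pr M n s \<in> S) \<longleftrightarrow> (\<exists>s. s \<prec> b \<and> pr M n s \<in> S)" for n by blast
    then show ?thesis
      by (intro bounded_setI[where E = "\<lambda>_. S" and e = "\<lambda>_. b" and \<theta> =
          "\<^bold>\<exists>1. Var 1 \<^bold>< Var 2 \<^bold>\<and> pair_tm (Var 0) (Var 1) \<^bold>\<in> 0"])
        (use S in \<open>auto intro!: bounded_fm.intros\<close>)
  next
    case False
    obtain T where T: "T \<in> Sets M" "\<exists>i x. pr M i x \<in> T"
      "\<And>i x. pr M i x \<in> T \<Longrightarrow> x \<in> S \<and> (\<forall>k. \<exists>j y. pr M j y \<in> T \<and> k \<prec> y \<and> pr M x y \<notin> stage_order S)"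
      using H[OF S stage_order_in_Sets[OF S] partial_order_stage_order False
          no_homogeneous_chain[OF S False pairs]] by blast
    show ?thesis
    proof (rule projection_from_true_stages[OF S unique pairs T(1)])
      show "true_stage S x" if x: "pr M i x \<in> T" for i x
        unfolding true_stage_def
      proof (intro conjI ballI notI)
        show "x \<in> S" using T(3) x by blast
        fix k assume k: "k \<in> S" "injures k x"
        obtain j y where y: "pr M j y \<in> T" "k \<prec> y" "pr M x y \<notin> stage_order S" using T(3) x by blast
        then show False using k T(3) x unfolding stage_order_iff lte_def by blast
      qed
      show "\<exists>i x. pr M i x \<in> T \<and> k \<prec> x" for k using T(2,3) by blast
    qed
  qed
  then show "{n. \<exists>s. pr M n s \<in> A} \<in> Sets M" using eq by simp
qed

theorem no_antichain_principle_imp_ACA0: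
  assumes "M \<Turnstile> {no_antichain_principle}"
  shows "M \<Turnstile> ACA0"
proof (intro projection_closed_imp_ACA0 projection_closedI)
  fix S L assume *: "S \<in> Sets M" "L \<in> Sets M" "partial_order S L" "\<not> bdd S"
    "\<And>C. \<not> homogeneous S L C"
  then obtain A where A: "A \<in> Sets M" "antichain S L A" "\<not> bdd A"
    using assms unfolding models_no_antichain_principle by blast
  define T where "T = {w. \<exists>x. x \<prec> w \<oplus> \<one> \<and> w = pr M x x \<and> x \<in> A}"
  have "T \<in> Sets M"
    by (rule bounded_setI[where E = "\<lambda>_. A" and e = "\<lambda>_. \<zero>" and \<theta> =
      "\<^bold>\<exists>1. Var 1 \<^bold>< Var 0 \<^bold>+ \<^bold>1 \<^bold>\<and> Var 0 \<^bold>= pair_tm (Var 1) (Var 1) \<^bold>\<and> Var 1 \<^bold>\<in> 0"])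
      (use A in \<open>auto intro!: bounded_fm.intros simp: T_def\<close>)
  moreover have T: "pr M i x \<in> T \<longleftrightarrow> i = x \<and> x \<in> A" for i x
    unfolding T_def by auto
  moreover have "\<exists>y. y \<in> A \<and> k \<prec> y \<and> pr M x y \<notin> L" if "x \<in> A" for x k
  proof -
    obtain y where y: "y \<in> A" "k \<oplus> x \<prec> y" using A(3) not_bdd by blast
    then have "k \<prec> y" "x \<prec> y" using le_add1 le_add2 N.le_less_trans by blast+
    moreover from this have "\<not> cmp M L x y"
      using y(1) A(2) \<open>x \<in> A\<close> unfolding antichain_def using N.less_irrefl by metis
    ultimately show ?thesis using y(1) unfolding cmp_def by blast
  qed
  moreover have "A \<subseteq> S" "A \<noteq> {}" using A unfolding antichain_def bdd_def by auto
  ultimately show "\<exists>T\<in>Sets M. (\<exists>i x. pr M i x \<in> T) \<and> (\<forall>i x. pr M i x \<in> T \<longrightarrow> x \<in> S \<and>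
      (\<forall>k. \<exists>j y. pr M j y \<in> T \<and> k \<prec> y \<and> pr M x y \<notin> L))"
    by (intro bexI[of _ T]) (auto simp: T)
qed

theorem wpo_principle_imp_ACA0:
  assumes "M \<Turnstile> {wpo_principle}"
  shows "M \<Turnstile> ACA0"
proof (intro projection_closed_imp_ACA0 projection_closedI)
  fix S L assume *: "S \<in> Sets M" "L \<in> Sets M" "partial_order S L" "\<not> bdd S"
    "\<And>C. \<not> homogeneous S L C"
  then have "\<not> well_partial_order S L"
    using assms unfolding models_wpo_principle by blast
  then obtain h where h: "h \<in> Sets M" "h \<subseteq> {pr M m p | m p. p \<in> S}" "\<forall>m. \<exists>!p. pr M m p \<in> h"
    "\<And>m n p q. m \<prec> n \<Longrightarrow> pr M m p \<in> h \<Longrightarrow> pr M n q \<in> h \<Longrightarrow> pr M p q \<notin> L \<and> p \<noteq> q"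
    using *(3) unfolding well_partial_order_def by blast
  have unb: "\<exists>i v. i0 \<preceq> i \<and> pr M i v \<in> h \<and> b \<preceq> v" for i0 b
  proof (rule pigeonhole[OF h(1)])
    show "i = j" if "pr M i v \<in> h" "pr M j v \<in> h" for i j v
      using h(4) that N.less_linear by blast
    show "v = w" if "pr M i v \<in> h" "pr M i w \<in> h" for i v w using h(3) that by blast
    show "\<exists>v. pr M i v \<in> h" for i using h(3) by blast
  qed
  show "\<exists>T\<in>Sets M. (\<exists>i x. pr M i x \<in> T) \<and> (\<forall>i x. pr M i x \<in> T \<longrightarrow> x \<in> S \<and>
      (\<forall>k. \<exists>j y. pr M j y \<in> T \<and> k \<prec> y \<and> pr M x y \<notin> L))"
  proof (intro bexI[OF _ h(1)] conjI allI impI)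
    show "\<exists>i x. pr M i x \<in> h" using h(3) by blast
    show "x \<in> S" if "pr M i x \<in> h" for i x using h(2) that by auto
    show "\<exists>j y. pr M j y \<in> h \<and> k \<prec> y \<and> pr M x y \<notin> L" if x: "pr M i x \<in> h" for i x k
    proof -
      obtain j y where y: "i \<oplus> \<one> \<preceq> j" "pr M j y \<in> h" "k \<oplus> \<one> \<preceq> y" using unb by blast
      then show ?thesis using h(4)[OF _ x y(2)] one_add_lte by blast
    qed
  qed
qed

end

section \<open>Coding, recursion and collection in a model of ACA0\<close>

locale aca0_model = rca0_model +
  assumes aca0: "M \<Turnstile> ACA0"
begin

lemma arith_setI:
  assumes \<phi>: "arithmetical \<phi>" and E: "range E \<subseteq> Sets M"
    and A: "\<And>a. a \<in> A \<longleftrightarrow> sat M (e(0 := a)) E \<phi>"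
  shows "A \<in> Sets M"
proof -
  obtain X where X: "X \<notin> free_set_vars \<phi>" using fresh_var finite_free_set_vars by blast
  have "(\<^bold>\<exists>\<^sub>sX. \<^bold>\<forall>0. Var 0 \<^bold>\<in> X \<^bold>\<longleftrightarrow> \<phi>) \<in> ACA0"
    unfolding ACA0_def arithmetical_comprehension_def using \<phi> X by blast
  then have "sat M e E (\<^bold>\<exists>\<^sub>sX. \<^bold>\<forall>0. Var 0 \<^bold>\<in> X \<^bold>\<longleftrightarrow> \<phi>)"
    using aca0 E unfolding models_def by blast
  then obtain B where B: "B \<in> Sets M" "\<And>a. a \<in> B \<longleftrightarrow> sat M (e(0 := a)) (E(X := B)) \<phi>"
    by auto
  have "sat M f (E(X := B)) \<phi> = sat M f E \<phi>" for f
    using X by (intro sat_set_cong) auto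
  then have "A = B" using A B(2) by auto
  then show ?thesis using B(1) by simp
qed

text \<open>
  The number \<open>a\<close> is the product of the moduli of the elements of \<open>X\<close> below \<open>k\<close>, built up by
  induction.
\<close>

lemma bounded_set_coded:
  assumes X: "X \<in> Sets M"
  shows "\<exists>B a. \<forall>i. i \<prec> k \<longrightarrow> dv (modulus B i) a \<longleftrightarrow> i \<in> X"
proof -
  obtain B where B0: "\<zero> \<prec> B" and B: "\<forall>i. i \<prec> k \<longrightarrow> dv (i \<oplus> \<one>) B" using common_multiple by blast
  define D where "D = {m. \<exists>a. \<forall>i. i \<prec> k \<longrightarrow> ((\<exists>c. modulus B i \<otimes> c = a) \<longleftrightarrow> i \<in> X \<and> i \<prec> m)}"
  have D: "m \<in> D \<longleftrightarrow> (\<exists>a. \<forall>i. i \<prec> k \<longrightarrow> (dv (modulus B i) a \<longleftrightarrow> i \<in> X \<and> i \<prec> m))" for m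
    unfolding D_def dv_def by blast
  have "D \<in> Sets M"
    by (rule arith_setI[where E = "\<lambda>_. X" and e = "(\<lambda>_. \<zero>)(10 := k, 11 := B)" and \<phi> =
      "\<^bold>\<exists>1. \<^bold>\<forall>2. Var 2 \<^bold>< Var 10 \<^bold>\<longrightarrow>
        ((\<^bold>\<exists>3. (\<^bold>1 \<^bold>+ (Var 2 \<^bold>+ \<^bold>1) \<^bold>* Var 11) \<^bold>* Var 3 \<^bold>= Var 1) \<^bold>\<longleftrightarrow> Var 2 \<^bold>\<in> 0 \<^bold>\<and> Var 2 \<^bold>< Var 0)"])
      (use X in \<open>auto simp: D_def modulus_def\<close>)
  moreover have "\<zero> \<in> D"
  proof -
    have "\<not> dv (modulus B i) \<one>" for i
    proof
      assume "dv (modulus B i) \<one>"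
      then obtain c where c: "modulus B i \<otimes> c = \<one>" unfolding dv_def by blast
      then have "\<zero> \<prec> c" using zero_le[of c] unfolding lte_def by auto
      then have "modulus B i \<preceq> \<one>" using le_mult c by metis
      then show False using modulus_gt_one[OF B0] N.not_le by blast
    qed
    then show ?thesis unfolding D by (intro exI[of _ \<one>]) simp
  qed
  moreover have "m \<oplus> \<one> \<in> D" if "m \<in> D" for m
  proof -
    obtain a where a: "\<And>i. i \<prec> k \<Longrightarrow> dv (modulus B i) a \<longleftrightarrow> i \<in> X \<and> i \<prec> m"
      using \<open>m \<in> D\<close> D by blast
    show ?thesis
    proof (cases "m \<prec> k \<and> m \<in> X")
      case True
      have "dv (modulus B i) (a \<otimes> modulus B m) \<longleftrightarrow> i \<in> X \<and> i \<prec> m \<oplus> \<one>" if "i \<prec> k" for i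
      proof (cases "i = m")
        case True
        then show ?thesis using \<open>m \<prec> k \<and> m \<in> X\<close> dv_mult[OF dv_refl, of "modulus B m" a]
          by (simp add: N.mult.commute)
      next
        case False
        have "dv (modulus B i) (a \<otimes> modulus B m) \<longleftrightarrow> dv (modulus B i) a"
          using modulus_coprime[of k B i m a] B that True False dv_mult by blast
        then show ?thesis using a[OF that] False lt_succ lte_def by metis
      qed
      then show ?thesis unfolding D by blast
    next
      case False
      have "i \<in> X \<and> i \<prec> m \<longleftrightarrow> i \<in> X \<and> i \<prec> m \<oplus> \<one>" if "i \<prec> k" for i
        using False that lt_succ lte_def by metis
      then show ?thesis unfolding D using a by blast
    qed
  qed
  ultimately have "k \<in> D" using set_induct by blast
  then show ?thesis unfolding D by blast
qed

text \<open>
  Recursion: starting from \<open>x0\<close>, pass repeatedly to the least larger \<open>R\<close>-successor in \<open>X\<close>.  The set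
  of iterates is the least set that contains \<open>x0\<close> and is closed under this step.  Whether \<open>b\<close> is in
  it depends only on the numbers up to \<open>b\<close>, because the step increases numbers; so it suffices to
  intersect coded finite sets, and the definition becomes arithmetical.
\<close>

lemma iteration:
  assumes X: "X \<in> Sets M" and R: "R \<in> Sets M" and x0: "x0 \<in> X"
    and step: "\<And>x. x \<in> X \<Longrightarrow> \<exists>y\<in>X. x \<prec> y \<and> pr M x y \<in> R"
  obtains B where "B \<in> Sets M" "B \<subseteq> X" "x0 \<in> B"
    "\<And>b. b \<in> B \<Longrightarrow> \<exists>c\<in>B. b \<prec> c \<and> pr M b c \<in> R \<and> (\<forall>d\<in>B. b \<prec> d \<longrightarrow> c \<preceq> d)"
proof -
  define succ where "succ x y \<longleftrightarrow> y \<in> X \<and> x \<prec> y \<and> pr M x y \<in> R \<and>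
    (\<forall>z. z \<in> X \<and> x \<prec> z \<and> pr M x z \<in> R \<longrightarrow> y \<preceq> z)" for x y
  have succ_ex: "\<exists>y. succ x y" if "x \<in> X" for x
  proof -
    define Y where "Y = {y. y \<in> X \<and> x \<prec> y \<and> pr M x y \<in> R}"
    have "Y \<in> Sets M"
      by (rule arith_setI[where E = "(\<lambda>_. X)(1 := R)" and e = "\<lambda>_. x" and \<phi> =
        "Var 0 \<^bold>\<in> 0 \<^bold>\<and> Var 1 \<^bold>< Var 0 \<^bold>\<and> pair_tm (Var 1) (Var 0) \<^bold>\<in> 1"])
        (use X R in \<open>auto simp: Y_def\<close>)
    moreover have "Y \<noteq> {}" using step[OF that] unfolding Y_def by blast
    ultimately obtain y where "y \<in> Y" "\<And>z. z \<in> Y \<Longrightarrow> y \<preceq> z" using least_element by blast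
    then show ?thesis unfolding succ_def Y_def by blast
  qed
  have succ_unique: "y = z" if "succ x y" "succ x z" for x y z
    using that unfolding succ_def using N.order_antisym by blast
  define G where "G = {w. \<exists>x y. w = pr M x y \<and> succ x y}"
  have "G \<in> Sets M"
    by (rule arith_setI[where E = "(\<lambda>_. X)(1 := R)" and e = "\<lambda>_. \<zero>" and \<phi> =
      "\<^bold>\<exists>1. \<^bold>\<exists>2. Var 0 \<^bold>= pair_tm (Var 1) (Var 2) \<^bold>\<and> Var 2 \<^bold>\<in> 0 \<^bold>\<and> Var 1 \<^bold>< Var 2 \<^bold>\<and>
        pair_tm (Var 1) (Var 2) \<^bold>\<in> 1 \<^bold>\<and>
        (\<^bold>\<forall>3. Var 3 \<^bold>\<in> 0 \<^bold>\<and> Var 1 \<^bold>< Var 3 \<^bold>\<and> pair_tm (Var 1) (Var 3) \<^bold>\<in> 1 \<^bold>\<longrightarrow> Var 2 \<^bold>\<le> Var 3)"])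
      (use X R in \<open>auto simp: G_def succ_def lte_def\<close>)
  have G: "pr M x y \<in> G \<longleftrightarrow> succ x y" for x y unfolding G_def by simp
  \<comment> \<open>The pair (m, a) codes the set of those i whose modulus (with respect to m) divides a.\<close>
  define B where "B = {b. \<forall>m a. dv (modulus m x0) a \<and>
    (\<forall>c d. dv (modulus m c) a \<and> pr M c d \<in> G \<and> d \<preceq> b \<longrightarrow> dv (modulus m d) a) \<longrightarrow>
    dv (modulus m b) a}"
  have B: "B \<in> Sets M"
    by (rule arith_setI[where E = "\<lambda>_. G" and e = "\<lambda>_. x0" and \<phi> =
      "\<^bold>\<forall>1. \<^bold>\<forall>2. (\<^bold>\<exists>3. (\<^bold>1 \<^bold>+ (Var 9 \<^bold>+ \<^bold>1) \<^bold>* Var 1) \<^bold>* Var 3 \<^bold>= Var 2) \<^bold>\<and>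
        (\<^bold>\<forall>4. \<^bold>\<forall>5. (\<^bold>\<exists>3. (\<^bold>1 \<^bold>+ (Var 4 \<^bold>+ \<^bold>1) \<^bold>* Var 1) \<^bold>* Var 3 \<^bold>= Var 2) \<^bold>\<and>
          pair_tm (Var 4) (Var 5) \<^bold>\<in> 0 \<^bold>\<and> Var 5 \<^bold>\<le> Var 0 \<^bold>\<longrightarrow>
          (\<^bold>\<exists>3. (\<^bold>1 \<^bold>+ (Var 5 \<^bold>+ \<^bold>1) \<^bold>* Var 1) \<^bold>* Var 3 \<^bold>= Var 2)) \<^bold>\<longrightarrow>
        (\<^bold>\<exists>3. (\<^bold>1 \<^bold>+ (Var 0 \<^bold>+ \<^bold>1) \<^bold>* Var 1) \<^bold>* Var 3 \<^bold>= Var 2)"])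
      (use \<open>G \<in> Sets M\<close> in \<open>simp_all add: B_def dv_def modulus_def lte_def image_subset_iff\<close>)
  have x0B: "x0 \<in> B" unfolding B_def by blast
  have BG: "d \<in> B" if "b \<in> B" "succ b d" for b d
    unfolding B_def
  proof (rule CollectI, intro allI impI, elim conjE)
    fix m a
    assume *: "dv (modulus m x0) a"
      "\<forall>c d'. dv (modulus m c) a \<and> pr M c d' \<in> G \<and> d' \<preceq> d \<longrightarrow> dv (modulus m d') a"
    have "b \<prec> d" using that(2) succ_def by blast
    then have "\<forall>c d'. dv (modulus m c) a \<and> pr M c d' \<in> G \<and> d' \<preceq> b \<longrightarrow> dv (modulus m d') a"
      using *(2) N.order_trans N.less_imp_le by blast
    then have "dv (modulus m b) a" using that(1) *(1) unfolding B_def by blast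
    then show "dv (modulus m d) a" using *(2) that(2) G N.order_refl by blast
  qed
  have induct: "B \<subseteq> Y" if Y: "Y \<in> Sets M" "x0 \<in> Y" "\<And>y d. y \<in> Y \<Longrightarrow> succ y d \<Longrightarrow> d \<in> Y" for Y
  proof
    fix b assume b: "b \<in> B"
    obtain m a where code: "\<And>i. i \<prec> b \<oplus> x0 \<oplus> \<one> \<Longrightarrow> dv (modulus m i) a \<longleftrightarrow> i \<in> Y"
      using bounded_set_coded[OF Y(1)] by blast
    have le: "i \<prec> b \<oplus> x0 \<oplus> \<one>" if "i \<preceq> b" for i
      using that le_add1 N.order_trans by simp
    have "dv (modulus m x0) a" using code Y(2) by simp
    moreover have "dv (modulus m d) a" if "dv (modulus m c) a" "pr M c d \<in> G" "d \<preceq> b" for c d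
    proof -
      have n: "succ c d" using that(2) G by blast
      then have "c \<prec> d" using succ_def by blast
      then have "c \<preceq> b" using that(3) N.less_le_trans N.less_imp_le by blast
      then show ?thesis using code le that n Y(3) by blast
    qed
    ultimately have "dv (modulus m b) a" using b unfolding B_def by blast
    then show "b \<in> Y" using code le by blast
  qed
  have BX: "B \<subseteq> {x. x \<in> X \<and> x0 \<preceq> x}"
  proof (rule induct)
    show "{x. x \<in> X \<and> x0 \<preceq> x} \<in> Sets M"
      by (rule arith_setI[where E = "\<lambda>_. X" and e = "\<lambda>_. x0" and \<phi> = "Var 0 \<^bold>\<in> 0 \<^bold>\<and> Var 1 \<^bold>\<le> Var 0"])
        (use X in \<open>auto simp: lte_def\<close>)
  qed (use x0 succ_def N.le_less_trans N.less_imp_le in blast)+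
  define Y where "Y = {d. d \<in> B \<and> (\<forall>b c. b \<in> B \<and> pr M b c \<in> G \<and> b \<prec> d \<longrightarrow> c \<preceq> d)}"
  have Y_Sets: "Y \<in> Sets M"
    by (rule arith_setI[where E = "(\<lambda>_. G)(1 := B)" and e = "\<lambda>_. \<zero>" and \<phi> =
      "Var 0 \<^bold>\<in> 1 \<^bold>\<and> (\<^bold>\<forall>1. \<^bold>\<forall>2. Var 1 \<^bold>\<in> 1 \<^bold>\<and> pair_tm (Var 1) (Var 2) \<^bold>\<in> 0 \<^bold>\<and> Var 1 \<^bold>< Var 0 \<^bold>\<longrightarrow> Var 2 \<^bold>\<le> Var 0)"])
      (use \<open>G \<in> Sets M\<close> B in \<open>auto simp: Y_def lte_def\<close>)
  \<comment> \<open>No iterate lies strictly between d and its successor.\<close>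
  have gap: "b \<preceq> d \<or> d' \<preceq> b" if d: "d \<in> Y" "succ d d'" and b: "b \<in> B" for d d' b
  proof -
    have "B \<subseteq> {b. b \<in> B \<and> (b \<preceq> d \<or> d' \<preceq> b)}"
    proof (rule induct)
      show "{b. b \<in> B \<and> (b \<preceq> d \<or> d' \<preceq> b)} \<in> Sets M"
        by (rule arith_setI[where E = "\<lambda>_. B" and e = "(\<lambda>_. d)(2 := d')" and
            \<phi> = "Var 0 \<^bold>\<in> 0 \<^bold>\<and> (Var 0 \<^bold>\<le> Var 1 \<^bold>\<or> Var 2 \<^bold>\<le> Var 0)"])
          (use B in \<open>auto simp: lte_def\<close>)
      show "x0 \<in> {b. b \<in> B \<and> (b \<preceq> d \<or> d' \<preceq> b)}"
        using x0B BX d(1) unfolding Y_def by blast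
      fix y z assume y: "y \<in> {b. b \<in> B \<and> (b \<preceq> d \<or> d' \<preceq> b)}" and n: "succ y z"
      then have yB: "y \<in> B" by blast
      have yz: "y \<prec> z" using n succ_def by blast
      consider "y \<prec> d" | "y = d" | "d' \<preceq> y" using y lte_def by blast
      then have "z \<preceq> d \<or> d' \<preceq> z"
      proof cases
        case 1
        then show ?thesis using d(1) yB n G unfolding Y_def by blast
      next
        case 2
        then show ?thesis using succ_unique n d(2) N.order_refl by blast
      next
        case 3
        then show ?thesis using yz N.order_trans N.less_imp_le by blast
      qed
      then show "z \<in> {b. b \<in> B \<and> (b \<preceq> d \<or> d' \<preceq> b)}" using BG[OF yB n] by blast
    qed
    then show ?thesis using b by blast
  qed
  have "B \<subseteq> Y"
  proof (rule induct[OF Y_Sets])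
    show "x0 \<in> Y" unfolding Y_def using x0B BX N.not_le by blast
    fix d d' assume d: "d \<in> Y" "succ d d'"
    have "c \<preceq> d'" if "b \<in> B" "pr M b c \<in> G" "b \<prec> d'" for b c
    proof -
      have "b \<preceq> d" using gap[OF d that(1)] that(3) N.not_le by blast
      then consider "b \<prec> d" | "b = d" unfolding lte_def by blast
      then show ?thesis
      proof cases
        case 1
        then have "c \<preceq> d" using d(1) that(1,2) unfolding Y_def by blast
        moreover have "d \<prec> d'" using d(2) unfolding succ_def by blast
        ultimately show ?thesis using N.order_trans N.less_imp_le by blast
      next
        case 2
        then show ?thesis using that(2) d(2) G succ_unique N.order_refl by blast
      qed
    qed
    then show "d' \<in> Y" unfolding Y_def using BG d Y_def by blast
  qed
  have "\<exists>c\<in>B. b \<prec> c \<and> pr M b c \<in> R \<and> (\<forall>d\<in>B. b \<prec> d \<longrightarrow> c \<preceq> d)" if b: "b \<in> B" for b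
  proof -
    obtain c where c: "succ b c" using succ_ex BX b by blast
    have "c \<preceq> d" if "d \<in> B" "b \<prec> d" for d
    proof -
      have "b \<in> Y" using \<open>B \<subseteq> Y\<close> b by blast
      from gap[OF this c that(1)] show ?thesis using that(2) N.not_le by blast
    qed
    moreover have "b \<prec> c" "pr M b c \<in> R" using c unfolding succ_def by blast+
    ultimately show ?thesis using BG[OF b c] by blast
  qed
  moreover have "B \<subseteq> X" using BX by blast
  ultimately show ?thesis using that[OF B _ x0B] by simp
qed

lemma iteration_unbounded:
  assumes "B \<in> Sets M" "x \<in> B" "\<And>b. b \<in> B \<Longrightarrow> \<exists>c\<in>B. b \<prec> c"
  shows "\<not> bdd B"
proof
  assume "bdd B"
  then obtain m where "m \<in> B" "\<And>x. x \<in> B \<Longrightarrow> x \<preceq> m"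
    using greatest_element[OF assms(1)] assms(2) by blast
  then show False using assms(3) N.not_le by blast
qed

text \<open>
  If the claim fails for \<open>b\<close>, let \<open>m\<close> be the least later element for which it fails and compare \<open>m\<close>
  with its immediate predecessor \<open>d\<close>.
\<close>

lemma iteration_transitive:
  assumes B: "B \<in> Sets M" and T: "T \<in> Sets M"
    and succ: "\<And>b. b \<in> B \<Longrightarrow> \<exists>c\<in>B. b \<prec> c \<and> pr M b c \<in> T \<and> (\<forall>d\<in>B. b \<prec> d \<longrightarrow> c \<preceq> d)"
    and trans: "\<And>a b c. pr M a b \<in> T \<Longrightarrow> pr M b c \<in> T \<Longrightarrow> pr M a c \<in> T"
    and bc: "b \<in> B" "c \<in> B" "b \<prec> c"
  shows "pr M b c \<in> T"
proof (rule ccontr)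
  assume no: "pr M b c \<notin> T"
  define Y where "Y = {c. c \<in> B \<and> b \<prec> c \<and> pr M b c \<notin> T}"
  have "Y \<in> Sets M"
    by (rule arith_setI[where E = "(\<lambda>_. B)(1 := T)" and e = "\<lambda>_. b" and \<phi> =
      "Var 0 \<^bold>\<in> 0 \<^bold>\<and> Var 1 \<^bold>< Var 0 \<^bold>\<and> \<^bold>\<not> pair_tm (Var 1) (Var 0) \<^bold>\<in> 1"])
      (use B T in \<open>auto simp: Y_def\<close>)
  moreover have "Y \<noteq> {}" using no bc Y_def by blast
  ultimately obtain m where m: "m \<in> Y" "\<And>x. x \<in> Y \<Longrightarrow> m \<preceq> x" using least_element by blast
  define Z where "Z = {d. d \<in> B \<and> d \<prec> m}"
  have "Z \<in> Sets M"
    by (rule arith_setI[where E = "\<lambda>_. B" and e = "\<lambda>_. m" and \<phi> = "Var 0 \<^bold>\<in> 0 \<^bold>\<and> Var 0 \<^bold>< Var 1"])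
      (use B in \<open>auto simp: Z_def\<close>)
  moreover have bZ: "b \<in> Z" using m(1) bc(1) unfolding Z_def Y_def by blast
  moreover have "bdd Z" unfolding bdd_def Z_def by blast
  ultimately obtain d where d: "d \<in> Z" "\<And>x. x \<in> Z \<Longrightarrow> x \<preceq> d" using greatest_element by blast
  obtain e where e: "e \<in> B" "d \<prec> e" "pr M d e \<in> T" "\<forall>x\<in>B. d \<prec> x \<longrightarrow> e \<preceq> x"
    using succ d(1) unfolding Z_def by blast
  have "e \<preceq> m" using e(4) d(1) m(1) unfolding Z_def Y_def by blast
  moreover have "\<not> e \<prec> m" using d(2) e(1,2) N.not_le unfolding Z_def by blast
  ultimately have "e = m" unfolding lte_def by blast
  have "b \<preceq> d" using d(2) bZ by blast
  then have "b = d \<or> pr M b d \<in> T"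
    using m(2) d(1) N.not_le unfolding Y_def Z_def lte_def by blast
  then have "pr M b m \<in> T" using e(3) \<open>e = m\<close> trans by blast
  then show False using m(1) Y_def by blast
qed

lemma collection:
  assumes B: "B \<in> Sets M" "bdd B" and S: "S \<in> Sets M" and ex: "\<And>b. b \<in> B \<Longrightarrow> \<exists>y. pr M b y \<in> S"
  shows "\<exists>u. \<forall>b\<in>B. \<exists>y. y \<prec> u \<and> pr M b y \<in> S"
proof -
  define D where "D = {k. \<exists>u. \<forall>b. b \<in> B \<and> b \<prec> k \<longrightarrow> (\<exists>y. y \<prec> u \<and> pr M b y \<in> S)}"
  have "D \<in> Sets M"
    by (rule arith_setI[where E = "(\<lambda>_. B)(1 := S)" and e = "\<lambda>_. \<zero>" and \<phi> =
      "\<^bold>\<exists>1. \<^bold>\<forall>2. Var 2 \<^bold>\<in> 0 \<^bold>\<and> Var 2 \<^bold>< Var 0 \<^bold>\<longrightarrow> (\<^bold>\<exists>3. Var 3 \<^bold>< Var 1 \<^bold>\<and> pair_tm (Var 2) (Var 3) \<^bold>\<in> 1)"])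
      (use B S in \<open>auto simp: D_def\<close>)
  moreover have "\<zero> \<in> D" by (simp add: D_def)
  moreover have "k \<oplus> \<one> \<in> D" if "k \<in> D" for k
  proof -
    obtain u where u: "\<And>b. b \<in> B \<Longrightarrow> b \<prec> k \<Longrightarrow> \<exists>y. y \<prec> u \<and> pr M b y \<in> S"
      using \<open>k \<in> D\<close> unfolding D_def by auto
    have "\<exists>v. k \<in> B \<longrightarrow> pr M k v \<in> S" using ex[of k] by (cases "k \<in> B") simp_all
    then obtain v where v: "k \<in> B \<longrightarrow> pr M k v \<in> S" ..
    have *: "\<exists>y. y \<prec> u \<oplus> v \<oplus> \<one> \<and> pr M b y \<in> S" if b: "b \<in> B" "b \<preceq> k" for b
    proof (cases "b = k")
      case True
      then show ?thesis using v b by (intro exI[of _ v]) simp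
    next
      case False
      then obtain y where "y \<prec> u" "pr M b y \<in> S" using u b lte_def by blast
      moreover from this have "y \<preceq> u \<oplus> v" using le_add1 N.less_le_trans N.less_imp_le by blast
      ultimately show ?thesis by auto
    qed
    have "\<forall>b. b \<in> B \<and> b \<prec> k \<oplus> \<one> \<longrightarrow> (\<exists>y. y \<prec> u \<oplus> v \<oplus> \<one> \<and> pr M b y \<in> S)"
      using * lt_succ[of _ k] by simp
    then show ?thesis unfolding D_def by blast
  qed
  ultimately have D: "k \<in> D" for k using set_induct by blast
  obtain k where k: "\<forall>b\<in>B. b \<prec> k" using B(2) unfolding bdd_def ..
  obtain u where "\<forall>b. b \<in> B \<and> b \<prec> k \<longrightarrow> (\<exists>y. y \<prec> u \<and> pr M b y \<in> S)"
    using D[of k] unfolding D_def by blast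
  then have "\<forall>b\<in>B. \<exists>y. y \<prec> u \<and> pr M b y \<in> S" using k by simp
  then show ?thesis ..
qed

lemma bdd_family:
  assumes B: "B \<in> Sets M" "bdd B" and R: "R \<in> Sets M" and fin: "\<And>b. b \<in> B \<Longrightarrow> bdd {z. pr M b z \<in> R}"
  shows "bdd {z. \<exists>b\<in>B. pr M b z \<in> R}"
proof -
  define S where "S = {w. \<exists>b u. w = pr M b u \<and> (\<forall>z. pr M b z \<in> R \<longrightarrow> z \<prec> u)}"
  have "S \<in> Sets M"
    by (rule arith_setI[where E = "\<lambda>_. R" and e = "\<lambda>_. \<zero>" and \<phi> =
      "\<^bold>\<exists>1. \<^bold>\<exists>2. Var 0 \<^bold>= pair_tm (Var 1) (Var 2) \<^bold>\<and> (\<^bold>\<forall>3. pair_tm (Var 1) (Var 3) \<^bold>\<in> 0 \<^bold>\<longrightarrow> Var 3 \<^bold>< Var 2)"])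
      (use R in \<open>auto simp: S_def\<close>)
  moreover have "\<exists>u. pr M b u \<in> S" if "b \<in> B" for b
    using fin[OF that] unfolding bdd_def S_def by auto
  ultimately obtain u where u: "\<And>b. b \<in> B \<Longrightarrow> \<exists>y. y \<prec> u \<and> pr M b y \<in> S" using collection[OF B] by blast
  have "z \<prec> u" if b: "b \<in> B" "pr M b z \<in> R" for b z
  proof -
    obtain y where "y \<prec> u" "pr M b y \<in> S" using u b by blast
    then show ?thesis using b(2) N.less_trans unfolding S_def by auto
  qed
  then show ?thesis unfolding bdd_def by blast
qed

end

section \<open>Partial orders without infinite antichains\<close>

text \<open>
  \<open>fac\<close> abbreviates the finite antichain condition.  The order is kept as a locale parameter so that
  every result can be applied to the dual order as well.
\<close>

locale fac_order = aca0_model +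
  fixes P L :: "'a set"
  assumes P: "P \<in> Sets M" and L: "L \<in> Sets M"
    and po: "partial_order P L"
    and fac: "\<And>A. A \<in> Sets M \<Longrightarrow> antichain P L A \<Longrightarrow> bdd A"
begin

definition below :: "'a \<Rightarrow> 'a \<Rightarrow> bool" (infix "\<sqsubset>" 50) where "x \<sqsubset> y \<longleftrightarrow> pr M x y \<in> L"
definition below_eq :: "'a \<Rightarrow> 'a \<Rightarrow> bool" (infix "\<sqsubseteq>" 50) where "x \<sqsubseteq> y \<longleftrightarrow> pr M x y \<in> L \<or> x = y"

lemma below_carrier:
  assumes "x \<sqsubset> y"
  shows "x \<in> P" "y \<in> P"
proof -
  have "pr M x y \<in> {pr M p q | p q. p \<in> P \<and> q \<in> P}"
    using po assms unfolding partial_order_def below_def by blast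
  then show "x \<in> P" "y \<in> P" by simp_all
qed

lemma below_irrefl: "\<not> x \<sqsubset> x"
  using po below_carrier(1)[of x x] unfolding partial_order_def below_def by metis

lemma below_trans:
  assumes "x \<sqsubset> y" "y \<sqsubset> z"
  shows "x \<sqsubset> z"
proof -
  have "x \<in> P" "y \<in> P" "z \<in> P" using below_carrier assms by blast+
  moreover have "\<forall>p\<in>P. \<forall>q\<in>P. \<forall>r\<in>P. pr M p q \<in> L \<and> pr M q r \<in> L \<longrightarrow> pr M p r \<in> L"
    using po unfolding partial_order_def by (elim conjE)
  ultimately show ?thesis using assms unfolding below_def by blast
qed

lemma below_eq_iff: "x \<sqsubseteq> y \<longleftrightarrow> x \<sqsubset> y \<or> x = y"
  unfolding below_eq_def below_def by simp

lemma below_eq_refl [simp]: "x \<sqsubseteq> x"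
  by (simp add: below_eq_iff)

lemma below_eq_trans: "x \<sqsubseteq> y \<Longrightarrow> y \<sqsubseteq> z \<Longrightarrow> x \<sqsubseteq> z"
  unfolding below_eq_iff using below_trans by blast

lemma below_eq_below: "x \<sqsubseteq> y \<Longrightarrow> y \<sqsubset> z \<Longrightarrow> x \<sqsubset> z"
  unfolding below_eq_iff using below_trans by blast

lemma cmp_iff: "cmp M L x y \<longleftrightarrow> x \<sqsubseteq> y \<or> y \<sqsubseteq> x"
  unfolding cmp_def below_eq_def by blast

text \<open>
  An ascending sequence is represented by its range, enumerated in the numerical order.
\<close>

definition ascending :: "'a set \<Rightarrow> bool" where
  "ascending A \<longleftrightarrow> A \<in> Sets M \<and> A \<subseteq> P \<and> \<not> bdd A \<and> (\<forall>a\<in>A. \<forall>b\<in>A. a \<prec> b \<longrightarrow> a \<sqsubset> b)"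

text \<open>
  By induction on \<open>k\<close> there is \<open>m \<ge> x\<close> in \<open>X\<close> with no element of \<open>X\<close> that is numerically less than
  \<open>k\<close> above it: when \<open>k\<close> itself lies above \<open>m\<close>, replace \<open>m\<close> by \<open>k\<close>.
\<close>

lemma unbounded_above:
  assumes X: "X \<in> Sets M" "x \<in> X" and step: "\<And>y. y \<in> X \<Longrightarrow> x \<sqsubseteq> y \<Longrightarrow> \<exists>z\<in>X. y \<sqsubset> z"
  shows "\<exists>y\<in>X. x \<sqsubset> y \<and> k \<prec> y"
proof -
  define D where "D = {k. \<exists>m. m \<in> X \<and> x \<sqsubseteq> m \<and> (\<forall>y. y \<in> X \<and> y \<prec> k \<longrightarrow> \<not> m \<sqsubset> y)}"
  have "D \<in> Sets M"
    by (rule arith_setI[where E = "(\<lambda>_. X)(1 := L)" and e = "(\<lambda>_. \<zero>)(10 := x)" and \<phi> =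
      "\<^bold>\<exists>1. Var 1 \<^bold>\<in> 0 \<^bold>\<and> leq_fm 1 (Var 10) (Var 1) \<^bold>\<and>
        (\<^bold>\<forall>2. Var 2 \<^bold>\<in> 0 \<^bold>\<and> Var 2 \<^bold>< Var 0 \<^bold>\<longrightarrow> \<^bold>\<not> pair_tm (Var 1) (Var 2) \<^bold>\<in> 1)"])
      (use X L in \<open>auto simp: leq_fm_def D_def below_def below_eq_def\<close>)
  moreover have "\<zero> \<in> D" unfolding D_def using X(2) by auto
  moreover have "n \<oplus> \<one> \<in> D" if "n \<in> D" for n
  proof -
    obtain m where m: "m \<in> X" "x \<sqsubseteq> m" "\<And>y. y \<in> X \<Longrightarrow> y \<prec> n \<Longrightarrow> \<not> m \<sqsubset> y"
      using \<open>n \<in> D\<close> unfolding D_def by blast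
    show ?thesis
    proof (cases "n \<in> X \<and> m \<sqsubset> n")
      case True
      have "\<not> n \<sqsubset> y" if "y \<in> X" "y \<preceq> n" for y
        using that True m(3) below_trans below_irrefl unfolding lte_def by blast
      moreover have "x \<sqsubseteq> n" using True m(2) below_eq_iff below_eq_trans by blast
      ultimately have "n \<in> X \<and> x \<sqsubseteq> n \<and> (\<forall>y. y \<in> X \<and> y \<prec> n \<oplus> \<one> \<longrightarrow> \<not> n \<sqsubset> y)"
        using True by simp
      then show ?thesis unfolding D_def by blast
    next
      case False
      have "\<not> m \<sqsubset> y" if "y \<in> X" "y \<preceq> n" for y
        using that False m(3) unfolding lte_def by blast
      then have "m \<in> X \<and> x \<sqsubseteq> m \<and> (\<forall>y. y \<in> X \<and> y \<prec> n \<oplus> \<one> \<longrightarrow> \<not> m \<sqsubset> y)"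
        using m(1,2) by simp
      then show ?thesis unfolding D_def by blast
    qed
  qed
  ultimately have "k \<oplus> \<one> \<in> D" using set_induct by blast
  then obtain m where m: "m \<in> X" "x \<sqsubseteq> m" "\<And>y. y \<in> X \<Longrightarrow> y \<prec> k \<oplus> \<one> \<Longrightarrow> \<not> m \<sqsubset> y"
    unfolding D_def by blast
  obtain y where y: "y \<in> X" "m \<sqsubset> y" using step m(1,2) by blast
  then have "\<not> y \<preceq> k" using m(3)[of y] lt_succ by blast
  then show ?thesis using y m(2) below_eq_below N.not_le by blast
qed

lemma ascending_from:
  assumes X: "X \<in> Sets M" "X \<subseteq> P" "x \<in> X"
    and step: "\<And>y. y \<in> X \<Longrightarrow> x \<sqsubseteq> y \<Longrightarrow> \<exists>z\<in>X. y \<sqsubset> z"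
  obtains A where "ascending A" "A \<subseteq> X" "\<And>a. a \<in> A \<Longrightarrow> x \<sqsubseteq> a"
proof -
  define X' where "X' = {y. y \<in> X \<and> x \<sqsubseteq> y}"
  have X': "X' \<in> Sets M"
    by (rule arith_setI[where E = "(\<lambda>_. X)(1 := L)" and e = "\<lambda>_. x" and \<phi> =
      "Var 0 \<^bold>\<in> 0 \<^bold>\<and> leq_fm 1 (Var 1) (Var 0)"])
      (use X L in \<open>auto simp: leq_fm_def X'_def below_eq_def\<close>)
  have "\<exists>z\<in>X'. y \<prec> z \<and> pr M y z \<in> L" if y: "y \<in> X'" for y
  proof -
    have "\<exists>z\<in>X. y \<sqsubset> z \<and> y \<prec> z"
      using unbounded_above[OF X(1), of y] y step below_eq_trans unfolding X'_def by blast
    then show ?thesis using y below_eq_trans unfolding X'_def below_def below_eq_iff by blast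
  qed
  moreover have "x \<in> X'" using X(3) unfolding X'_def by simp
  ultimately obtain B where B: "B \<in> Sets M" "B \<subseteq> X'" "x \<in> B"
    "\<And>b. b \<in> B \<Longrightarrow> \<exists>c\<in>B. b \<prec> c \<and> pr M b c \<in> L \<and> (\<forall>d\<in>B. b \<prec> d \<longrightarrow> c \<preceq> d)"
    using iteration[OF X' L] by metis
  have "pr M b c \<in> L" if "b \<in> B" "c \<in> B" "b \<prec> c" for b c
    using iteration_transitive[OF B(1) L B(4) _ that] below_trans unfolding below_def by blast
  moreover have "\<not> bdd B" using iteration_unbounded[OF B(1,3)] B(4) by blast
  ultimately have "ascending B"
    unfolding ascending_def below_def using B(1,2) X(2) unfolding X'_def by blast
  then show ?thesis using that B(2) unfolding X'_def by blast
qed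

lemma maximal_above:
  assumes X: "X \<in> Sets M" "X \<subseteq> P" "x \<in> X" and no: "\<And>A. ascending A \<Longrightarrow> \<not> A \<subseteq> X"
  shows "\<exists>m\<in>X. x \<sqsubseteq> m \<and> (\<forall>y\<in>X. \<not> m \<sqsubset> y)"
  using ascending_from[OF X] no by metis

lemma maximal_elements:
  assumes X: "X \<in> Sets M" "X \<subseteq> P"
  shows "{m. m \<in> X \<and> (\<forall>y\<in>X. \<not> m \<sqsubset> y)} \<in> Sets M" (is "?m \<in> _")
    and "bdd {m. m \<in> X \<and> (\<forall>y\<in>X. \<not> m \<sqsubset> y)}"
proof -
  show m: "?m \<in> Sets M"
    by (rule arith_setI[where E = "(\<lambda>_. X)(1 := L)" and e = "\<lambda>_. \<zero>" and \<phi> =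
      "Var 0 \<^bold>\<in> 0 \<^bold>\<and> (\<^bold>\<forall>1. Var 1 \<^bold>\<in> 0 \<^bold>\<longrightarrow> \<^bold>\<not> pair_tm (Var 0) (Var 1) \<^bold>\<in> 1)"])
      (use X L in \<open>auto simp: below_def\<close>)
  have "antichain P L ?m"
    using X(2) unfolding antichain_def cmp_iff below_eq_iff by blast
  then show "bdd ?m" using fac m by blast
qed

lemma bdd_if_covered:
  assumes Y: "Y \<in> Sets M" and B: "B \<in> Sets M" "bdd B"
    and fin: "\<And>b. b \<in> B \<Longrightarrow> bdd {z. z \<in> Y \<and> z \<sqsubseteq> b}" and cover: "\<And>y. y \<in> Y \<Longrightarrow> \<exists>b\<in>B. y \<sqsubseteq> b"
  shows "bdd Y"
proof -
  define R where "R = {w. \<exists>b z. w = pr M b z \<and> z \<in> Y \<and> z \<sqsubseteq> b}"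
  have R: "R \<in> Sets M"
    by (rule arith_setI[where E = "(\<lambda>_. Y)(1 := L)" and e = "\<lambda>_. \<zero>" and \<phi> =
      "\<^bold>\<exists>1. \<^bold>\<exists>2. Var 0 \<^bold>= pair_tm (Var 1) (Var 2) \<^bold>\<and> Var 2 \<^bold>\<in> 0 \<^bold>\<and> leq_fm 1 (Var 2) (Var 1)"])
      (use Y L in \<open>auto simp: leq_fm_def R_def below_eq_def\<close>)
  have R_iff: "pr M b z \<in> R \<longleftrightarrow> z \<in> Y \<and> z \<sqsubseteq> b" for b z unfolding R_def by simp
  have "bdd {z. \<exists>b\<in>B. z \<in> Y \<and> z \<sqsubseteq> b}"
    using bdd_family[OF B R] fin unfolding R_iff by blast
  then show ?thesis by (rule bdd_subset) (use cover in blast)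
qed

text \<open>
  Otherwise \<open>Y\<close> would be covered by the lower cones of its maximal elements, a finite antichain.
\<close>

lemma no_maximal_above_of_finite_lower_cones:
  assumes Y: "Y \<in> Sets M" "Y \<subseteq> P" "\<not> bdd Y" and fin: "\<And>y. y \<in> Y \<Longrightarrow> bdd {z. z \<in> Y \<and> z \<sqsubseteq> y}"
  shows "\<exists>q\<in>Y. \<forall>y\<in>Y. q \<sqsubseteq> y \<longrightarrow> (\<exists>z\<in>Y. y \<sqsubset> z)"
proof (rule ccontr)
  assume "\<not> ?thesis"
  then have "\<exists>b\<in>{m. m \<in> Y \<and> (\<forall>z\<in>Y. \<not> m \<sqsubset> z)}. y \<sqsubseteq> b" if "y \<in> Y" for y using that by blast
  moreover have "bdd {z. z \<in> Y \<and> z \<sqsubseteq> b}" if "b \<in> {m. m \<in> Y \<and> (\<forall>z\<in>Y. \<not> m \<sqsubset> z)}" for b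
    using fin that by blast
  ultimately have "bdd Y" using bdd_if_covered[OF Y(1) maximal_elements[OF Y(1,2)]] by blast
  then show False using Y(3) by blast
qed

text \<open>
  If no upper cone of \<open>V\<close> is directed, then above every \<open>b\<close> there are incompatible \<open>a'\<close> and \<open>b'\<close>.
  Continuing above \<open>b'\<close> and collecting the elements \<open>a'\<close> yields an infinite antichain: all later
  choices lie above \<open>b'\<close> and are thus incompatible with \<open>a'\<close>.
\<close>

lemma directed_cone:
  assumes V: "V \<in> Sets M" "V \<subseteq> P" "V \<noteq> {}" and nomax: "\<And>y. y \<in> V \<Longrightarrow> \<exists>z\<in>V. y \<sqsubset> z"
  shows "\<exists>v\<in>V. \<forall>a\<in>V. \<forall>b\<in>V. v \<sqsubseteq> a \<longrightarrow> v \<sqsubseteq> b \<longrightarrow> (\<exists>c\<in>V. a \<sqsubseteq> c \<and> b \<sqsubseteq> c)"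
proof (rule ccontr)
  assume "\<not> ?thesis"
  then have split: "\<exists>a b. a \<in> V \<and> b \<in> V \<and> v \<sqsubseteq> a \<and> v \<sqsubseteq> b \<and> \<not> (\<exists>c\<in>V. a \<sqsubseteq> c \<and> b \<sqsubseteq> c)"
    if "v \<in> V" for v using that by blast
  define X where "X = {w. \<exists>a b. w = pr M a b \<and> a \<in> V \<and> b \<in> V \<and> \<not> (\<exists>c. c \<in> V \<and> a \<sqsubseteq> c \<and> b \<sqsubseteq> c)}"
  have X: "X \<in> Sets M"
    by (rule arith_setI[where E = "(\<lambda>_. V)(1 := L)" and e = "\<lambda>_. \<zero>" and \<phi> =
      "\<^bold>\<exists>1. \<^bold>\<exists>2. Var 0 \<^bold>= pair_tm (Var 1) (Var 2) \<^bold>\<and> Var 1 \<^bold>\<in> 0 \<^bold>\<and> Var 2 \<^bold>\<in> 0 \<^bold>\<and>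
        \<^bold>\<not> (\<^bold>\<exists>3. Var 3 \<^bold>\<in> 0 \<^bold>\<and> leq_fm 1 (Var 1) (Var 3) \<^bold>\<and> leq_fm 1 (Var 2) (Var 3))"])
      (use V L in \<open>auto simp: leq_fm_def X_def below_eq_def\<close>)
  \<comment> \<open>The code of the old pair is below a' so that the collected elements a' are unbounded.\<close>
  define R where "R = {w. \<exists>a b a' b'. w = pr M (pr M a b) (pr M a' b') \<and> b \<sqsubseteq> a' \<and> b \<sqsubseteq> b' \<and> pr M a b \<prec> a'}"
  have R: "R \<in> Sets M"
    by (rule arith_setI[where E = "\<lambda>_. L" and e = "\<lambda>_. \<zero>" and \<phi> =
      "\<^bold>\<exists>1. \<^bold>\<exists>2. \<^bold>\<exists>3. \<^bold>\<exists>4. Var 0 \<^bold>= pair_tm (pair_tm (Var 1) (Var 2)) (pair_tm (Var 3) (Var 4)) \<^bold>\<and>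
        leq_fm 0 (Var 2) (Var 3) \<^bold>\<and> leq_fm 0 (Var 2) (Var 4) \<^bold>\<and> pair_tm (Var 1) (Var 2) \<^bold>< Var 3"])
      (use L in \<open>auto simp: leq_fm_def R_def below_eq_def\<close>)
  have RR: "pr M (pr M a b) (pr M a' b') \<in> R \<longleftrightarrow> b \<sqsubseteq> a' \<and> b \<sqsubseteq> b' \<and> pr M a b \<prec> a'" for a b a' b'
    unfolding R_def by auto
  have XX: "pr M a b \<in> X \<longleftrightarrow> a \<in> V \<and> b \<in> V \<and> \<not> (\<exists>c\<in>V. a \<sqsubseteq> c \<and> b \<sqsubseteq> c)" for a b
    unfolding X_def by auto
  have pairs: "\<exists>a b. x = pr M a b" if "x \<in> X" for x using that unfolding X_def by blast
  obtain x0 where "x0 \<in> X" using split V(3) XX by blast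
  moreover have "\<exists>y\<in>X. x \<prec> y \<and> pr M x y \<in> R" if x: "x \<in> X" for x
  proof -
    obtain a b where ab: "x = pr M a b" "b \<in> V" using x unfolding X_def by blast
    obtain c d where cd: "c \<in> V" "d \<in> V" "b \<sqsubseteq> c" "b \<sqsubseteq> d" "\<not> (\<exists>e\<in>V. c \<sqsubseteq> e \<and> d \<sqsubseteq> e)"
      using split ab(2) by blast
    obtain c' where c': "c' \<in> V" "c \<sqsubset> c'" "x \<prec> c'"
      using unbounded_above[OF V(1) cd(1)] nomax by blast
    have "c \<sqsubseteq> c'" using c'(2) below_eq_iff by blast
    then have "pr M c' d \<in> X" using XX c'(1) cd(2,5) below_eq_trans by blast
    moreover have "x \<prec> pr M c' d" using c'(3) le_pr1 N.less_le_trans by blast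
    moreover have "pr M x (pr M c' d) \<in> R"
      unfolding ab(1) RR using \<open>c \<sqsubseteq> c'\<close> cd(3,4) below_eq_trans c'(3) ab(1) by blast
    ultimately show ?thesis by blast
  qed
  ultimately obtain B where B: "B \<in> Sets M" "B \<subseteq> X" "x0 \<in> B"
    "\<And>b. b \<in> B \<Longrightarrow> \<exists>c\<in>B. b \<prec> c \<and> pr M b c \<in> R \<and> (\<forall>d\<in>B. b \<prec> d \<longrightarrow> c \<preceq> d)"
    using iteration[OF X R] by metis
  have trans: "pr M x z \<in> R" if xyz: "pr M x y \<in> R" "pr M y z \<in> R" for x y z
  proof -
    obtain a b c d where 1: "x = pr M a b" "y = pr M c d" "b \<sqsubseteq> d" "pr M a b \<prec> c"
      using xyz(1) unfolding R_def mem_Collect_eq pr_inj by blast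
    obtain e f where 2: "z = pr M e f" "d \<sqsubseteq> e" "d \<sqsubseteq> f" "pr M c d \<prec> e"
      using xyz(2) unfolding 1(2) R_def mem_Collect_eq pr_inj by blast
    have "pr M a b \<prec> e" using 1(4) 2(4) le_pr1 N.less_le_trans N.less_trans by blast
    then show ?thesis unfolding 1 2 RR using 1 2 below_eq_trans by blast
  qed
  have chain: "pr M b c \<in> R" if "b \<in> B" "c \<in> B" "b \<prec> c" for b c
  proof (rule iteration_transitive[OF B(1) R])
    show "\<exists>c\<in>B. b \<prec> c \<and> pr M b c \<in> R \<and> (\<forall>d\<in>B. b \<prec> d \<longrightarrow> c \<preceq> d)" if "b \<in> B" for b
      using B(4) that by blast
  qed (use trans that in blast)+
  have unb: "\<not> bdd B" using iteration_unbounded[OF B(1,3)] B(4) by blast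
  define A where "A = {a. \<exists>b. pr M a b \<in> B}"
  have "A \<in> Sets M"
    by (rule arith_setI[where E = "\<lambda>_. B" and e = "\<lambda>_. \<zero>" and \<phi> = "\<^bold>\<exists>1. pair_tm (Var 0) (Var 1) \<^bold>\<in> 0"])
      (use B in \<open>auto simp: A_def\<close>)
  moreover have AV: "A \<subseteq> V" using B(2) XX unfolding A_def by blast
  have incomparable: "\<not> a \<sqsubseteq> a' \<and> \<not> a' \<sqsubseteq> a" if "pr M a b \<in> B" "pr M a' b' \<in> B" "pr M a b \<prec> pr M a' b'" for a b a' b'
  proof -
    have "b \<sqsubseteq> a'" using chain[OF that] RR by blast
    moreover have "a \<in> V" "a' \<in> V" "\<not> (\<exists>c\<in>V. a \<sqsubseteq> c \<and> b \<sqsubseteq> c)"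
      using that(1,2) B(2) XX by blast+
    ultimately show ?thesis using below_eq_trans below_eq_refl by blast
  qed
  have "antichain P L A"
    unfolding antichain_def cmp_iff
  proof (intro conjI ballI impI)
    show "A \<subseteq> P" using AV V(2) by blast
    fix p q assume pq: "p \<in> A" "q \<in> A" "p \<noteq> q"
    then obtain b c where "pr M p b \<in> B" "pr M q c \<in> B" unfolding A_def by blast
    moreover have "pr M p b \<prec> pr M q c \<or> pr M q c \<prec> pr M p b"
      using pq(3) N.less_linear pr_inj by metis
    ultimately show "\<not> (p \<sqsubseteq> q \<or> q \<sqsubseteq> p)" using incomparable by blast
  qed
  moreover have "\<not> bdd A"
    unfolding not_bdd
  proof
    fix k
    obtain x where x: "x \<in> B" "k \<prec> x" using unb not_bdd by blast
    obtain y where y: "y \<in> B" "pr M x y \<in> R" using B(4) x(1) by blast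
    then obtain a b where "y = pr M a b" "x \<prec> a" unfolding R_def by auto
    then show "\<exists>i\<in>A. k \<prec> i" using y(1) x(2) N.less_trans unfolding A_def by blast
  qed
  ultimately show False using fac by blast
qed

text \<open>
  Let \<open>C\<close> be an ascending sequence that is cofinal in a directed upper cone \<open>I\<close> of \<open>V\<close>.  An element
  that is below some \<open>c \<in> C\<close> is below all later ones, so only elements above some \<open>c\<close> can violate
  homogeneity.  Such an element is in \<open>I\<close>, hence below a later element of \<open>C\<close>, or it is in \<open>R\<close> and above
  some but not all of \<open>C\<close>.  The latter, the bad ones, have a maximal one above each of them, because
  \<open>R\<close> contains no ascending sequence, and these maximal bad elements are finitely many.  If there
  were a bad element above every \<open>c\<close>, then one of them would be above all of \<open>C\<close>.  So some final
  segment of \<open>C\<close> has no bad elements above it, and it is homogeneous.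
\<close>

lemma homogeneous_ideal:
  assumes V: "V \<in> Sets M" "V \<subseteq> P" "V \<noteq> {}" and nomax: "\<And>y. y \<in> V \<Longrightarrow> \<exists>z\<in>V. y \<sqsubset> z"
    and R: "R \<in> Sets M" "R \<subseteq> P" and up: "\<And>x p. x \<in> V \<Longrightarrow> x \<sqsubset> p \<Longrightarrow> p \<in> V \<union> R"
    and noasc: "\<And>A. ascending A \<Longrightarrow> \<not> A \<subseteq> R"
  shows "\<exists>C\<in>Sets M. homogeneous P L C"
proof -
  obtain v where v: "v \<in> V"
    "\<And>a b. a \<in> V \<Longrightarrow> b \<in> V \<Longrightarrow> v \<sqsubseteq> a \<Longrightarrow> v \<sqsubseteq> b \<Longrightarrow> \<exists>c\<in>V. a \<sqsubseteq> c \<and> b \<sqsubseteq> c"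
    using directed_cone[OF V nomax] by blast
  define I where "I = {y. y \<in> V \<and> v \<sqsubseteq> y}"
  have I: "I \<in> Sets M"
    by (rule arith_setI[where E = "(\<lambda>_. V)(1 := L)" and e = "\<lambda>_. v" and \<phi> =
      "Var 0 \<^bold>\<in> 0 \<^bold>\<and> leq_fm 1 (Var 1) (Var 0)"])
      (use V L in \<open>auto simp: leq_fm_def I_def below_eq_def\<close>)
  have vI: "v \<in> I" using v(1) I_def by simp
  have I_up: "\<exists>y\<in>I. x \<sqsubset> y \<and> k \<prec> y" if x: "x \<in> I" for x k
  proof -
    have "\<exists>y\<in>V. x \<sqsubset> y \<and> k \<prec> y" using unbounded_above[OF V(1), of x k] nomax x unfolding I_def by blast
    then show ?thesis using x below_eq_trans unfolding I_def below_eq_iff by blast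
  qed
  have I_join: "\<exists>c\<in>I. a \<sqsubseteq> c \<and> b \<sqsubseteq> c" if ab: "a \<in> I" "b \<in> I" for a b
  proof -
    obtain c where "c \<in> V" "a \<sqsubseteq> c" "b \<sqsubseteq> c" using v(2)[of a b] ab unfolding I_def by blast
    then show ?thesis using ab(1) below_eq_trans unfolding I_def by blast
  qed
  define D where "D = {n. \<exists>y. y \<in> I \<and> (\<forall>p. p \<in> I \<and> p \<prec> n \<longrightarrow> p \<sqsubseteq> y)}"
  have "D \<in> Sets M"
    by (rule arith_setI[where E = "(\<lambda>_. I)(1 := L)" and e = "\<lambda>_. \<zero>" and \<phi> =
      "\<^bold>\<exists>1. Var 1 \<^bold>\<in> 0 \<^bold>\<and> (\<^bold>\<forall>2. Var 2 \<^bold>\<in> 0 \<^bold>\<and> Var 2 \<^bold>< Var 0 \<^bold>\<longrightarrow> leq_fm 1 (Var 2) (Var 1))"])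
      (use I L in \<open>auto simp: leq_fm_def D_def below_eq_def\<close>)
  moreover have "\<zero> \<in> D" unfolding D_def using vI by auto
  moreover have "n \<oplus> \<one> \<in> D" if "n \<in> D" for n
  proof -
    obtain y where y: "y \<in> I" "\<And>p. p \<in> I \<Longrightarrow> p \<prec> n \<Longrightarrow> p \<sqsubseteq> y" using \<open>n \<in> D\<close> unfolding D_def by blast
    obtain c where c: "c \<in> I" "y \<sqsubseteq> c" "n \<in> I \<longrightarrow> n \<sqsubseteq> c"
      using I_join[OF y(1)] y(1) below_eq_refl by blast
    have "p \<sqsubseteq> c" if "p \<in> I" "p \<preceq> n" for p using that c y(2) below_eq_trans lte_def by metis
    then have "c \<in> I \<and> (\<forall>p. p \<in> I \<and> p \<prec> n \<oplus> \<one> \<longrightarrow> p \<sqsubseteq> c)" using c(1) by simp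
    then show ?thesis unfolding D_def by blast
  qed
  ultimately have D: "n \<in> D" for n using set_induct by blast
  \<comment> \<open>Each new element of C lies above all elements of I up to the previous one; so C is cofinal in I.\<close>
  define T where "T = {w. \<exists>c y. w = pr M c y \<and> c \<prec> y \<and> y \<in> I \<and> (\<forall>p. p \<in> I \<and> p \<preceq> c \<longrightarrow> p \<sqsubset> y)}"
  have T: "T \<in> Sets M"
    by (rule arith_setI[where E = "(\<lambda>_. I)(1 := L)" and e = "\<lambda>_. \<zero>" and \<phi> =
      "\<^bold>\<exists>1. \<^bold>\<exists>2. Var 0 \<^bold>= pair_tm (Var 1) (Var 2) \<^bold>\<and> Var 1 \<^bold>< Var 2 \<^bold>\<and> Var 2 \<^bold>\<in> 0 \<^bold>\<and>
        (\<^bold>\<forall>3. Var 3 \<^bold>\<in> 0 \<^bold>\<and> Var 3 \<^bold>\<le> Var 1 \<^bold>\<longrightarrow> pair_tm (Var 3) (Var 2) \<^bold>\<in> 1)"])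
      (use I L in \<open>auto simp: T_def below_def lte_def\<close>)
  have TT: "pr M c y \<in> T \<longleftrightarrow> c \<prec> y \<and> y \<in> I \<and> (\<forall>p. p \<in> I \<and> p \<preceq> c \<longrightarrow> p \<sqsubset> y)" for c y
    unfolding T_def by simp
  have "\<exists>y\<in>I. x \<prec> y \<and> pr M x y \<in> T" if x: "x \<in> I" for x
  proof -
    obtain y where y: "y \<in> I" "\<And>p. p \<in> I \<Longrightarrow> p \<prec> x \<oplus> \<one> \<Longrightarrow> p \<sqsubseteq> y" using D[of "x \<oplus> \<one>"] unfolding D_def by blast
    obtain z where z: "z \<in> I" "y \<sqsubset> z" "x \<prec> z" using I_up[OF y(1)] by blast
    have "p \<sqsubset> z" if "p \<in> I" "p \<preceq> x" for p
      using that y(2)[of p] z(2) below_eq_below[of p y z] lt_succ by blast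
    then show ?thesis using z unfolding TT by blast
  qed
  then obtain C where C: "C \<in> Sets M" "C \<subseteq> I" "v \<in> C"
    "\<And>b. b \<in> C \<Longrightarrow> \<exists>c\<in>C. b \<prec> c \<and> pr M b c \<in> T \<and> (\<forall>d\<in>C. b \<prec> d \<longrightarrow> c \<preceq> d)"
    using iteration[OF I T vI] by metis
  have trans: "pr M a c \<in> T" if "pr M a b \<in> T" "pr M b c \<in> T" for a b c
  proof -
    have ab: "a \<prec> b" "b \<in> I" "\<forall>p. p \<in> I \<and> p \<preceq> a \<longrightarrow> p \<sqsubset> b" using that(1) unfolding TT by blast+
    have bc: "b \<prec> c" "c \<in> I" "b \<sqsubset> c" using that(2) ab(2) N.order_refl unfolding TT by blast+
    have "\<forall>p. p \<in> I \<and> p \<preceq> a \<longrightarrow> p \<sqsubset> c" using ab(3) bc(3) below_trans by blast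
    then show ?thesis unfolding TT using ab(1) bc(1,2) N.less_trans by blast
  qed
  have chain: "b \<sqsubset> c" if "b \<in> C" "c \<in> C" "b \<prec> c" for b c
  proof -
    have "pr M b c \<in> T"
    proof (rule iteration_transitive[OF C(1) T])
      show "\<exists>c\<in>C. b \<prec> c \<and> pr M b c \<in> T \<and> (\<forall>d\<in>C. b \<prec> d \<longrightarrow> c \<preceq> d)" if "b \<in> C" for b
        using C(4) that by blast
    qed (use trans that in blast)+
    moreover have "b \<in> I" using C(2) that(1) by blast
    ultimately show ?thesis using N.order_refl unfolding TT by blast
  qed
  have unb: "\<not> bdd C" using iteration_unbounded[OF C(1,3)] C(4) by blast
  have cofinal: "\<exists>c\<in>C. p \<sqsubset> c" if p: "p \<in> I" for p
  proof -
    obtain b where b: "b \<in> C" "p \<prec> b" using unb not_bdd by blast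
    obtain c where c: "c \<in> C" "pr M b c \<in> T" using C(4) b(1) by blast
    then show ?thesis using p b(2) N.less_imp_le unfolding TT by blast
  qed
  define Bad where "Bad = {p. p \<in> R \<and> (\<exists>c. c \<in> C \<and> c \<sqsubseteq> p) \<and> (\<exists>c. c \<in> C \<and> \<not> c \<sqsubseteq> p)}"
  have Bad: "Bad \<in> Sets M"
    by (rule arith_setI[where E = "(\<lambda>_. R)(1 := L, 2 := C)" and e = "\<lambda>_. \<zero>" and \<phi> =
      "Var 0 \<^bold>\<in> 0 \<^bold>\<and> (\<^bold>\<exists>1. Var 1 \<^bold>\<in> 2 \<^bold>\<and> leq_fm 1 (Var 1) (Var 0)) \<^bold>\<and>
        (\<^bold>\<exists>1. Var 1 \<^bold>\<in> 2 \<^bold>\<and> \<^bold>\<not> leq_fm 1 (Var 1) (Var 0))"])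
      (use R C L in \<open>auto simp: leq_fm_def Bad_def below_eq_def\<close>)
  have "\<exists>c\<in>C. \<forall>p\<in>Bad. \<not> c \<sqsubseteq> p"
  proof (rule ccontr)
    assume bad: "\<not> ?thesis"
    define Mx where "Mx = {m. m \<in> Bad \<and> (\<forall>y\<in>Bad. \<not> m \<sqsubset> y)}"
    have "Bad \<subseteq> R" unfolding Bad_def by blast
    then have Bad': "Bad \<subseteq> P" "\<And>A. ascending A \<Longrightarrow> \<not> A \<subseteq> Bad" using R(2) noasc by blast+
    have Mx: "Mx \<in> Sets M" "bdd Mx" unfolding Mx_def using maximal_elements[OF Bad Bad'(1)] by blast+
    define S where "S = {w. \<exists>m c. w = pr M m c \<and> c \<in> C \<and> \<not> c \<sqsubseteq> m}"
    have "S \<in> Sets M"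
      by (rule arith_setI[where E = "(\<lambda>_. C)(1 := L)" and e = "\<lambda>_. \<zero>" and \<phi> =
        "\<^bold>\<exists>1. \<^bold>\<exists>2. Var 0 \<^bold>= pair_tm (Var 1) (Var 2) \<^bold>\<and> Var 2 \<^bold>\<in> 0 \<^bold>\<and> \<^bold>\<not> leq_fm 1 (Var 2) (Var 1)"])
        (use C L in \<open>auto simp: leq_fm_def S_def below_eq_def\<close>)
    moreover have "\<exists>c. pr M m c \<in> S" if "m \<in> Mx" for m
      using that unfolding Mx_def Bad_def S_def by auto
    ultimately obtain u where u: "\<And>m. m \<in> Mx \<Longrightarrow> \<exists>c. c \<prec> u \<and> pr M m c \<in> S"
      using collection[OF Mx] by blast
    obtain c where c: "c \<in> C" "u \<prec> c" using unb not_bdd by blast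
    obtain p where p: "p \<in> Bad" "c \<sqsubseteq> p" using bad c(1) by blast
    obtain m where m: "m \<in> Mx" "p \<sqsubseteq> m"
      using maximal_above[OF Bad Bad'(1) p(1) Bad'(2)] unfolding Mx_def by blast
    obtain d where d: "d \<prec> u" "d \<in> C" "\<not> d \<sqsubseteq> m" using u[OF m(1)] unfolding S_def by auto
    have "d \<sqsubset> c" using chain d(1,2) c N.less_trans by blast
    then have "d \<sqsubseteq> m" using p(2) m(2) below_eq_trans below_eq_iff by blast
    then show False using d(3) by blast
  qed
  then obtain c0 where c0: "c0 \<in> C" "\<And>p. p \<in> Bad \<Longrightarrow> \<not> c0 \<sqsubseteq> p" by blast
  define H where "H = {c. c \<in> C \<and> c0 \<preceq> c}"
  have H: "H \<in> Sets M"
    by (rule arith_setI[where E = "\<lambda>_. C" and e = "\<lambda>_. c0" and \<phi> = "Var 0 \<^bold>\<in> 0 \<^bold>\<and> Var 1 \<^bold>\<le> Var 0"])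
      (use C in \<open>auto simp: H_def lte_def\<close>)
  have later: "\<exists>c\<in>H. k \<prec> c \<and> d \<sqsubset> c" if d: "d \<in> C" for k d
  proof -
    obtain c where c: "c \<in> C" "k \<oplus> d \<oplus> c0 \<prec> c" using unb not_bdd by blast
    have "k \<prec> c" "d \<prec> c" "c0 \<preceq> c"
      using c(2) le_add1 le_add2 N.le_less_trans N.order_trans N.less_imp_le by meson+
    then show ?thesis using c(1) chain d unfolding H_def by blast
  qed
  have "homogeneous P L H"
    unfolding homogeneous_def cmp_iff
  proof (intro conjI ballI)
    show "H \<subseteq> P" using C(2) V(2) unfolding H_def I_def by blast
    show "\<not> bdd H" unfolding not_bdd using later c0(1) by blast
    show "p \<sqsubseteq> q \<or> q \<sqsubseteq> p" if "p \<in> H" "q \<in> H" for p q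
      using that chain N.less_linear unfolding H_def below_eq_iff by blast
    fix p assume "p \<in> P"
    have "\<forall>k. \<exists>c\<in>H. k \<prec> c \<and> (p \<sqsubseteq> c \<or> c \<sqsubseteq> p)" if c: "c \<in> H" "p \<sqsubseteq> c \<or> c \<sqsubseteq> p" for c
    proof (cases "\<exists>d\<in>C. p \<sqsubseteq> d")
      case True
      then show ?thesis using later below_eq_below below_eq_iff by blast
    next
      case False
      then have cp: "c \<sqsubset> p" using c unfolding H_def below_eq_iff by blast
      have cI: "c \<in> I" using c(1) C(2) unfolding H_def by blast
      have "p \<in> V \<union> R" using up cp cI unfolding I_def by blast
      moreover have "p \<notin> V"
      proof
        assume "p \<in> V"
        then have "p \<in> I" using cI cp below_eq_trans unfolding I_def below_eq_iff by blast
        then show False using cofinal False below_eq_iff by blast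
      qed
      ultimately have "p \<in> R" by blast
      moreover have "c0 \<sqsubseteq> p"
        using chain[of c0 c] c0(1) c(1) cp below_eq_iff below_eq_trans unfolding H_def lte_def by blast
      ultimately have "\<forall>d\<in>C. d \<sqsubseteq> p" using c0 unfolding Bad_def by blast
      then show ?thesis using later[OF c0(1)] unfolding H_def by blast
    qed
    then show "(\<forall>c\<in>H. \<not> (p \<sqsubseteq> c \<or> c \<sqsubseteq> p)) \<or> (\<forall>k. \<exists>c\<in>H. k \<prec> c \<and> (p \<sqsubseteq> c \<or> c \<sqsubseteq> p))"
      by blast
  qed
  then show ?thesis using H by blast
qed

end

section \<open>Homogeneous chains in partial orders without infinite antichains\<close>

context fac_order
begin

definition dual :: "'a set" where "dual = {w. \<exists>x y. w = pr M y x \<and> pr M x y \<in> L}"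

definition descending :: "'a set \<Rightarrow> bool" where
  "descending A \<longleftrightarrow> A \<in> Sets M \<and> A \<subseteq> P \<and> \<not> bdd A \<and> (\<forall>a\<in>A. \<forall>b\<in>A. a \<prec> b \<longrightarrow> b \<sqsubset> a)"

lemma dual_iff [simp]: "pr M y x \<in> dual \<longleftrightarrow> pr M x y \<in> L"
  unfolding dual_def by simp

lemma cmp_dual [simp]: "cmp M dual = cmp M L"
  by (intro ext) (auto simp: cmp_def)

lemma homogeneous_dual: "homogeneous P dual C \<longleftrightarrow> homogeneous P L C"
  unfolding homogeneous_def by simp

lemma fac_order_dual: "fac_order M P dual"
proof
  show "P \<in> Sets M" by (rule P)
  show "dual \<in> Sets M"
    by (rule arith_setI[where E = "\<lambda>_. L" and e = "\<lambda>_. \<zero>" and \<phi> =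
      "\<^bold>\<exists>1. \<^bold>\<exists>2. Var 0 \<^bold>= pair_tm (Var 2) (Var 1) \<^bold>\<and> pair_tm (Var 1) (Var 2) \<^bold>\<in> 0"])
      (use L in \<open>auto simp: dual_def\<close>)
  show "partial_order P dual"
    unfolding partial_order_def
  proof (intro conjI ballI impI)
    show "dual \<subseteq> {pr M p q |p q. p \<in> P \<and> q \<in> P}"
    proof
      fix w assume "w \<in> dual"
      then obtain x y where "w = pr M y x" "x \<sqsubset> y" unfolding dual_def below_def by blast
      then show "w \<in> {pr M p q |p q. p \<in> P \<and> q \<in> P}" using below_carrier by blast
    qed
    show "pr M p p \<notin> dual" for p using below_irrefl unfolding below_def by simp
    show "pr M p r \<in> dual" if "pr M p q \<in> dual \<and> pr M q r \<in> dual" for p q r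
      using that below_trans unfolding below_def by simp blast
  qed
  show "A \<in> Sets M \<Longrightarrow> antichain P dual A \<Longrightarrow> bdd A" for A
    using fac unfolding antichain_def by simp
qed

text \<open>
  An element comparable with a member of the ascending part is below almost all of that part or above
  the whole descending part, and symmetrically.
\<close>

lemma homogeneous_zeta:
  assumes A: "ascending A" and D: "descending D" and x: "\<And>a. a \<in> A \<Longrightarrow> x \<sqsubseteq> a" "\<And>d. d \<in> D \<Longrightarrow> d \<sqsubseteq> x"
  shows "\<exists>C\<in>Sets M. homogeneous P L C"
proof -
  have Sets: "A \<in> Sets M" "D \<in> Sets M" "A \<subseteq> P" "D \<subseteq> P" using A D unfolding ascending_def descending_def by blast+
  have unb: "\<not> bdd A" "\<not> bdd D" using A D unfolding ascending_def descending_def by blast+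
  have C: "A \<union> D \<in> Sets M"
    by (rule arith_setI[where E = "(\<lambda>_. A)(1 := D)" and e = "\<lambda>_. \<zero>" and \<phi> = "Var 0 \<^bold>\<in> 0 \<^bold>\<or> Var 0 \<^bold>\<in> 1"])
      (use Sets in auto)
  have up: "\<exists>a\<in>A. k \<prec> a \<and> c \<sqsubseteq> a" if c: "c \<in> A" for c k
  proof -
    obtain a where a: "a \<in> A" "k \<oplus> c \<prec> a" using unb(1) not_bdd by blast
    have "k \<prec> a" "c \<prec> a" using a(2) le_add1 le_add2 N.le_less_trans by blast+
    then show ?thesis using a(1) c A unfolding ascending_def below_eq_iff by blast
  qed
  have down: "\<exists>d\<in>D. k \<prec> d \<and> d \<sqsubseteq> c" if c: "c \<in> D" for c k
  proof -
    obtain d where d: "d \<in> D" "k \<oplus> c \<prec> d" using unb(2) not_bdd by blast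
    have "k \<prec> d" "c \<prec> d" using d(2) le_add1 le_add2 N.le_less_trans by blast+
    then show ?thesis using d(1) c D unfolding descending_def below_eq_iff by blast
  qed
  have far: "\<exists>a\<in>A. k \<prec> a" "\<exists>d\<in>D. k \<prec> d" for k
    using unb not_bdd by blast+
  have "homogeneous P L (A \<union> D)"
    unfolding homogeneous_def cmp_iff
  proof (intro conjI ballI)
    show "A \<union> D \<subseteq> P" using Sets by blast
    show "\<not> bdd (A \<union> D)" unfolding not_bdd using far by blast
    show "p \<sqsubseteq> q \<or> q \<sqsubseteq> p" if "p \<in> A \<union> D" "q \<in> A \<union> D" for p q
    proof -
      have "p = q \<or> p \<prec> q \<or> q \<prec> p" using N.less_linear by blast
      then show ?thesis
        using that A D x below_eq_trans unfolding ascending_def descending_def below_eq_iff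
        by (elim UnE; blast)
    qed
    fix p assume "p \<in> P"
    have "\<exists>c\<in>A \<union> D. k \<prec> c \<and> (p \<sqsubseteq> c \<or> c \<sqsubseteq> p)" if c: "c \<in> A \<union> D" "p \<sqsubseteq> c \<or> c \<sqsubseteq> p" for c k
    proof -
      consider "c \<in> A" "p \<sqsubseteq> c" | "c \<in> A" "c \<sqsubseteq> p" | "c \<in> D" "p \<sqsubseteq> c" | "c \<in> D" "c \<sqsubseteq> p" using c by blast
      then show ?thesis
      proof cases
        case 1
        then show ?thesis using up below_eq_trans by blast
      next
        case 2
        then have "x \<sqsubseteq> p" using x(1) below_eq_trans by blast
        then show ?thesis using far(2) x(2) below_eq_trans by blast
      next
        case 3
        then have "p \<sqsubseteq> x" using x(2) below_eq_trans by blast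
        then show ?thesis using far(1) x(1) below_eq_trans by blast
      next
        case 4
        then show ?thesis using down below_eq_trans by blast
      qed
    qed
    then show "(\<forall>c\<in>A \<union> D. \<not> (p \<sqsubseteq> c \<or> c \<sqsubseteq> p)) \<or> (\<forall>k. \<exists>c\<in>A \<union> D. k \<prec> c \<and> (p \<sqsubseteq> c \<or> c \<sqsubseteq> p))"
      by blast
  qed
  then show ?thesis using C by blast
qed

text \<open>
  The elements of \<open>[x, m]\<close> with only finitely many elements of \<open>[x, m]\<close> below them.
\<close>

definition initial_part :: "'a \<Rightarrow> 'a \<Rightarrow> 'a set" where
  "initial_part x m = {y. y \<in> P \<and> x \<sqsubseteq> y \<and> y \<sqsubseteq> m \<and> bdd {z. x \<sqsubseteq> z \<and> z \<sqsubseteq> y}}"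

text \<open>
  The arithmetical substitute for the set of elements with an ascending sequence above them: a greedy
  search inside some \<open>initial_part x m\<close> is required to succeed.
\<close>

definition ascent :: "'a set" where
  "ascent = {p. p \<in> P \<and> (\<exists>x m q. p \<sqsubseteq> q \<and> q \<in> initial_part x m \<and>
    (\<forall>y. y \<in> initial_part x m \<and> q \<sqsubseteq> y \<longrightarrow> (\<exists>z. z \<in> initial_part x m \<and> y \<sqsubset> z)))}"

lemma initial_part_in_Sets: "initial_part x m \<in> Sets M"
  by (rule arith_setI[where E = "(\<lambda>_. P)(1 := L)" and e = "(\<lambda>_. \<zero>)(10 := x, 11 := m)" and \<phi> =
      "Var 0 \<^bold>\<in> 0 \<^bold>\<and> leq_fm 1 (Var 10) (Var 0) \<^bold>\<and> leq_fm 1 (Var 0) (Var 11) \<^bold>\<and>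
        (\<^bold>\<exists>1. \<^bold>\<forall>2. leq_fm 1 (Var 10) (Var 2) \<^bold>\<and> leq_fm 1 (Var 2) (Var 0) \<^bold>\<longrightarrow> Var 2 \<^bold>< Var 1)"])
    (use P L in \<open>auto simp: leq_fm_def initial_part_def below_eq_def bdd_def\<close>)

lemma ascent_in_Sets: "ascent \<in> Sets M"
proof -
  define F where "F = {w. \<exists>x y. w = pr M x y \<and> (\<exists>k. \<forall>z. x \<sqsubseteq> z \<and> z \<sqsubseteq> y \<longrightarrow> z \<prec> k)}"
  have F: "F \<in> Sets M"
    by (rule arith_setI[where E = "\<lambda>_. L" and e = "\<lambda>_. \<zero>" and \<phi> =
      "\<^bold>\<exists>1. \<^bold>\<exists>2. Var 0 \<^bold>= pair_tm (Var 1) (Var 2) \<^bold>\<and>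
        (\<^bold>\<exists>3. \<^bold>\<forall>4. leq_fm 0 (Var 1) (Var 4) \<^bold>\<and> leq_fm 0 (Var 4) (Var 2) \<^bold>\<longrightarrow> Var 4 \<^bold>< Var 3)"])
      (use L in \<open>auto simp: leq_fm_def F_def below_eq_def\<close>)
  have ip: "y \<in> initial_part x m \<longleftrightarrow> y \<in> P \<and> x \<sqsubseteq> y \<and> y \<sqsubseteq> m \<and> pr M x y \<in> F" for x y m
    unfolding initial_part_def F_def bdd_def by auto
  show ?thesis
    by (rule arith_setI[where E = "(\<lambda>_. P)(1 := L, 2 := F)" and e = "\<lambda>_. \<zero>" and \<phi> =
      "Var 0 \<^bold>\<in> 0 \<^bold>\<and> (\<^bold>\<exists>1. \<^bold>\<exists>2. \<^bold>\<exists>3. leq_fm 1 (Var 0) (Var 3) \<^bold>\<and>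
        (Var 3 \<^bold>\<in> 0 \<^bold>\<and> leq_fm 1 (Var 1) (Var 3) \<^bold>\<and> leq_fm 1 (Var 3) (Var 2) \<^bold>\<and> pair_tm (Var 1) (Var 3) \<^bold>\<in> 2) \<^bold>\<and>
        (\<^bold>\<forall>4. (Var 4 \<^bold>\<in> 0 \<^bold>\<and> leq_fm 1 (Var 1) (Var 4) \<^bold>\<and> leq_fm 1 (Var 4) (Var 2) \<^bold>\<and> pair_tm (Var 1) (Var 4) \<^bold>\<in> 2) \<^bold>\<and>
            leq_fm 1 (Var 3) (Var 4) \<^bold>\<longrightarrow>
          (\<^bold>\<exists>5. (Var 5 \<^bold>\<in> 0 \<^bold>\<and> leq_fm 1 (Var 1) (Var 5) \<^bold>\<and> leq_fm 1 (Var 5) (Var 2) \<^bold>\<and> pair_tm (Var 1) (Var 5) \<^bold>\<in> 2) \<^bold>\<and>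
            pair_tm (Var 4) (Var 5) \<^bold>\<in> 1)))"])
      (use P L F in \<open>simp_all add: ascent_def ip leq_fm_def below_def below_eq_def image_subset_iff\<close>)
qed

lemma ascent_carrier: "ascent \<subseteq> P"
  unfolding ascent_def by blast

lemma ascent_no_maximal:
  assumes "p \<in> ascent"
  shows "\<exists>p'\<in>ascent. p \<sqsubset> p'"
proof -
  obtain x m q where q: "p \<sqsubseteq> q" "q \<in> initial_part x m"
    "\<And>y. y \<in> initial_part x m \<Longrightarrow> q \<sqsubseteq> y \<Longrightarrow> \<exists>z. z \<in> initial_part x m \<and> y \<sqsubset> z"
    using assms unfolding ascent_def by blast
  obtain z where z: "z \<in> initial_part x m" "q \<sqsubset> z" using q(3)[OF q(2)] by auto
  have "q \<sqsubseteq> y" if "z \<sqsubseteq> y" for y using that z(2) below_eq_trans unfolding below_eq_iff by blast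
  then have "z \<in> ascent"
    unfolding ascent_def using z(1) q(3) below_carrier(2)[OF z(2)] below_eq_refl by blast
  then show ?thesis using q(1) z(2) below_eq_below by blast
qed

lemma ascent_ascending:
  assumes "p \<in> ascent"
  shows "\<exists>A. ascending A \<and> (\<forall>a\<in>A. p \<sqsubseteq> a)"
proof -
  obtain x m q where q: "p \<sqsubseteq> q" "q \<in> initial_part x m"
    "\<And>y. y \<in> initial_part x m \<Longrightarrow> q \<sqsubseteq> y \<Longrightarrow> \<exists>z. z \<in> initial_part x m \<and> y \<sqsubset> z"
    using assms unfolding ascent_def by blast
  have "initial_part x m \<subseteq> P" unfolding initial_part_def by blast
  from ascending_from[OF initial_part_in_Sets this q(2)] q(3)
  obtain A where "ascending A" "\<And>a. a \<in> A \<Longrightarrow> q \<sqsubseteq> a" by metis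
  then show ?thesis using q(1) below_eq_trans by blast
qed

text \<open>
  In an initial part all lower cones are finite, so if it is infinite, it has an element with
  no maximal elements above it.
\<close>

lemma unbounded_initial_part_imp_ascent:
  assumes "l \<in> P" "\<not> bdd (initial_part l m)"
  shows "l \<in> ascent"
proof -
  have sub: "initial_part l m \<subseteq> P" unfolding initial_part_def by blast
  have "bdd {z. z \<in> initial_part l m \<and> z \<sqsubseteq> y}" if "y \<in> initial_part l m" for y
  proof (rule bdd_subset)
    show "bdd {z. l \<sqsubseteq> z \<and> z \<sqsubseteq> y}" using that unfolding initial_part_def by blast
  qed (auto simp: initial_part_def)
  then obtain q where q: "q \<in> initial_part l m"
    "\<forall>y\<in>initial_part l m. q \<sqsubseteq> y \<longrightarrow> (\<exists>z\<in>initial_part l m. y \<sqsubset> z)"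
    using no_maximal_above_of_finite_lower_cones[OF initial_part_in_Sets sub assms(2)] by blast
  have "l \<sqsubseteq> q" using q(1) unfolding initial_part_def by blast
  then show ?thesis unfolding ascent_def using q assms(1) by blast
qed

text \<open>
  If only finitely many \<open>y\<close> in \<open>[l, m]\<close> have finite \<open>[y, m]\<close>, then above each \<open>y\<close> with infinite
  \<open>[y, m]\<close> there is another such element.
\<close>

lemma ascending_in_interval:
  assumes x: "x \<in> P" "\<not> bdd {z. x \<sqsubseteq> z \<and> z \<sqsubseteq> m}" and l: "l \<sqsubseteq> x"
    and fin: "bdd {y. y \<in> P \<and> l \<sqsubseteq> y \<and> y \<sqsubseteq> m \<and> bdd {z. y \<sqsubseteq> z \<and> z \<sqsubseteq> m}}"
  shows "\<exists>A. ascending A \<and> (\<forall>a\<in>A. x \<sqsubseteq> a)"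
proof -
  define X where "X = {y. y \<in> P \<and> x \<sqsubseteq> y \<and> y \<sqsubseteq> m \<and> \<not> (\<exists>k. \<forall>z. y \<sqsubseteq> z \<and> z \<sqsubseteq> m \<longrightarrow> z \<prec> k)}"
  have X: "X \<in> Sets M"
    by (rule arith_setI[where E = "(\<lambda>_. P)(1 := L)" and e = "(\<lambda>_. \<zero>)(10 := x, 11 := m)" and \<phi> =
      "Var 0 \<^bold>\<in> 0 \<^bold>\<and> leq_fm 1 (Var 10) (Var 0) \<^bold>\<and> leq_fm 1 (Var 0) (Var 11) \<^bold>\<and>
        \<^bold>\<not> (\<^bold>\<exists>1. \<^bold>\<forall>2. leq_fm 1 (Var 0) (Var 2) \<^bold>\<and> leq_fm 1 (Var 2) (Var 11) \<^bold>\<longrightarrow> Var 2 \<^bold>< Var 1)"])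
      (use P L in \<open>simp_all add: X_def leq_fm_def below_eq_def image_subset_iff\<close>)
  have X_iff: "y \<in> X \<longleftrightarrow> y \<in> P \<and> x \<sqsubseteq> y \<and> y \<sqsubseteq> m \<and> \<not> bdd {z. y \<sqsubseteq> z \<and> z \<sqsubseteq> m}" for y
    unfolding X_def bdd_def by simp
  have "\<exists>z. x \<sqsubseteq> z \<and> z \<sqsubseteq> m" using x(2) unfolding not_bdd by blast
  then have xX: "x \<in> X" unfolding X_iff using x below_eq_trans by auto
  have "X \<subseteq> P" using X_iff by blast
  have "\<exists>z\<in>X. y \<sqsubset> z" if y: "y \<in> X" for y
  proof -
    obtain k where k: "\<And>z. z \<in> P \<Longrightarrow> l \<sqsubseteq> z \<Longrightarrow> z \<sqsubseteq> m \<Longrightarrow> bdd {w. z \<sqsubseteq> w \<and> w \<sqsubseteq> m} \<Longrightarrow> z \<prec> k"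
      using fin unfolding bdd_def[of "Collect _"] by blast
    obtain z where z: "y \<sqsubseteq> z" "z \<sqsubseteq> m" "k \<oplus> y \<prec> z"
      using y unfolding X_iff not_bdd by blast
    have kz: "k \<prec> z" "y \<prec> z" using z(3) le_add1 le_add2 N.le_less_trans by blast+
    then have yz: "y \<sqsubset> z" using z(1) N.less_irrefl unfolding below_eq_iff by blast
    have "x \<sqsubseteq> z" using y z(1) below_eq_trans unfolding X_iff by blast
    moreover have "\<not> bdd {w. z \<sqsubseteq> w \<and> w \<sqsubseteq> m}"
      using k[of z] kz(1) z(2) below_carrier(2)[OF yz] l \<open>x \<sqsubseteq> z\<close> below_eq_trans N.less_asym by blast
    ultimately show ?thesis unfolding Bex_def X_iff using yz below_carrier(2)[OF yz] z(2) by blast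
  qed
  then show ?thesis using ascending_from[OF X \<open>X \<subseteq> P\<close> xX] by metis
qed

text \<open>
  Otherwise the elements above \<open>q\<close> outside \<open>Z\<close> would form a set as in \<open>homogeneous_ideal\<close>.
\<close>

lemma maximal_above_outside:
  assumes Z: "Z \<in> Sets M" "Z \<subseteq> P" and noasc: "\<And>A. ascending A \<Longrightarrow> \<not> A \<subseteq> Z"
    and none: "\<not> (\<exists>C\<in>Sets M. homogeneous P L C)" and q: "q \<in> P - Z"
  shows "\<exists>m\<in>P - Z. q \<sqsubseteq> m \<and> (\<forall>y\<in>P - Z. \<not> m \<sqsubset> y)"
proof (rule ccontr)
  assume no: "\<not> ?thesis"
  define V where "V = {y. y \<in> P \<and> y \<notin> Z \<and> q \<sqsubseteq> y}"
  have "V \<in> Sets M"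
    by (rule arith_setI[where E = "(\<lambda>_. P)(1 := L, 2 := Z)" and e = "\<lambda>_. q" and \<phi> =
      "Var 0 \<^bold>\<in> 0 \<^bold>\<and> \<^bold>\<not> Var 0 \<^bold>\<in> 2 \<^bold>\<and> leq_fm 1 (Var 1) (Var 0)"])
      (use P L Z in \<open>auto simp: leq_fm_def V_def below_eq_def\<close>)
  moreover have "V \<subseteq> P" "V \<noteq> {}" using q unfolding V_def by auto
  moreover have "\<exists>z\<in>V. y \<sqsubset> z" if y: "y \<in> V" for y
  proof -
    obtain z where "z \<in> P - Z" "y \<sqsubset> z" using no y unfolding V_def by blast
    then show ?thesis using y below_eq_trans unfolding V_def below_eq_iff by blast
  qed
  moreover have "p \<in> V \<union> Z" if "x \<in> V" "x \<sqsubset> p" for x p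
    using that below_eq_trans below_carrier unfolding V_def below_eq_iff by blast
  ultimately show False using homogeneous_ideal[OF _ _ _ _ Z _ noasc] none by blast
qed

text \<open>
  A finite set \<open>F\<close> cannot help \<open>Z\<close> to contain an ascending sequence, since a final segment of the
  sequence avoids \<open>F\<close>.
\<close>

lemma homogeneous_if_almost_ascent:
  assumes Z: "Z \<in> Sets M" "Z \<subseteq> P" and noasc: "\<And>A. ascending A \<Longrightarrow> \<not> A \<subseteq> Z"
    and F: "F \<in> Sets M" "F \<subseteq> P" "bdd F" and cover: "P \<subseteq> ascent \<union> Z \<union> F" and ne: "ascent \<noteq> {}"
  shows "\<exists>C\<in>Sets M. homogeneous P L C"
proof (rule homogeneous_ideal[OF ascent_in_Sets ascent_carrier ne ascent_no_maximal])
  show "Z \<union> F \<in> Sets M"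
    by (rule arith_setI[where E = "(\<lambda>_. Z)(1 := F)" and e = "\<lambda>_. \<zero>" and \<phi> = "Var 0 \<^bold>\<in> 0 \<^bold>\<or> Var 0 \<^bold>\<in> 1"])
      (use Z F in auto)
  show "Z \<union> F \<subseteq> P" using Z F by blast
  show "p \<in> ascent \<union> (Z \<union> F)" if "x \<sqsubset> p" for x p using below_carrier(2)[OF that] cover by blast
  show "\<not> A \<subseteq> Z \<union> F" if A: "ascending A" for A
  proof
    assume sub: "A \<subseteq> Z \<union> F"
    obtain k where k: "\<forall>i\<in>F. i \<prec> k" using F(3) unfolding bdd_def ..
    define B where "B = {a. a \<in> A \<and> k \<prec> a}"
    have "B \<in> Sets M"
      by (rule arith_setI[where E = "\<lambda>_. A" and e = "\<lambda>_. k" and \<phi> = "Var 0 \<^bold>\<in> 0 \<^bold>\<and> Var 1 \<^bold>< Var 0"])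
        (use A in \<open>auto simp: B_def ascending_def\<close>)
    moreover have "\<not> bdd B"
      unfolding not_bdd
    proof
      fix n
      have "\<not> bdd A" using A unfolding ascending_def by blast
      then obtain a where a: "a \<in> A" "n \<oplus> k \<prec> a" using not_bdd by blast
      then have "n \<prec> a" "k \<prec> a" using le_add1 le_add2 N.le_less_trans by blast+
      then show "\<exists>i\<in>B. n \<prec> i" using a(1) unfolding B_def by blast
    qed
    ultimately have "ascending B" using A unfolding ascending_def B_def by blast
    moreover have "B \<subseteq> Z" using sub k N.less_asym unfolding B_def by blast
    ultimately show False using noasc by blast
  qed
qed auto

theorem homogeneous_chain_exists:
  assumes inf: "\<not> bdd P"
  shows "\<exists>C\<in>Sets M. homogeneous P L C"
proof (rule ccontr)
  assume none: "\<not> ?thesis"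
  interpret D: fac_order M P dual by (rule fac_order_dual)
  have dual_below: "D.below x y \<longleftrightarrow> y \<sqsubset> x" and dual_below_eq: "D.below_eq x y \<longleftrightarrow> y \<sqsubseteq> x" for x y
    unfolding D.below_def below_def D.below_eq_def below_eq_def by auto
  have dual_ascending: "D.ascending A \<longleftrightarrow> descending A" for A
    unfolding D.ascending_def descending_def dual_below ..
  have none': "\<not> (\<exists>C\<in>Sets M. homogeneous P dual C)" using none homogeneous_dual by simp
  define W where "W = ascent"
  define Z where "Z = D.ascent"
  have Sets: "W \<in> Sets M" "W \<subseteq> P" "Z \<in> Sets M" "Z \<subseteq> P"
    unfolding W_def Z_def
    using ascent_in_Sets ascent_carrier D.ascent_in_Sets D.ascent_carrier by auto
  have W_up: "\<exists>A. ascending A \<and> (\<forall>a\<in>A. p \<sqsubseteq> a)" if "p \<in> W" for p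
    using ascent_ascending that unfolding W_def by blast
  have Z_down: "\<exists>A. descending A \<and> (\<forall>a\<in>A. a \<sqsubseteq> p)" if "p \<in> Z" for p
    using D.ascent_ascending that unfolding Z_def dual_ascending dual_below_eq by blast
  have zeta: False if "ascending A" "descending B" "\<And>a. a \<in> A \<Longrightarrow> x \<sqsubseteq> a" "\<And>b. b \<in> B \<Longrightarrow> b \<sqsubseteq> x" for A B x
    using homogeneous_zeta[OF that] none by blast
  have disjoint: "W \<inter> Z = {}" using W_up Z_down zeta by blast
  have Z_noasc: "\<not> A \<subseteq> Z" if A: "ascending A" for A
  proof
    assume sub: "A \<subseteq> Z"
    have "A \<in> Sets M" "A \<noteq> {}" using A unfolding ascending_def bdd_def by auto
    then obtain a where a: "a \<in> A" "\<And>x. x \<in> A \<Longrightarrow> a \<preceq> x" using least_element by blast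
    then have "\<forall>x\<in>A. a \<sqsubseteq> x" using A unfolding ascending_def below_eq_iff lte_def by blast
    then show False using Z_down a(1) sub A zeta by blast
  qed
  have W_nodesc: "\<not> A \<subseteq> W" if A: "D.ascending A" for A
  proof
    assume sub: "A \<subseteq> W"
    have A': "descending A" using A dual_ascending by simp
    then have "A \<in> Sets M" "A \<noteq> {}" unfolding descending_def bdd_def by auto
    then obtain a where a: "a \<in> A" "\<And>x. x \<in> A \<Longrightarrow> a \<preceq> x" using least_element by blast
    then have "\<forall>x\<in>A. x \<sqsubseteq> a" using A' unfolding descending_def below_eq_iff lte_def by blast
    then show False using W_up a(1) sub A' zeta by blast
  qed
  \<comment> \<open>In an infinite interval with finite initial parts at both ends, any x outside these parts has
  infinitely many elements of the interval on both sides and is the centre of a zeta chain.\<close>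
  have intervals: "bdd {z. l \<sqsubseteq> z \<and> z \<sqsubseteq> m}" if lm: "l \<in> P - W" "m \<in> P - Z" for l m
  proof (rule ccontr)
    assume unb: "\<not> ?thesis"
    have lo: "bdd (initial_part l m)"
      using unbounded_initial_part_imp_ascent lm(1) W_def by blast
    have hi: "bdd (D.initial_part m l)"
      using D.unbounded_initial_part_imp_ascent lm(2) Z_def by blast
    obtain k where k: "\<forall>i\<in>initial_part l m \<union> D.initial_part m l. i \<prec> k"
      using bdd_Un[OF lo hi] unfolding bdd_def ..
    obtain x where x: "l \<sqsubseteq> x" "x \<sqsubseteq> m" "k \<prec> x" using unb unfolding not_bdd by blast
    have xP: "x \<in> P" using x(1) lm(1) below_carrier unfolding below_eq_iff by blast
    have "x \<notin> initial_part l m" "x \<notin> D.initial_part m l" using k x(3) N.less_asym by blast+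
    then have unb1: "\<not> bdd {z. l \<sqsubseteq> z \<and> z \<sqsubseteq> x}" and unb2: "\<not> bdd {z. x \<sqsubseteq> z \<and> z \<sqsubseteq> m}"
      unfolding initial_part_def D.initial_part_def dual_below_eq using x(1,2) xP
      by (auto simp: conj_commute)
    have "\<exists>A. ascending A \<and> (\<forall>a\<in>A. x \<sqsubseteq> a)"
    proof (rule ascending_in_interval[OF xP unb2 x(1)])
      show "bdd {y. y \<in> P \<and> l \<sqsubseteq> y \<and> y \<sqsubseteq> m \<and> bdd {z. y \<sqsubseteq> z \<and> z \<sqsubseteq> m}}"
        using hi unfolding D.initial_part_def dual_below_eq by (rule bdd_subset) (auto simp: conj_commute)
    qed
    moreover have "\<exists>A. D.ascending A \<and> (\<forall>a\<in>A. D.below_eq x a)"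
    proof (rule D.ascending_in_interval)
      show "x \<in> P" by (rule xP)
      show "\<not> bdd {z. D.below_eq x z \<and> D.below_eq z l}"
        using unb1 unfolding dual_below_eq by (simp add: conj_commute)
      show "D.below_eq m x" unfolding dual_below_eq by (rule x(2))
      show "bdd {y. y \<in> P \<and> D.below_eq m y \<and> D.below_eq y l \<and> bdd {z. D.below_eq y z \<and> D.below_eq z l}}"
        using lo unfolding initial_part_def dual_below_eq by (rule bdd_subset) (auto simp: conj_commute)
    qed
    ultimately show False using zeta unfolding dual_ascending dual_below_eq by blast
  qed
  define Mx where "Mx = {m. m \<in> P - Z \<and> (\<forall>y\<in>P - Z. \<not> m \<sqsubset> y)}"
  define Mn where "Mn = {m. m \<in> P - W \<and> (\<forall>y\<in>P - W. \<not> D.below m y)}"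
  have diff: "P - X \<in> Sets M" if "X \<in> Sets M" for X
    by (rule arith_setI[where E = "(\<lambda>_. P)(1 := X)" and e = "\<lambda>_. \<zero>" and \<phi> = "Var 0 \<^bold>\<in> 0 \<^bold>\<and> \<^bold>\<not> Var 0 \<^bold>\<in> 1"])
      (use P that in auto)
  have Mx: "Mx \<in> Sets M" "bdd Mx"
    unfolding Mx_def using maximal_elements[OF diff[OF Sets(3)]] by blast+
  have Mn: "Mn \<in> Sets M" "bdd Mn"
    unfolding Mn_def using D.maximal_elements[OF diff[OF Sets(1)]] by blast+
  have Mx_above: "\<exists>m\<in>Mx. q \<sqsubseteq> m" if "q \<in> P - Z" for q
    using maximal_above_outside[OF Sets(3,4) Z_noasc none that] unfolding Mx_def by blast
  have Mn_below: "\<exists>l\<in>Mn. l \<sqsubseteq> q" if "q \<in> P - W" for q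
    using D.maximal_above_outside[OF Sets(1,2) W_nodesc none' that] unfolding Mn_def dual_below_eq by blast
  define F where "F = P - W - Z"
  have F: "F \<in> Sets M"
    by (rule arith_setI[where E = "(\<lambda>_. P)(1 := W, 2 := Z)" and e = "\<lambda>_. \<zero>" and
        \<phi> = "Var 0 \<^bold>\<in> 0 \<^bold>\<and> \<^bold>\<not> Var 0 \<^bold>\<in> 1 \<^bold>\<and> \<^bold>\<not> Var 0 \<^bold>\<in> 2"])
      (use P Sets in \<open>auto simp: F_def\<close>)
  have "bdd F"
  proof (rule bdd_if_covered[OF F Mx])
    show "\<exists>m\<in>Mx. z \<sqsubseteq> m" if "z \<in> F" for z using that Mx_above unfolding F_def by blast
    fix m assume m: "m \<in> Mx"
    show "bdd {z. z \<in> F \<and> z \<sqsubseteq> m}"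
    proof (rule D.bdd_if_covered[OF _ Mn])
      show "{z. z \<in> F \<and> z \<sqsubseteq> m} \<in> Sets M"
        by (rule arith_setI[where E = "(\<lambda>_. F)(1 := L)" and e = "\<lambda>_. m" and
            \<phi> = "Var 0 \<^bold>\<in> 0 \<^bold>\<and> leq_fm 1 (Var 0) (Var 1)"])
          (use F L in \<open>auto simp: leq_fm_def below_eq_def\<close>)
      show "\<exists>b\<in>Mn. D.below_eq y b" if "y \<in> {z. z \<in> F \<and> z \<sqsubseteq> m}" for y
        using that Mn_below unfolding F_def dual_below_eq by blast
      show "bdd {z. z \<in> {z. z \<in> F \<and> z \<sqsubseteq> m} \<and> D.below_eq z b}" if "b \<in> Mn" for b
      proof (rule bdd_subset)
        show "bdd {z. b \<sqsubseteq> z \<and> z \<sqsubseteq> m}"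
          using intervals that m unfolding Mx_def Mn_def by blast
      qed (auto simp: dual_below_eq)
    qed
  qed
  have cover: "P \<subseteq> W \<union> Z \<union> F" and "F \<subseteq> P" unfolding F_def by blast+
  have "P - F \<noteq> {}" using inf \<open>bdd F\<close> bdd_subset by blast
  then have "W \<noteq> {} \<or> Z \<noteq> {}" using cover by blast
  then show False
  proof
    assume "W \<noteq> {}"
    then show False
      using homogeneous_if_almost_ascent[OF Sets(3,4) Z_noasc F \<open>F \<subseteq> P\<close> \<open>bdd F\<close>] cover none
      unfolding W_def by blast
  next
    assume "Z \<noteq> {}"
    then show False
      using D.homogeneous_if_almost_ascent[OF Sets(1,2) W_nodesc F \<open>F \<subseteq> P\<close> \<open>bdd F\<close>] cover none'
      unfolding Z_def by blast
  qed
qed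

end

section \<open>The equivalences\<close>

context aca0_model begin

text \<open>
  An infinite antichain, enumerated in increasing order, is a bad sequence.  The enumeration \<open>h\<close> is
  obtained by iterating the step from \<open>(m, x)\<close> to \<open>(m + 1, y)\<close> with \<open>x\<close> less than \<open>y\<close>.
\<close>

lemma well_partial_order_antichains_bounded:
  assumes wpo: "well_partial_order P L" and A: "A \<in> Sets M" "antichain P L A"
  shows "bdd A"
proof (rule ccontr)
  assume unb: "\<not> bdd A"
  then obtain x0 where x0: "x0 \<in> A" unfolding bdd_def by blast
  define X where "X = {w. \<exists>m x. w = pr M m x \<and> x \<in> A}"
  have X: "X \<in> Sets M"
    by (rule arith_setI[where E = "\<lambda>_. A" and e = "\<lambda>_. \<zero>" and \<phi> =
      "\<^bold>\<exists>1. \<^bold>\<exists>2. Var 0 \<^bold>= pair_tm (Var 1) (Var 2) \<^bold>\<and> Var 2 \<^bold>\<in> 0"])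
      (use A in \<open>auto simp: X_def\<close>)
  define R where "R = {w. \<exists>m x y. w = pr M (pr M m x) (pr M (m \<oplus> \<one>) y) \<and> x \<prec> y}"
  have R: "R \<in> Sets M"
    by (rule arith_setI[where E = "\<lambda>_. A" and e = "\<lambda>_. \<zero>" and \<phi> =
      "\<^bold>\<exists>1. \<^bold>\<exists>2. \<^bold>\<exists>3. Var 0 \<^bold>= pair_tm (pair_tm (Var 1) (Var 2)) (pair_tm (Var 1 \<^bold>+ \<^bold>1) (Var 3)) \<^bold>\<and>
        Var 2 \<^bold>< Var 3"])
      (use A in \<open>auto simp: R_def\<close>)
  define T where "T = {w. \<exists>m x n y. w = pr M (pr M m x) (pr M n y) \<and> m \<prec> n \<and> x \<prec> y}"
  have T: "T \<in> Sets M"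
    by (rule arith_setI[where E = "\<lambda>_. A" and e = "\<lambda>_. \<zero>" and \<phi> =
      "\<^bold>\<exists>1. \<^bold>\<exists>2. \<^bold>\<exists>3. \<^bold>\<exists>4. Var 0 \<^bold>= pair_tm (pair_tm (Var 1) (Var 2)) (pair_tm (Var 3) (Var 4)) \<^bold>\<and>
        Var 1 \<^bold>< Var 3 \<^bold>\<and> Var 2 \<^bold>< Var 4"])
      (use A in \<open>auto simp: T_def\<close>)
  have TT: "pr M (pr M m x) (pr M n y) \<in> T \<longleftrightarrow> m \<prec> n \<and> x \<prec> y" for m x n y
    unfolding T_def by auto
  have RT: "R \<subseteq> T" unfolding R_def T_def using lt_succ_self by blast
  have XX: "pr M m x \<in> X \<longleftrightarrow> x \<in> A" for m x unfolding X_def by simp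
  have "\<exists>v\<in>X. w \<prec> v \<and> pr M w v \<in> R" if w: "w \<in> X" for w
  proof -
    obtain m x where mx: "w = pr M m x" "x \<in> A" using w unfolding X_def by blast
    obtain y where y: "y \<in> A" "x \<prec> y" using unb not_bdd by blast
    have "w \<prec> pr M (m \<oplus> \<one>) y" unfolding mx(1) using y(2) by (intro pr_mono_strict) (auto simp: lte_def)
    moreover have "pr M w (pr M (m \<oplus> \<one>) y) \<in> R" unfolding mx(1) R_def using y(2) by blast
    ultimately show ?thesis using y(1) XX by blast
  qed
  moreover have "pr M \<zero> x0 \<in> X" using x0 XX by blast
  ultimately obtain h where h: "h \<in> Sets M" "h \<subseteq> X" "pr M \<zero> x0 \<in> h"
    "\<And>b. b \<in> h \<Longrightarrow> \<exists>c\<in>h. b \<prec> c \<and> pr M b c \<in> R \<and> (\<forall>d\<in>h. b \<prec> d \<longrightarrow> c \<preceq> d)"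
    using iteration[OF X R] by metis
  have trans: "pr M a c \<in> T" if abc: "pr M a b \<in> T" "pr M b c \<in> T" for a b c
  proof -
    obtain m x n y where 1: "a = pr M m x" "b = pr M n y" "m \<prec> n" "x \<prec> y"
      using abc(1) unfolding T_def mem_Collect_eq pr_inj by blast
    obtain k z where 2: "c = pr M k z" "n \<prec> k" "y \<prec> z"
      using abc(2) unfolding 1(2) T_def mem_Collect_eq pr_inj by blast
    show ?thesis unfolding 1 2 TT using 1 2 N.less_trans by blast
  qed
  have chain: "pr M b c \<in> T" if "b \<in> h" "c \<in> h" "b \<prec> c" for b c
  proof (rule iteration_transitive[OF h(1) T])
    show "\<exists>c\<in>h. b \<prec> c \<and> pr M b c \<in> T \<and> (\<forall>d\<in>h. b \<prec> d \<longrightarrow> c \<preceq> d)" if "b \<in> h" for b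
      using h(4)[OF that] RT by blast
  qed (use trans that in blast)+
  have increasing: "m \<prec> n \<and> x \<prec> y \<or> n \<prec> m \<and> y \<prec> x"
    if "pr M m x \<in> h" "pr M n y \<in> h" "\<not> (m = n \<and> x = y)" for m x n y
    using chain[OF that(1,2)] chain[OF that(2,1)] that(3) N.less_linear[of "pr M m x" "pr M n y"] TT
    by auto
  define D where "D = {m. \<exists>x. pr M m x \<in> h}"
  have "D \<in> Sets M"
    by (rule arith_setI[where E = "\<lambda>_. h" and e = "\<lambda>_. \<zero>" and \<phi> = "\<^bold>\<exists>1. pair_tm (Var 0) (Var 1) \<^bold>\<in> 0"])
      (use h in \<open>auto simp: D_def\<close>)
  moreover have "\<zero> \<in> D" unfolding D_def using h(3) by blast
  moreover have "m \<oplus> \<one> \<in> D" if m: "m \<in> D" for m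
  proof -
    obtain x where "pr M m x \<in> h" using m unfolding D_def by blast
    then obtain c where c: "c \<in> h" "pr M (pr M m x) c \<in> R" using h(4) by blast
    then obtain y where "c = pr M (m \<oplus> \<one>) y" unfolding R_def by auto
    then show ?thesis using c(1) unfolding D_def by blast
  qed
  ultimately have total: "\<exists>x. pr M m x \<in> h" for m using set_induct[of D m] unfolding D_def by blast
  have "\<forall>m. \<exists>!x. pr M m x \<in> h"
  proof (intro allI ex_ex1I)
    show "\<exists>x. pr M m x \<in> h" for m by (rule total)
    show "x = y" if "pr M m x \<in> h" "pr M m y \<in> h" for m x y
      using increasing[OF that] N.less_irrefl by blast
  qed
  moreover have "h \<subseteq> {pr M m p |m p. p \<in> P}"
    using h(2) A(2) unfolding X_def antichain_def by blast
  ultimately obtain m n p q where *: "m \<prec> n" "pr M m p \<in> h" "pr M n q \<in> h" "pr M p q \<in> L \<or> p = q"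
    using wpo h(1) unfolding well_partial_order_def by blast
  have "p \<prec> q" using increasing[OF *(2,3)] *(1) N.less_irrefl N.less_asym by blast
  then have "p \<noteq> q" using N.less_irrefl by blast
  moreover have "p \<in> A" "q \<in> A" using *(2,3) h(2) XX by blast+
  ultimately have "\<not> cmp M L p q" using A(2) unfolding antichain_def by blast
  then show False using *(4) \<open>p \<noteq> q\<close> unfolding cmp_def by blast
qed

theorem ACA0_imp_no_antichain_principle: "M \<Turnstile> {no_antichain_principle}"
  unfolding models_no_antichain_principle
proof (intro ballI impI, elim conjE)
  fix P L assume "P \<in> Sets M" "L \<in> Sets M" "partial_order P L" and inf: "\<not> bdd P"
    and "\<not> (\<exists>A\<in>Sets M. antichain P L A \<and> \<not> bdd A)"
  then interpret fac_order M P L by unfold_locales auto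
  show "\<exists>C\<in>Sets M. homogeneous P L C" by (rule homogeneous_chain_exists[OF inf])
qed

theorem ACA0_imp_wpo_principle: "M \<Turnstile> {wpo_principle}"
  unfolding models_wpo_principle
proof (intro ballI impI, elim conjE)
  fix P L assume PL: "P \<in> Sets M" "L \<in> Sets M" and wpo: "well_partial_order P L" and inf: "\<not> bdd P"
  have "partial_order P L" using wpo unfolding well_partial_order_def by blast
  moreover have "\<not> (\<exists>A\<in>Sets M. antichain P L A \<and> \<not> bdd A)"
    using well_partial_order_antichains_bounded[OF wpo] by blast
  ultimately show "\<exists>C\<in>Sets M. homogeneous P L C"
    using ACA0_imp_no_antichain_principle PL inf unfolding models_no_antichain_principle by blast
qed

end

theorem theorem7p8:
  fixes M :: "'a L2_structure"
  assumes "Sets M \<noteq> {}" and "M \<Turnstile> RCA0"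
  shows "(M \<Turnstile> ACA0 \<longleftrightarrow> M \<Turnstile> {no_antichain_principle}) \<and>
         (M \<Turnstile> ACA0 \<longleftrightarrow> M \<Turnstile> {wpo_principle})"
proof -
  interpret rca0_model M using assms by unfold_locales
  have "aca0_model M" if "M \<Turnstile> ACA0" using that by unfold_locales
  then show ?thesis
    using aca0_model.ACA0_imp_no_antichain_principle aca0_model.ACA0_imp_wpo_principle
      no_antichain_principle_imp_ACA0 wpo_principle_imp_ACA0 by blast
qed

end
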